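(* The space $\mathcal U_{\star\mathbb H}^{\mathcal L}$ of $\Lambda$-local $\star$-quaternionic unitaries (defined in the context) has exactly two path components. The map $\mathrm{ind}_{\Lambda,2}:\mathcal U_{\star\mathbb H}^{\mathcal L}\to\mathbb Z_2$ is norm continuous and descends to a bijection $$\mathrm{ind}_{\Lambda,2}:\pi_0(\mathcal U_{\star\mathbb H}^{\mathcal L})\xrightarrow{\ \sim\ }\mathbb Z_2 .$$
   Context: $\mathcal H$ is an infinite-dimensional separable complex Hilbert space, $\mathcal B$ its bounded linear operators with the operator norm topology, $\mathcal K$ the compact operators. $\Lambda\in\mathcal B$ is a fixed self-adjoint projection whose range and kernel are both infinite-dimensional. $A\in\mathcal B$ is called $\Lambda$-local iff $\Lambda A-A\Lambda\in\mathcal K$; $\mathcal L$ is the set of all $\Lambda$-local operators. $J:\mathcal H\to\mathcal H$ is a fixed anti-unitary operator with $J^2=-\mathbb 1$ and $J\Lambda=\Lambda J$. $\mathcal U_{\star\mathbb H}^{\mathcal L}$ is the set of unitaries $U\in\mathcal L$ with $UJ=JU^*$, with the subspace topology from the operator norm. For $U\in\mathcal U_{\star\mathbb H}^{\mathcal L}$ the operator $\Lambda U\Lambda+\mathbb 1-\Lambda$ is Fredholm, and $\mathrm{ind}_{\Lambda,2}(U):=\dim\ker(\Lambda U\Lambda+\mathbb 1-\Lambda)\bmod 2\in\mathbb Z_2$. $\pi_0$ denotes the set of path components. *)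

theory Defs
  imports "HOL-Analysis.Analysis" "HOL-Library.Z2"
begin

text \<open>
  Complex Hilbert spaces. The underlying real Hilbert space structure (which provides the norm and
  the topology) is the one given by the real part of the complex inner product. The complex inner
  product is conjugate-linear in the first and linear in the second argument.
\<close>

class complex_hilbert_space = real_inner + complete_space +
  fixes scaleC :: "complex \<Rightarrow> 'a \<Rightarrow> 'a"  (infixr \<open>*\<^sub>C\<close> 75)
    and cinner :: "'a \<Rightarrow> 'a \<Rightarrow> complex"
  assumes scaleC_add_right: "c *\<^sub>C (x + y) = c *\<^sub>C x + c *\<^sub>C y"
    and scaleC_add_left: "(c + d) *\<^sub>C x = c *\<^sub>C x + d *\<^sub>C x"
    and scaleC_scaleC: "c *\<^sub>C (d *\<^sub>C x) = (c * d) *\<^sub>C x"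
    and scaleR_scaleC: "r *\<^sub>R x = complex_of_real r *\<^sub>C x"
    and cinner_commute: "cinner x y = cnj (cinner y x)"
    and cinner_add_right: "cinner x (y + z) = cinner x y + cinner x z"
    and cinner_scaleC_right: "cinner x (c *\<^sub>C y) = c * cinner x y"
    and inner_eq_Re_cinner: "inner x y = Re (cinner x y)"

instantiation complex :: complex_hilbert_space
begin
definition "scaleC_complex c x = c * (x :: complex)"
definition "cinner_complex x y = cnj x * (y :: complex)"
instance
  by standard (auto simp: scaleC_complex_def cinner_complex_def algebra_simps
      scaleR_conv_of_real inner_complex_def)
end

global_interpretation complex_vector:
  vector_space "scaleC :: complex \<Rightarrow> 'a \<Rightarrow> 'a::complex_hilbert_space"
proof
  fix x :: 'a
  show "1 *\<^sub>C x = x"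
    using scaleR_scaleC[of 1 x] by simp
qed (simp_all add: scaleC_add_right scaleC_add_left scaleC_scaleC)

definition cfinite_dim :: "'a::complex_hilbert_space set \<Rightarrow> bool" where
  "cfinite_dim S \<longleftrightarrow> (\<exists>B. finite B \<and> S \<subseteq> complex_vector.span B)"

text \<open>
  The bounded complex-linear operators are the complex-homogeneous elements of the type of bounded
  real-linear maps; the norm of that type is the operator norm.
\<close>

definition bounded_ops :: "('a::complex_hilbert_space \<Rightarrow>\<^sub>L 'a) set" where
  "bounded_ops = {A. \<forall>c x. blinfun_apply A (c *\<^sub>C x) = c *\<^sub>C blinfun_apply A x}"

definition compact_ops :: "('a::complex_hilbert_space \<Rightarrow>\<^sub>L 'a) set" where
  "compact_ops = {A \<in> bounded_ops. compact (closure (blinfun_apply A ` cball 0 1))}"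

text \<open>For bounded complex-linear operators the adjoint exists by the Riesz representation theorem.\<close>

definition cadj :: "('a::complex_hilbert_space \<Rightarrow>\<^sub>L 'a) \<Rightarrow> ('a \<Rightarrow>\<^sub>L 'a)" where
  "cadj A = (THE B. \<forall>x y. cinner (blinfun_apply B x) y = cinner x (blinfun_apply A y))"

definition unitary_ops :: "('a::complex_hilbert_space \<Rightarrow>\<^sub>L 'a) set" where
  "unitary_ops =
    {U \<in> bounded_ops. cadj U o\<^sub>L U = id_blinfun \<and> U o\<^sub>L cadj U = id_blinfun}"

definition sa_projection :: "('a::complex_hilbert_space \<Rightarrow>\<^sub>L 'a) \<Rightarrow> bool" where
  "sa_projection P \<longleftrightarrow> P \<in> bounded_ops \<and> P o\<^sub>L P = P \<and> cadj P = P"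

definition local_ops ::
  "('a::complex_hilbert_space \<Rightarrow>\<^sub>L 'a) \<Rightarrow> ('a \<Rightarrow>\<^sub>L 'a) set" where
  "local_ops \<Lambda> = {A \<in> bounded_ops. (\<Lambda> o\<^sub>L A) - (A o\<^sub>L \<Lambda>) \<in> compact_ops}"

definition antiunitary :: "('a::complex_hilbert_space \<Rightarrow> 'a) \<Rightarrow> bool" where
  "antiunitary J \<longleftrightarrow>
    (\<forall>x y. J (x + y) = J x + J y) \<and> (\<forall>c x. J (c *\<^sub>C x) = cnj c *\<^sub>C J x) \<and>
    surj J \<and> (\<forall>x y. cinner (J x) (J y) = cnj (cinner x y))"

definition star_quaternionic_local_unitaries ::
  "('a::complex_hilbert_space \<Rightarrow>\<^sub>L 'a) \<Rightarrow> ('a \<Rightarrow> 'a) \<Rightarrow> ('a \<Rightarrow>\<^sub>L 'a) set" where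
  "star_quaternionic_local_unitaries \<Lambda> J =
    {U \<in> unitary_ops \<inter> local_ops \<Lambda>.
      \<forall>x. blinfun_apply U (J x) = J (blinfun_apply (cadj U) x)}"

text \<open>
  The two-element field \<^typ>\<open>bit\<close> serves as the integers modulo 2; \<^const>\<open>of_nat\<close> is reduction
  modulo 2. The dimension is the complex one; library convention sets it to 0 for
  infinite-dimensional spaces, which do not occur here because the operator is Fredholm.
\<close>

definition index2 ::
  "('a::complex_hilbert_space \<Rightarrow>\<^sub>L 'a) \<Rightarrow> ('a \<Rightarrow>\<^sub>L 'a) \<Rightarrow> bit" where
  "index2 \<Lambda> U = of_nat (complex_vector.dim
    {x. blinfun_apply ((\<Lambda> o\<^sub>L U o\<^sub>L \<Lambda>) + id_blinfun - \<Lambda>) x = 0})"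

end

theory Submission
  imports Defs
begin

text \<open>
  Put \<open>M = J U\<close>. Then \<open>U\<close> is a \<open>\<Lambda>\<close>-local \<open>\<star>\<close>-quaternionic unitary iff \<open>M\<close> is antilinear, skew for the real
  inner product, satisfies \<open>M\<^sup>2 = -1\<close> and commutes with \<open>\<Lambda>\<close> up to a compact operator, and the index is
  the parity of the dimension of the radical of the skew form \<open>\<langle>x, M y\<rangle>\<close> on the range of \<open>\<Lambda>\<close>.

  Restricting a skew Fredholm form to a hyperplane changes the dimension of its radical by one. Cutting
  down to a subspace on which the form is nondegenerate, an open condition, shows that the parity is
  locally constant.

  If the radical has even dimension, a small finite-rank skew perturbation makes the form nondegenerate
  on the range of \<open>\<Lambda>\<close>; block elimination then deforms \<open>M\<close> to an invertible skew operator commuting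
  with \<open>\<Lambda>\<close>, the phase in the polar decomposition makes the path unitary, and \<open>J\<close> is reached through the
  sign of the imaginary part of \<open>U\<close>. Conjugation by a unitary \<open>W\<close> mapping the range of \<open>\<Lambda>\<close> onto a
  hyperplane of itself exchanges the two parities, so the odd structures are connected as well.
\<close>

section \<open>Complex Hilbert spaces as real Hilbert spaces\<close>

text \<open>The relation U J = J U^* does not restrict to hyperplanes of the range of \<Lambda>,
  which need not be J-invariant. Skewness of M = J U does, so the argument is carried out for M and
  an arbitrary projection P. Skewness refers to the real inner product because M is antilinear;
  operators are real-linear by type, and their behaviour under i is tracked separately.

  Two constructions have different reach. Square roots are norm limits of polynomials, so they keep
  commutators with P compact, and the phase can be taken along any path of invertible forms. The
  sign of a self-adjoint operator is discontinuous at 0 and gives no control over commutators modulo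
  compacts; it respects only what commutes exactly. Hence a form is first deformed until it commutes
  with P exactly. The obstruction to this is the radical on the range of P, which can be removed
  only two dimensions at a time.

  A structure commuting with P has zero radical, so the odd class contains no base point of that
  kind; the shift supplies one.\<close>

instance complex_hilbert_space \<subseteq> banach ..

lemma cinner_add_left: "cinner (x + y) z = cinner x z + cinner (y :: 'a::complex_hilbert_space) z"
  by (metis cinner_add_right cinner_commute complex_cnj_add)

lemma cinner_scaleC_left: "cinner (c *\<^sub>C x) y = cnj c * cinner (x :: 'a::complex_hilbert_space) y"
  by (metis cinner_commute cinner_scaleC_right complex_cnj_mult)

lemma Re_cinner: "Re (cinner x y) = inner x (y :: 'a::complex_hilbert_space)"
  by (simp add: inner_eq_Re_cinner)

lemma Im_cinner: "Im (cinner x y) = - inner x (\<i> *\<^sub>C (y :: 'a::complex_hilbert_space))"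
  by (simp add: inner_eq_Re_cinner cinner_scaleC_right)

lemma cinner_eqI:
  fixes a b c d :: "'a::complex_hilbert_space"
  assumes "inner a b = inner c d" "inner a (\<i> *\<^sub>C b) = inner c (\<i> *\<^sub>C d)"
  shows "cinner a b = cinner c d"
  using assms by (intro complex_eqI) (simp_all add: Re_cinner Im_cinner)

lemma cinner_self: "cinner x x = complex_of_real ((norm (x :: 'a::complex_hilbert_space))\<^sup>2)"
proof (rule complex_eqI)
  have "cinner x x = cnj (cinner x x)" by (rule cinner_commute)
  then show "Im (cinner x x) = Im (complex_of_real ((norm x)\<^sup>2))"
    by (metis Im_complex_of_real Reals_cnj_iff complex_is_Real_iff)
qed (simp add: Re_cinner power2_norm_eq_inner)

lemma norm_scaleC: "norm (c *\<^sub>C (x :: 'a::complex_hilbert_space)) = cmod c * norm x"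
proof -
  have "complex_of_real ((norm (c *\<^sub>C x))\<^sup>2) = (c * cnj c) * complex_of_real ((norm x)\<^sup>2)"
    by (simp only: cinner_self[symmetric] cinner_scaleC_left cinner_scaleC_right mult_ac)
  also have "\<dots> = complex_of_real ((cmod c * norm x)\<^sup>2)"
    by (simp add: complex_norm_square[symmetric] power_mult_distrib)
  finally have "complex_of_real ((norm (c *\<^sub>C x))\<^sup>2) = complex_of_real ((cmod c * norm x)\<^sup>2)" .
  then have "(norm (c *\<^sub>C x))\<^sup>2 = (cmod c * norm x)\<^sup>2" using of_real_eq_iff by blast
  then show ?thesis by (simp add: power2_eq_iff_nonneg)
qed

lemma norm_cinner_le: "cmod (cinner x y) \<le> norm x * norm (y :: 'a::complex_hilbert_space)"
proof -
  \<comment> \<open>A unit scalar that rotates \<open>cinner x y\<close> onto the nonnegative real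
    axis, so that the real Cauchy-Schwarz inequality bounds the modulus.\<close>
  obtain c where c: "cmod c = 1" "c * cinner x y = complex_of_real (cmod (cinner x y))"
  proof (cases "cinner x y = 0")
    case True
    then show ?thesis using that[of 1] by simp
  next
    case False
    let ?z = "cinner x y"
    have "cnj ?z / of_real (cmod ?z) * ?z = of_real (cmod ?z)"
      using False by (simp add: field_simps complex_norm_square[symmetric] power2_eq_square)
    then show ?thesis using that[of "cnj ?z / of_real (cmod ?z)"] False by (simp add: norm_divide)
  qed
  have "cmod (cinner x y) = Re (cinner x (c *\<^sub>C y))" using c by (simp add: cinner_scaleC_right)
  also have "\<dots> = inner x (c *\<^sub>C y)" by (simp add: Re_cinner)
  also have "\<dots> \<le> norm x * norm (c *\<^sub>C y)" by (rule norm_cauchy_schwarz)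
  finally show ?thesis using c by (simp add: norm_scaleC)
qed

interpretation cinner: bounded_bilinear "cinner :: 'a::complex_hilbert_space \<Rightarrow> 'a \<Rightarrow> complex"
proof
  show "\<exists>K. \<forall>a b :: 'a. cmod (cinner a b) \<le> norm a * norm b * K"
    by (rule exI[of _ 1]) (simp add: norm_cinner_le)
qed (simp_all add: cinner_add_left cinner_add_right scaleR_scaleC cinner_scaleC_left
    cinner_scaleC_right scaleC_complex_def)

interpretation scaleC: bounded_bilinear "scaleC :: complex \<Rightarrow> 'a \<Rightarrow> 'a::complex_hilbert_space"
proof
  show "\<exists>K. \<forall>a. \<forall>b :: 'a. norm (a *\<^sub>C b) \<le> norm a * norm b * K"
    by (rule exI[of _ 1]) (simp add: norm_scaleC)
qed (simp_all add: scaleC_add_left scaleC_add_right scaleR_scaleC scaleC_scaleC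
    scaleC_complex_def mult_ac)

lemma scaleC_eq_Re_Im: "c *\<^sub>C x = Re c *\<^sub>R x + Im c *\<^sub>R (\<i> *\<^sub>C (x :: 'a::complex_hilbert_space))"
proof -
  have "c = of_real (Re c) + of_real (Im c) * \<i>" by (simp add: complex_eq mult.commute)
  then have "c *\<^sub>C x = (of_real (Re c) + of_real (Im c) * \<i>) *\<^sub>C x" by simp
  then show ?thesis by (simp add: scaleR_scaleC scaleC_add_left scaleC_scaleC)
qed

lemma inner_i_left: "inner (\<i> *\<^sub>C x) y = - inner x (\<i> *\<^sub>C (y :: 'a::complex_hilbert_space))"
  by (simp add: inner_eq_Re_cinner cinner_scaleC_left cinner_scaleC_right)

text \<open>Multiplication by i as a bounded operator, so that statements about everything commuting
  with a given operator can be applied to it and yield complex linearity.\<close>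

definition iop :: "'a::complex_hilbert_space \<Rightarrow>\<^sub>L 'a" where
  "iop = Blinfun (scaleC \<i>)"

lemma iop_apply [simp]: "iop x = \<i> *\<^sub>C x"
  by (simp add: iop_def bounded_linear_Blinfun_apply scaleC.bounded_linear_right)

text \<open>Real scalars are covered by the type, so only the scalar i is left to check.\<close>

lemma bounded_opsI:
  fixes A :: "'a::complex_hilbert_space \<Rightarrow>\<^sub>L 'a"
  assumes "\<And>x. A (\<i> *\<^sub>C x) = \<i> *\<^sub>C A x"
  shows "A \<in> bounded_ops"
proof -
  have "A (c *\<^sub>C x) = c *\<^sub>C A x" for c x
    by (subst (1 2) scaleC_eq_Re_Im) (simp add: blinfun.bilinear_simps assms)
  then show ?thesis by (simp add: bounded_ops_def)
qed

lemma bounded_ops_scaleC: "A \<in> bounded_ops \<Longrightarrow> A (c *\<^sub>C x) = c *\<^sub>C A x"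
  by (simp add: bounded_ops_def)

section \<open>Orthogonal projections, Riesz representation and adjoints over the reals\<close>

lemma exists_nearest_point:
  fixes V :: "'a::{real_inner,complete_space} set"
  assumes V: "subspace V" "closed V"
  shows "\<exists>p\<in>V. \<forall>v\<in>V. inner (x - p) v = 0"
proof -
  define D where "D = Inf ((\<lambda>v. (norm (x - v))\<^sup>2) ` V)"
  have ne: "(\<lambda>v. (norm (x - v))\<^sup>2) ` V \<noteq> {}" using V(1) subspace_0 by blast
  have bd: "bdd_below ((\<lambda>v. (norm (x - v))\<^sup>2) ` V)" by (rule bdd_belowI[of _ 0]) auto
  have D: "D \<le> (norm (x - v))\<^sup>2" if "v \<in> V" for v
    unfolding D_def using that bd by (auto intro: cInf_lower)
  have "\<exists>v\<in>V. (norm (x - v))\<^sup>2 < D + 1 / Suc n" for n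
  proof -
    have "Inf ((\<lambda>v. (norm (x - v))\<^sup>2) ` V) < D + 1 / Suc n" by (simp add: D_def)
    then show ?thesis using cInf_lessD[OF ne] by blast
  qed
  then obtain v where v: "\<And>n. v n \<in> V" "\<And>n. (norm (x - v n))\<^sup>2 < D + 1 / Suc n" by metis
  \<comment> \<open>Parallelogram law: the midpoint lies in V and so has squared distance at least D
    from x, which forces near-minimisers together.\<close>
  have par: "(norm (v m - v n))\<^sup>2 \<le> 2 / Suc m + 2 / Suc n" for m n
  proof -
    have "(1/2) *\<^sub>R (v m + v n) \<in> V" using V(1) v(1) by (simp add: subspace_add subspace_scale)
    from D[OF this] have "4 * D \<le> 4 * (norm (x - (1/2) *\<^sub>R (v m + v n)))\<^sup>2" by simp
    also have "\<dots> = (norm (2 *\<^sub>R (x - (1/2) *\<^sub>R (v m + v n))))\<^sup>2"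
      by (simp only: norm_scaleR power_mult_distrib) simp
    also have "2 *\<^sub>R (x - (1/2) *\<^sub>R (v m + v n)) = (x - v m) + (x - v n)"
      by (simp add: scaleR_diff_right scaleR_add_right scaleR_2)
    finally have "4 * D \<le> (norm ((x - v m) + (x - v n)))\<^sup>2" .
    moreover have "(norm ((x - v m) + (x - v n)))\<^sup>2 + (norm ((x - v n) - (x - v m)))\<^sup>2
        = 2 * (norm (x - v m))\<^sup>2 + 2 * (norm (x - v n))\<^sup>2"
      by (simp add: power2_norm_eq_inner inner_add inner_diff inner_commute)
    moreover have "(x - v n) - (x - v m) = v m - v n" by simp
    ultimately have "(norm (v m - v n))\<^sup>2 \<le> 2 * (norm (x - v m))\<^sup>2 + 2 * (norm (x - v n))\<^sup>2 - 4 * D"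
      by simp
    also have "\<dots> \<le> 2 / Suc m + 2 / Suc n" using v(2)[of m] v(2)[of n] by simp
    finally show ?thesis .
  qed
  have "Cauchy v"
  proof (rule CauchyI)
    fix e :: real assume "e > 0"
    then obtain N where N: "4 / e\<^sup>2 < real N" using reals_Archimedean2 by blast
    have "norm (v m - v n) < e" if "m \<ge> N" "n \<ge> N" for m n
    proof -
      have pos: "0 < 4 / e\<^sup>2" using \<open>e > 0\<close> by simp
      then have N0: "real N > 0" using N by linarith
      have "2 / Suc m \<le> 2 / real N" "2 / Suc n \<le> 2 / real N"
        using that N0 by (simp_all add: frac_le)
      then have "(norm (v m - v n))\<^sup>2 \<le> 4 / real N" using par[of m n] by simp
      also have "\<dots> < e\<^sup>2" using N N0 \<open>e > 0\<close> by (simp add: field_simps)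
      finally show ?thesis using \<open>e > 0\<close> by (simp add: power2_less_imp_less)
    qed
    then show "\<exists>M. \<forall>m\<ge>M. \<forall>n\<ge>M. norm (v m - v n) < e" by blast
  qed
  then obtain p where p: "v \<longlonglongrightarrow> p" by (metis Cauchy_convergent_iff convergent_def)
  have "p \<in> V" using closed_sequentially[OF V(2) _ p] v(1) by auto
  moreover have pD: "(norm (x - p))\<^sup>2 \<le> D"
  proof (rule LIMSEQ_le)
    show "(\<lambda>n. (norm (x - v n))\<^sup>2) \<longlonglongrightarrow> (norm (x - p))\<^sup>2" by (intro tendsto_intros p)
    show "(\<lambda>n. D + 1 / Suc n) \<longlonglongrightarrow> D"
      using tendsto_add[OF tendsto_const LIMSEQ_Suc[OF lim_1_over_n], of D] by simp
    show "\<exists>N. \<forall>n\<ge>N. (norm (x - v n))\<^sup>2 \<le> D + 1 / Suc n" using v(2) less_imp_le by blast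
  qed
  moreover have "inner (x - p) w = 0" if w: "w \<in> V" for w
  proof (cases "w = 0")
    case False
    \<comment> \<open>The minimiser over t of the squared norm of
      \<open>(x - p) - t *\<^sub>R w\<close>; a nonzero inner product would beat the infimum
      D.\<close>
    define t where "t = inner (x - p) w / (norm w)\<^sup>2"
    have ex: "(norm (u - t *\<^sub>R w))\<^sup>2 = (norm u)\<^sup>2 - 2 * t * inner u w + t\<^sup>2 * (norm w)\<^sup>2" for u
      unfolding power2_norm_eq_inner
      by (simp add: inner_diff inner_commute power2_eq_square algebra_simps)
    have "p + t *\<^sub>R w \<in> V" using \<open>p \<in> V\<close> w V(1) by (simp add: subspace_add subspace_scale)
    from D[OF this] pD have "(norm (x - p))\<^sup>2 \<le> (norm ((x - p) - t *\<^sub>R w))\<^sup>2"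
      unfolding diff_diff_eq by linarith
    also have "\<dots> = (norm (x - p))\<^sup>2 - 2 * t * inner (x - p) w + t\<^sup>2 * (norm w)\<^sup>2"
      by (rule ex)
    also have "\<dots> = (norm (x - p))\<^sup>2 - (inner (x - p) w)\<^sup>2 / (norm w)\<^sup>2"
      using False by (simp add: t_def power2_eq_square field_simps)
    finally have "(inner (x - p) w)\<^sup>2 / (norm w)\<^sup>2 \<le> 0" by simp
    then show ?thesis using False by (simp add: divide_le_0_iff)
  qed simp
  ultimately show ?thesis by blast
qed

lemma exists_proj_blinfun:
  fixes V :: "'a::{real_inner,complete_space} set"
  assumes V: "subspace V" "closed V"
  obtains p :: "'a \<Rightarrow>\<^sub>L 'a" where "\<And>x. p x \<in> V" "\<And>x v. v \<in> V \<Longrightarrow> inner (x - p x) v = 0"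
proof -
  obtain p where p: "\<And>x. p x \<in> V" "\<And>x v. v \<in> V \<Longrightarrow> inner (x - p x) v = 0"
    using exists_nearest_point[OF V] by metis
  have uniq: "p x = q" if "q \<in> V" "\<And>v. v \<in> V \<Longrightarrow> inner (x - q) v = 0" for x q
  proof -
    have d: "p x - q \<in> V" using p(1) that(1) V(1) by (simp add: subspace_diff)
    have "inner (p x - q) (p x - q) = inner (x - q) (p x - q) - inner (x - p x) (p x - q)"
      by (simp add: inner_diff)
    also have "\<dots> = 0" using that(2)[OF d] p(2)[OF d] by simp
    finally show ?thesis by simp
  qed
  have "bounded_linear p"
  proof (rule bounded_linear_intro[where K=1])
    show "p (x + y) = p x + p y" for x y
    proof (rule uniq)
      fix v assume "v \<in> V"
      then show "inner (x + y - (p x + p y)) v = 0"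
        using p(2)[of v x] p(2)[of v y] by (simp add: inner_diff inner_add)
    qed (use p(1) V(1) in \<open>simp add: subspace_add\<close>)
    show "p (r *\<^sub>R x) = r *\<^sub>R p x" for r x
    proof (rule uniq)
      fix v assume "v \<in> V"
      then have "inner (r *\<^sub>R (x - p x)) v = 0" using p(2)[of v x] by simp
      then show "inner (r *\<^sub>R x - r *\<^sub>R p x) v = 0" by (simp add: scaleR_diff_right)
    qed (use p(1) V(1) in \<open>simp add: subspace_scale\<close>)
    show "norm (p x) \<le> norm x * 1" for x
    proof -
      have "inner (p x) (p x) = inner x (p x)" using p(2)[OF p(1), of x x] by (simp add: inner_diff)
      also have "\<dots> \<le> norm x * norm (p x)" by (rule norm_cauchy_schwarz)
      finally have "norm (p x) * norm (p x) \<le> norm x * norm (p x)" by (simp add: norm_eq_sqrt_inner)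
      then show ?thesis by (cases "p x = 0") auto
    qed
  qed
  then show thesis using that[of "Blinfun p"] p by (simp add: bounded_linear_Blinfun_apply)
qed

lemma riesz_representation:
  fixes f :: "'a::{real_inner,complete_space} \<Rightarrow> real"
  assumes f: "bounded_linear f"
  shows "\<exists>a. \<forall>x. f x = inner a x"
proof (cases "\<forall>x. f x = 0")
  case True
  then show ?thesis by (intro exI[of _ 0]) simp
next
  case False
  then obtain x0 where x0: "f x0 \<noteq> 0" by blast
  interpret f: bounded_linear f by (rule f)
  let ?V = "{x. f x = 0}"
  have V: "subspace ?V" by (simp add: subspace_def f.zero f.add f.scaleR)
  have "closed ?V"
    by (intro closed_Collect_eq continuous_intros linear_continuous_on f)
  then obtain p where p: "p \<in> ?V" "\<forall>v\<in>?V. inner (x0 - p) v = 0"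
    using exists_nearest_point[OF V] by blast
  define w where "w = x0 - p"
  have fw: "f w = f x0" using p by (simp add: w_def f.diff)
  then have w: "w \<noteq> 0" using x0 f.zero by auto
  have "f x = inner ((f w / (norm w)\<^sup>2) *\<^sub>R w) x" for x
  proof -
    have "f (x - (f x / f w) *\<^sub>R w) = 0" using x0 fw by (simp add: f.diff f.scaleR)
    then have "inner w (x - (f x / f w) *\<^sub>R w) = 0" using p by (simp add: w_def)
    then have "inner w x = (f x / f w) * (norm w)\<^sup>2" by (simp add: inner_diff power2_norm_eq_inner)
    then show ?thesis using w fw x0 by simp
  qed
  then show ?thesis by blast
qed

lemma exists_adjoint_blinfun:
  fixes A :: "'a::{real_inner,complete_space} \<Rightarrow>\<^sub>L 'a"
  obtains B :: "'a \<Rightarrow>\<^sub>L 'a" where "\<And>x y. inner (B x) y = inner x (A y)"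
proof -
  have "\<exists>a. \<forall>y. inner x (A y) = inner a y" for x
    by (intro riesz_representation bounded_linear_intros)
  then obtain B where B: "\<And>x y. inner x (A y) = inner (B x) y" by metis
  have "bounded_linear B"
  proof (rule bounded_linear_intro[where K="norm A"])
    show "B (x + y) = B x + B y" for x y
      by (rule vector_eq_rdot[THEN iffD1]) (simp add: B[symmetric] inner_add)
    show "B (r *\<^sub>R x) = r *\<^sub>R B x" for r x
      by (rule vector_eq_rdot[THEN iffD1]) (simp add: B[symmetric])
    show "norm (B x) \<le> norm x * norm A" for x
    proof -
      have "norm (B x) * norm (B x) = inner (B x) (B x)" by (simp add: norm_eq_sqrt_inner)
      also have "\<dots> = inner x (A (B x))" by (simp add: B)
      also have "\<dots> \<le> norm x * norm (A (B x))" by (rule norm_cauchy_schwarz)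
      also have "\<dots> \<le> norm x * (norm A * norm (B x))" by (intro mult_left_mono norm_blinfun) auto
      finally have "norm (B x) * norm (B x) \<le> (norm x * norm A) * norm (B x)" by (simp add: mult_ac)
      then show ?thesis by (cases "B x = 0") auto
    qed
  qed
  then show thesis using that[of "Blinfun B"] B by (simp add: bounded_linear_Blinfun_apply)
qed

lemma cadj_eqI:
  fixes A B :: "'a::complex_hilbert_space \<Rightarrow>\<^sub>L 'a"
  assumes "\<And>x y. cinner (B x) y = cinner x (A y)"
  shows "cadj A = B"
  unfolding cadj_def
proof (rule the_equality)
  fix C assume C: "\<forall>x y. cinner (blinfun_apply C x) y = cinner x (A y)"
  have "C x = B x" for x
  proof -
    have "inner (C x) y = inner (B x) y" for y
      using C assms by (simp add: inner_eq_Re_cinner)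
    then show ?thesis by (metis vector_eq_rdot)
  qed
  then show "C = B" by (rule blinfun_eqI)
qed (use assms in blast)

text \<open>The real adjoint of a complex-linear operator is also its adjoint for
  \<open>cinner\<close>, which gives the definite description in \<open>cadj\<close> its
  meaning.\<close>

lemma cinner_cadj:
  fixes A :: "'a::complex_hilbert_space \<Rightarrow>\<^sub>L 'a"
  assumes A: "A \<in> bounded_ops"
  shows "cinner (cadj A x) y = cinner x (A y)"
proof -
  obtain B where B: "\<And>x y. inner (blinfun_apply B x) y = inner x (A y)"
    using exists_adjoint_blinfun[of A] by blast
  have "cinner (B x) y = cinner x (A y)" for x y
    by (rule cinner_eqI) (simp_all add: B bounded_ops_scaleC[OF A])
  then show ?thesis using cadj_eqI[of B A] by simp
qed

lemma inner_cadj: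
  fixes A :: "'a::complex_hilbert_space \<Rightarrow>\<^sub>L 'a"
  assumes A: "A \<in> bounded_ops"
  shows "inner (cadj A x) y = inner x (A y)"
  by (simp add: inner_eq_Re_cinner cinner_cadj A)

section \<open>Compact operators\<close>

text \<open>Unlike \<open>compact_ops\<close> this does not include complex linearity, since
  commutators of P with the antilinear M have to be covered.\<close>

definition compact_op :: "('a::real_normed_vector \<Rightarrow>\<^sub>L 'b::real_normed_vector) \<Rightarrow> bool" where
  "compact_op A \<longleftrightarrow> compact (closure (A ` cball 0 1))"

lemma compact_op_iff_totally_bounded:
  fixes A :: "'a::real_normed_vector \<Rightarrow>\<^sub>L 'b::banach"
  shows "compact_op A \<longleftrightarrow> (\<forall>e>0. \<exists>k. finite k \<and> A ` cball 0 1 \<subseteq> (\<Union>x\<in>k. ball x e))"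
    (is "_ \<longleftrightarrow> ?tb")
proof
  assume "compact_op A"
  then have "\<forall>e>0. \<exists>k. finite k \<and> closure (A ` cball 0 1) \<subseteq> (\<Union>x\<in>k. ball x e)"
    unfolding compact_op_def compact_eq_totally_bounded by simp
  then show ?tb by (meson closure_subset subset_trans)
next
  assume tb: ?tb
  have "\<exists>k. finite k \<and> closure (A ` cball 0 1) \<subseteq> (\<Union>x\<in>k. ball x e)" if e: "e > 0" for e
  proof -
    obtain k where k: "finite k" "A ` cball 0 1 \<subseteq> (\<Union>x\<in>k. ball x (e/2))"
      using tb[rule_format, of "e/2"] e by auto
    have "closure (A ` cball 0 1) \<subseteq> (\<Union>x\<in>k. cball x (e/2))"
    proof (intro closure_minimal closed_UN)
      show "A ` cball 0 1 \<subseteq> (\<Union>x\<in>k. cball x (e/2))"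
        by (rule subset_trans[OF k(2)]) (rule UN_mono[OF subset_refl ball_subset_cball])
    qed (use k(1) in auto)
    also have "\<dots> \<subseteq> (\<Union>x\<in>k. ball x e)" using e by auto
    finally show ?thesis using k by blast
  qed
  then show "compact_op A"
    unfolding compact_op_def compact_eq_totally_bounded by (simp add: complete_eq_closed)
qed

lemma compact_opD:
  fixes A :: "'a::real_normed_vector \<Rightarrow>\<^sub>L 'b::banach"
  assumes "compact_op A" "e > 0"
  obtains k where "finite k" "\<And>x. norm x \<le> 1 \<Longrightarrow> \<exists>y\<in>k. norm (A x - y) < e"
proof -
  obtain k where "finite k" "A ` cball 0 1 \<subseteq> (\<Union>x\<in>k. ball x e)"
    using assms unfolding compact_op_iff_totally_bounded by blast
  then show thesis using that[of k] by (auto simp: dist_norm norm_minus_commute image_subset_iff)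
qed

lemma compact_opI:
  fixes A :: "'a::real_normed_vector \<Rightarrow>\<^sub>L 'b::banach"
  assumes "\<And>e. e > 0 \<Longrightarrow> \<exists>k. finite k \<and> (\<forall>x. norm x \<le> 1 \<longrightarrow> (\<exists>y\<in>k. norm (A x - y) < e))"
  shows "compact_op A"
  unfolding compact_op_iff_totally_bounded
proof (intro allI impI)
  fix e :: real assume "e > 0"
  then obtain k where k: "finite k" "\<forall>x. norm x \<le> 1 \<longrightarrow> (\<exists>y\<in>k. norm (A x - y) < e)"
    using assms by blast
  then show "\<exists>k. finite k \<and> A ` cball 0 1 \<subseteq> (\<Union>x\<in>k. ball x e)"
    by (intro exI[of _ k]) (auto simp: dist_norm norm_minus_commute)
qed

lemma compact_op_add:
  fixes A B :: "'a::real_normed_vector \<Rightarrow>\<^sub>L 'b::banach"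
  assumes "compact_op A" "compact_op B"
  shows "compact_op (A + B)"
proof (rule compact_opI)
  fix e :: real assume "e > 0"
  obtain k where k: "finite k" "\<And>x. norm x \<le> 1 \<Longrightarrow> \<exists>y\<in>k. norm (A x - y) < e/2"
    using compact_opD[OF assms(1), of "e/2"] \<open>e > 0\<close> by auto
  obtain l where l: "finite l" "\<And>x. norm x \<le> 1 \<Longrightarrow> \<exists>y\<in>l. norm (B x - y) < e/2"
    using compact_opD[OF assms(2), of "e/2"] \<open>e > 0\<close> by auto
  have "\<exists>y\<in>(\<lambda>(a, b). a + b) ` (k \<times> l). norm ((A + B) x - y) < e" if x: "norm x \<le> 1" for x
  proof -
    obtain a b where ab: "a \<in> k" "norm (A x - a) < e/2" "b \<in> l" "norm (B x - b) < e/2"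
      using k l x by blast
    have "norm ((A + B) x - (a + b)) \<le> norm (A x - a) + norm (B x - b)"
      by (simp add: blinfun.add_left norm_diff_triangle_ineq)
    then have "norm ((A + B) x - (a + b)) < e" using ab by simp
    then show ?thesis using ab by blast
  qed
  then show "\<exists>k. finite k \<and> (\<forall>x. norm x \<le> 1 \<longrightarrow> (\<exists>y\<in>k. norm ((A + B) x - y) < e))"
    using k(1) l(1) by (intro exI[of _ "(\<lambda>(a, b). a + b) ` (k \<times> l)"]) auto
qed

lemma compact_op_compose_left:
  fixes A :: "'a::real_normed_vector \<Rightarrow>\<^sub>L 'b::banach" and B :: "'b \<Rightarrow>\<^sub>L 'c::banach"
  assumes "compact_op A"
  shows "compact_op (B o\<^sub>L A)"
proof (rule compact_opI)
  fix e :: real assume "e > 0"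
  then have "e / (norm B + 1) > 0" by (simp add: add_nonneg_pos)
  then obtain k where k: "finite k" "\<And>x. norm x \<le> 1 \<Longrightarrow> \<exists>y\<in>k. norm (A x - y) < e / (norm B + 1)"
    using compact_opD[OF assms] by blast
  have "\<exists>z\<in>B ` k. norm ((B o\<^sub>L A) x - z) < e" if x: "norm x \<le> 1" for x
  proof -
    obtain y where y: "y \<in> k" "norm (A x - y) < e / (norm B + 1)" using k x by blast
    have "norm ((B o\<^sub>L A) x - B y) = norm (B (A x - y))" by (simp add: blinfun.diff_right)
    also have "\<dots> \<le> norm B * norm (A x - y)" by (rule norm_blinfun)
    also have "\<dots> \<le> (norm B + 1) * norm (A x - y)" by (simp add: algebra_simps)
    also have "\<dots> < (norm B + 1) * (e / (norm B + 1))"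
      using y(2) by (intro mult_strict_left_mono) (auto simp: add_nonneg_pos)
    also have "\<dots> = e" using norm_ge_zero[of B] by (simp add: add_nonneg_pos less_imp_neq[symmetric])
    finally show ?thesis using y by blast
  qed
  then show "\<exists>k. finite k \<and> (\<forall>x. norm x \<le> 1 \<longrightarrow> (\<exists>y\<in>k. norm ((B o\<^sub>L A) x - y) < e))"
    using k by blast
qed

lemma compact_op_compose_right:
  fixes A :: "'b::real_normed_vector \<Rightarrow>\<^sub>L 'c::banach" and B :: "'a::real_normed_vector \<Rightarrow>\<^sub>L 'b"
  assumes "compact_op A"
  shows "compact_op (A o\<^sub>L B)"
proof (rule compact_opI)
  fix e :: real assume "e > 0"
  define c where "c = norm B + 1"
  have c: "c > 0" by (simp add: c_def add_nonneg_pos)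
  then have "e / c > 0" using \<open>e > 0\<close> by simp
  then obtain k where k: "finite k" "\<And>x. norm x \<le> 1 \<Longrightarrow> \<exists>y\<in>k. norm (A x - y) < e / c"
    using compact_opD[OF assms] by blast
  have "\<exists>z\<in>(*\<^sub>R) c ` k. norm ((A o\<^sub>L B) x - z) < e" if x: "norm x \<le> 1" for x
  proof -
    have "norm (B x) \<le> norm B * 1" using norm_blinfun[of B x] x mult_left_mono[OF x, of "norm B"] by simp
    then have "norm ((1/c) *\<^sub>R B x) \<le> 1" using c by (simp add: c_def field_simps)
    then obtain y where y: "y \<in> k" "norm (A ((1/c) *\<^sub>R B x) - y) < e / c" using k by blast
    have "(A o\<^sub>L B) x - c *\<^sub>R y = c *\<^sub>R (A ((1/c) *\<^sub>R B x) - y)"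
      using c by (simp add: blinfun.scaleR_right scaleR_diff_right)
    then have "norm ((A o\<^sub>L B) x - c *\<^sub>R y) = c * norm (A ((1/c) *\<^sub>R B x) - y)" using c by simp
    then have "norm ((A o\<^sub>L B) x - c *\<^sub>R y) < e"
      using y(2) c by (simp add: less_divide_eq mult.commute)
    then show ?thesis using y by blast
  qed
  then show "\<exists>k. finite k \<and> (\<forall>x. norm x \<le> 1 \<longrightarrow> (\<exists>y\<in>k. norm ((A o\<^sub>L B) x - y) < e))"
    using k by blast
qed

lemma compact_op_zero [simp]: "compact_op (0 :: 'a::real_normed_vector \<Rightarrow>\<^sub>L 'b::banach)"
  by (rule compact_opI) (auto intro!: exI[of _ "{0}"])

lemma compact_op_uminus:
  fixes A :: "'a::real_normed_vector \<Rightarrow>\<^sub>L 'b::banach"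
  assumes "compact_op A"
  shows "compact_op (- A)"
proof -
  have "- A = (- id_blinfun) o\<^sub>L A" by (rule blinfun_eqI) (simp add: blinfun.minus_left)
  then show ?thesis using compact_op_compose_left[OF assms] by metis
qed

lemma compact_op_diff:
  fixes A B :: "'a::real_normed_vector \<Rightarrow>\<^sub>L 'b::banach"
  shows "compact_op A \<Longrightarrow> compact_op B \<Longrightarrow> compact_op (A - B)"
  using compact_op_add[of A "- B"] compact_op_uminus[of B] by simp

lemma compact_op_approx:
  fixes A :: "'a::real_normed_vector \<Rightarrow>\<^sub>L 'b::banach"
  assumes "\<And>e. e > 0 \<Longrightarrow> \<exists>B. compact_op B \<and> norm (A - B) < e"
  shows "compact_op A"
proof (rule compact_opI)
  fix e :: real assume "e > 0"
  then obtain B where B: "compact_op B" "norm (A - B) < e/2" using assms[of "e/2"] by auto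
  obtain k where k: "finite k" "\<And>x. norm x \<le> 1 \<Longrightarrow> \<exists>y\<in>k. norm (B x - y) < e/2"
    using compact_opD[OF B(1), of "e/2"] \<open>e > 0\<close> by auto
  have "\<exists>y\<in>k. norm (A x - y) < e" if x: "norm x \<le> 1" for x
  proof -
    obtain y where y: "y \<in> k" "norm (B x - y) < e/2" using k x by blast
    have "norm (A x - y) \<le> norm ((A - B) x) + norm (B x - y)"
      using norm_triangle_ineq[of "(A - B) x" "B x - y"] by (simp add: blinfun.diff_left)
    also have "norm ((A - B) x) \<le> norm (A - B)"
      using norm_blinfun[of "A - B" x] mult_left_mono[OF x, of "norm (A - B)"] by simp
    finally show ?thesis using y B by force
  qed
  then show "\<exists>k. finite k \<and> (\<forall>x. norm x \<le> 1 \<longrightarrow> (\<exists>y\<in>k. norm (A x - y) < e))"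
    using k by blast
qed

lemma compact_op_subsequence:
  fixes A :: "'a::real_normed_vector \<Rightarrow>\<^sub>L 'b::real_normed_vector"
  assumes "compact_op A" "\<And>n. norm (x n) \<le> 1"
  obtains l r where "strict_mono (r :: nat \<Rightarrow> nat)" "(\<lambda>n. A (x (r n))) \<longlonglongrightarrow> l"
proof -
  have "\<forall>n. A (x n) \<in> closure (A ` cball 0 1)"
    using assms(2) by (intro allI subsetD[OF closure_subset]) auto
  then show thesis
    using assms(1) that unfolding compact_op_def compact_eq_seq_compact_metric seq_compact_def
    by (force simp: comp_def)
qed

text \<open>The operator |b><a|. For a unit vector e with P e = e, \<open>P - rank_one e e\<close>
  projects onto the hyperplane of the range of P orthogonal to e.\<close>

definition rank_one :: "'a::complex_hilbert_space \<Rightarrow> 'a \<Rightarrow> ('a \<Rightarrow>\<^sub>L 'a)" where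
  "rank_one a b = Blinfun (\<lambda>x. cinner a x *\<^sub>C b)"

lemma rank_one_apply [simp]: "rank_one a b x = cinner a x *\<^sub>C b"
  unfolding rank_one_def
  by (subst bounded_linear_Blinfun_apply)
    (auto intro: bounded_linear_compose[OF scaleC.bounded_linear_left cinner.bounded_linear_right])

lemma compact_op_rank_one [simp]: "compact_op (rank_one a b)"
proof -
  have "compact ((\<lambda>c. c *\<^sub>C b) ` cball 0 (norm a))"
    by (intro compact_continuous_image compact_cball linear_continuous_on scaleC.bounded_linear_left)
  moreover have "rank_one a b ` cball 0 1 \<subseteq> (\<lambda>c. c *\<^sub>C b) ` cball 0 (norm a)"
  proof (intro image_subsetI)
    fix x :: 'a assume "x \<in> cball 0 1"
    then have "cmod (cinner a x) \<le> norm a"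
      using norm_cinner_le[of a x] mult_left_mono[of "norm x" 1 "norm a"] by simp
    then show "rank_one a b x \<in> (\<lambda>c. c *\<^sub>C b) ` cball 0 (norm a)"
      by (intro rev_image_eqI[of "cinner a x"]) auto
  qed
  ultimately show ?thesis
    unfolding compact_op_def
    by (metis closed_closure closure_minimal compact_Int_closed compact_imp_closed inf.absorb2)
qed

section \<open>The closed algebra of operators commuting with P modulo compacts\<close>

definition commutes_mod_compact :: "('a::banach \<Rightarrow>\<^sub>L 'a) \<Rightarrow> ('a \<Rightarrow>\<^sub>L 'a) \<Rightarrow> bool" where
  "commutes_mod_compact P A \<longleftrightarrow> compact_op ((P o\<^sub>L A) - (A o\<^sub>L P))"

lemma commutes_mod_compactI: "P o\<^sub>L A = A o\<^sub>L P \<Longrightarrow> commutes_mod_compact P A"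
  by (simp add: commutes_mod_compact_def)

lemma commutes_mod_compact_id [simp]: "commutes_mod_compact P id_blinfun"
  by (rule commutes_mod_compactI) (rule blinfun_eqI, simp)

lemma commutes_mod_compact_add:
  assumes "commutes_mod_compact P A" "commutes_mod_compact P B"
  shows "commutes_mod_compact P (A + B)"
proof -
  have "(P o\<^sub>L (A + B)) - ((A + B) o\<^sub>L P) = ((P o\<^sub>L A) - (A o\<^sub>L P)) + ((P o\<^sub>L B) - (B o\<^sub>L P))"
    by (rule blinfun_eqI) (simp add: blinfun.bilinear_simps)
  then show ?thesis using assms by (simp add: commutes_mod_compact_def compact_op_add)
qed

lemma commutes_mod_compact_compose:
  assumes "commutes_mod_compact P A" "commutes_mod_compact P B"
  shows "commutes_mod_compact P (A o\<^sub>L B)"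
proof -
  have "(P o\<^sub>L (A o\<^sub>L B)) - ((A o\<^sub>L B) o\<^sub>L P)
      = (((P o\<^sub>L A) - (A o\<^sub>L P)) o\<^sub>L B) + (A o\<^sub>L ((P o\<^sub>L B) - (B o\<^sub>L P)))"
    by (rule blinfun_eqI) (simp add: blinfun.bilinear_simps)
  then show ?thesis using assms
    by (simp add: commutes_mod_compact_def compact_op_add compact_op_compose_left
        compact_op_compose_right)
qed

lemma commutes_mod_compact_scaleR:
  assumes "commutes_mod_compact P A"
  shows "commutes_mod_compact P (r *\<^sub>R A)"
proof -
  have "r *\<^sub>R A = (r *\<^sub>R id_blinfun) o\<^sub>L A"
    by (rule blinfun_eqI) (simp add: blinfun.bilinear_simps)
  moreover have "commutes_mod_compact P (r *\<^sub>R id_blinfun)"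
    by (rule commutes_mod_compactI) (rule blinfun_eqI, simp add: blinfun.bilinear_simps)
  ultimately show ?thesis using assms by (simp add: commutes_mod_compact_compose)
qed

lemma commutes_mod_compact_uminus: "commutes_mod_compact P A \<Longrightarrow> commutes_mod_compact P (- A)"
  using commutes_mod_compact_scaleR[of P A "-1"] by simp

lemma commutes_mod_compact_diff:
  "commutes_mod_compact P A \<Longrightarrow> commutes_mod_compact P B \<Longrightarrow> commutes_mod_compact P (A - B)"
  using commutes_mod_compact_add[of P A "- B"] commutes_mod_compact_uminus[of P B] by simp

text \<open>Compact operators are norm closed and the commutator with P is norm continuous. This is
  what keeps square roots, built as norm limits, local.\<close>

lemma commutes_mod_compact_lim:
  assumes "\<And>n. commutes_mod_compact P (A n)" "A \<longlonglongrightarrow> L"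
  shows "commutes_mod_compact P L"
  unfolding commutes_mod_compact_def
proof (rule compact_op_approx)
  fix e :: real assume "e > 0"
  have "(\<lambda>n. (P o\<^sub>L A n) - (A n o\<^sub>L P)) \<longlonglongrightarrow> (P o\<^sub>L L) - (L o\<^sub>L P)"
    by (intro tendsto_diff tendsto_const assms(2)
        bounded_bilinear.tendsto[OF bounded_bilinear_blinfun_compose])
  then obtain n where "dist ((P o\<^sub>L A n) - (A n o\<^sub>L P)) ((P o\<^sub>L L) - (L o\<^sub>L P)) < e"
    using \<open>e > 0\<close> unfolding lim_sequentially by blast
  then show "\<exists>B. compact_op B \<and> norm ((P o\<^sub>L L) - (L o\<^sub>L P) - B) < e"
    using assms(1)[of n] unfolding commutes_mod_compact_def dist_norm
    by (metis norm_minus_commute)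
qed

lemma commutes_mod_compact_inverse:
  assumes "commutes_mod_compact P A" "A o\<^sub>L B = id_blinfun" "B o\<^sub>L A = id_blinfun"
  shows "commutes_mod_compact P B"
proof -
  have AB: "A (B x) = x" "B (A x) = x" for x
    using assms(2,3) by (metis blinfun_apply_blinfun_compose blinfun_apply_id_blinfun)+
  have "(P o\<^sub>L B) - (B o\<^sub>L P) = - (B o\<^sub>L (((P o\<^sub>L A) - (A o\<^sub>L P)) o\<^sub>L B))"
    by (rule blinfun_eqI) (simp add: blinfun.bilinear_simps AB)
  then show ?thesis using assms(1)
    by (simp add: commutes_mod_compact_def compact_op_uminus compact_op_compose_left
        compact_op_compose_right)
qed

section \<open>Complex dimension\<close>

lemma cfinite_dim_subset: "cfinite_dim T \<Longrightarrow> S \<subseteq> T \<Longrightarrow> cfinite_dim S"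
  unfolding cfinite_dim_def by blast

lemma cfinite_dim_zero: "cfinite_dim {0 :: 'a::complex_hilbert_space}"
  by (auto simp: cfinite_dim_def intro!: exI[of _ "{}"])

lemma cfinite_dim_span_insert:
  assumes "cfinite_dim S"
  shows "cfinite_dim (complex_vector.span (insert z S))"
proof -
  obtain B where B: "finite B" "S \<subseteq> complex_vector.span B" using assms cfinite_dim_def by blast
  then have "insert z S \<subseteq> complex_vector.span (insert z B)"
    using complex_vector.span_mono[of B "insert z B"]
    by (auto intro: complex_vector.span_base)
  then have "complex_vector.span (insert z S) \<subseteq> complex_vector.span (insert z B)"
    by (simp add: complex_vector.span_minimal)
  then show ?thesis using B unfolding cfinite_dim_def by blast
qed

lemma cdim_span_insert:
  assumes K: "complex_vector.subspace K" and fin: "cfinite_dim K" and z: "z \<notin> K"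
  shows "complex_vector.dim (complex_vector.span (insert z K)) = Suc (complex_vector.dim K)"
proof -
  obtain B where B: "B \<subseteq> K" "complex_vector.independent B" "K \<subseteq> complex_vector.span B"
      "card B = complex_vector.dim K"
    using complex_vector.basis_exists by blast
  have sp: "complex_vector.span B = K"
    using B K complex_vector.span_minimal by blast
  have "finite B"
    using fin B complex_vector.independent_span_bound unfolding cfinite_dim_def
    by (metis subset_trans)
  have "complex_vector.independent (insert z B)"
    using B z sp by (simp add: complex_vector.independent_insertI)
  moreover have "complex_vector.span (insert z K) = complex_vector.span (insert z B)"
    unfolding complex_vector.span_insert sp[symmetric] complex_vector.span_span ..
  moreover have "z \<notin> B" using B z by blast
  ultimately show ?thesis
    using \<open>finite B\<close> B complex_vector.dim_span_eq_card_independent[of "insert z B"]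
    by (simp del: complex_vector.dim_span)
qed

lemma eq_span_insertI:
  assumes "complex_vector.subspace T" "z \<in> T" "K \<subseteq> T" "\<And>y. y \<in> T \<Longrightarrow> \<exists>c. y - c *\<^sub>C z \<in> K"
  shows "T = complex_vector.span (insert z K)"
proof
  show "T \<subseteq> complex_vector.span (insert z K)"
    unfolding complex_vector.span_insert using assms(4) by (auto intro: complex_vector.span_base)
  show "complex_vector.span (insert z K) \<subseteq> T"
    using assms by (intro complex_vector.span_minimal) auto
qed

lemma subspace_orthogonal:
  "complex_vector.subspace K \<Longrightarrow> complex_vector.subspace {y \<in> K. cinner e y = 0}"
  unfolding complex_vector.subspace_def
  by (auto simp: cinner.add_right cinner_scaleC_right cinner.zero_right)

lemma hyperplane_eq_span_insert:
  assumes K: "complex_vector.subspace K" and k: "k \<in> K" "cinner e k \<noteq> 0"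
  shows "K = complex_vector.span (insert k {y \<in> K. cinner e y = 0})"
proof (rule eq_span_insertI[OF K k(1)])
  fix y assume "y \<in> K"
  have "y - (cinner e y / cinner e k) *\<^sub>C k \<in> {y \<in> K. cinner e y = 0}"
    using k K \<open>y \<in> K\<close>
    by (auto simp: cinner.diff_right cinner_scaleC_right
        intro!: complex_vector.subspace_diff complex_vector.subspace_scale)
  then show "\<exists>c. y - c *\<^sub>C k \<in> {y \<in> K. cinner e y = 0}" by blast
qed auto

lemma cdim_hyperplane:
  assumes "complex_vector.subspace K" "cfinite_dim K" "k \<in> K" "cinner e k \<noteq> 0"
  shows "complex_vector.dim K = Suc (complex_vector.dim {y \<in> K. cinner e y = 0})"
proof -
  have "cfinite_dim {y \<in> K. cinner e y = 0}" by (rule cfinite_dim_subset[OF assms(2)]) auto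
  then show ?thesis
    using cdim_span_insert[OF subspace_orthogonal[OF assms(1)], of e k] assms(4)
    by (subst hyperplane_eq_span_insert[OF assms(1,3,4)]) simp
qed

text \<open>Each functional lowers the dimension by at most one, so adding one vector back to a
  finite-dimensional intersection would make the previous one finite-dimensional.\<close>

lemma infinite_dim_orthogonal:
  assumes "finite F" "complex_vector.subspace S" "\<not> cfinite_dim S"
  shows "\<not> cfinite_dim {y \<in> S. \<forall>f\<in>F. cinner f y = 0}"
  using assms(1)
proof induction
  case (insert f F)
  let ?S = "{y \<in> S. \<forall>f\<in>F. cinner f y = 0}"
  have sub: "complex_vector.subspace ?S" using assms(2)
    unfolding complex_vector.subspace_def
    by (auto simp: cinner.add_right cinner_scaleC_right cinner.zero_right)
  have eq: "{y \<in> S. \<forall>g\<in>insert f F. cinner g y = 0} = {y \<in> ?S. cinner f y = 0}" by auto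
  show ?case
  proof (cases "\<exists>k\<in>?S. cinner f k \<noteq> 0")
    case True
    then obtain k where "k \<in> ?S" "cinner f k \<noteq> 0" by blast
    from hyperplane_eq_span_insert[OF sub this] show ?thesis
      using insert.IH cfinite_dim_span_insert[of "{y \<in> ?S. cinner f y = 0}" k] unfolding eq by argo
  next
    case False
    then have "{y \<in> ?S. cinner f y = 0} = ?S" by blast
    then show ?thesis using insert.IH unfolding eq by simp
  qed
qed (use assms(3) in simp)

section \<open>Orthonormal sequences and estimates modulo compact operators\<close>

lemma exists_unit_vector:
  assumes "complex_vector.subspace S" "x \<in> S" "x \<noteq> (0::'a::complex_hilbert_space)"
  shows "\<exists>u\<in>S. norm u = 1"
proof
  show "complex_of_real (1 / norm x) *\<^sub>C x \<in> S"
    using assms complex_vector.subspace_scale by blast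
  show "norm (complex_of_real (1 / norm x) *\<^sub>C x) = 1" using assms by (simp add: norm_scaleC norm_divide)
qed

lemma exists_orthonormal_sequence:
  assumes S: "complex_vector.subspace S" "\<not> cfinite_dim (S :: 'a::complex_hilbert_space set)"
  shows "\<exists>e :: nat \<Rightarrow> 'a. (\<forall>n. e n \<in> S) \<and> (\<forall>m n. cinner (e m) (e n) = (if m = n then 1 else 0))"
proof -
  define P where "P = (\<lambda>(e :: nat \<Rightarrow> 'a) n v. v \<in> S \<and> norm v = 1 \<and> (\<forall>m<n. cinner (e m) v = 0))"
  have "\<exists>e. \<forall>n. P e n (e n)"
  proof (rule dependent_wellorder_choice)
    show "\<exists>v. P e n v" for n e
    proof -
      let ?T = "{y \<in> S. \<forall>f\<in>e ` {..<n}. cinner f y = 0}"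
      have sub: "complex_vector.subspace ?T" using S(1)
        unfolding complex_vector.subspace_def
        by (auto simp: cinner.add_right cinner_scaleC_right cinner.zero_right)
      have "\<not> cfinite_dim ?T" using infinite_dim_orthogonal[OF _ S, of "e ` {..<n}"] by blast
      then have "\<not> ?T \<subseteq> {0}"
        using cfinite_dim_subset[OF cfinite_dim_zero] by blast
      then obtain x where "x \<in> ?T" "x \<noteq> 0" by blast
      from exists_unit_vector[OF sub this] show ?thesis by (auto simp: P_def)
    qed
  qed (auto simp: P_def)
  then obtain e where e: "\<And>n. P e n (e n)" by blast
  have lt: "cinner (e m) (e n) = 0" if "m < n" for m n using e[of n] that by (simp add: P_def)
  have "cinner (e m) (e n) = (if m = n then 1 else 0)" for m n
  proof (cases m n rule: linorder_cases)
    case equal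
    then show ?thesis using e[of n] by (simp add: P_def cinner_self)
  next
    case greater
    then show ?thesis using lt[of n m] by (subst cinner_commute) simp
  qed (use lt in simp)
  then show ?thesis using e by (intro exI[of _ e]) (auto simp: P_def)
qed

lemma norm_diff_orthonormal:
  assumes "norm a = 1" "norm b = 1" "cinner a b = 0"
  shows "norm (a - b) = sqrt 2"
proof -
  have "inner a b = 0" using assms(3) by (simp add: inner_eq_Re_cinner)
  then have "(norm (a - b))\<^sup>2 = 2"
    using assms(1,2) by (simp add: power2_norm_eq_inner inner_diff inner_commute norm_eq_1)
  then show ?thesis by (metis norm_ge_zero real_sqrt_unique)
qed

text \<open>An orthonormal sequence in K has mutual distances sqrt 2, and C does not shrink
  differences of vectors of K. This contradicts the Cauchy subsequence of images that compactness
  provides.\<close>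

lemma cfinite_dim_if_compact_bound:
  fixes C :: "'a::complex_hilbert_space \<Rightarrow>\<^sub>L 'a"
  assumes K: "complex_vector.subspace K" and C: "compact_op C"
    and le: "\<And>y. y \<in> K \<Longrightarrow> norm y \<le> norm (C y)"
  shows "cfinite_dim K"
proof (rule ccontr)
  assume "\<not> cfinite_dim K"
  from exists_orthonormal_sequence[OF K this] obtain e :: "nat \<Rightarrow> 'a"
    where e: "\<And>n. e n \<in> K" "\<And>m n. cinner (e m) (e n) = (if m = n then 1 else 0)" by blast
  have n1: "norm (e n) = 1" for n
  proof -
    have "(norm (e n))\<^sup>2 = 1"
      using e(2)[of n n] cinner_self[of "e n"] by (metis of_real_eq_1_iff)
    then show ?thesis by (metis abs_norm_cancel abs_1 power2_eq_1_iff abs_minus_cancel)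
  qed
  obtain l r where r: "strict_mono (r :: nat \<Rightarrow> nat)" "(\<lambda>n. C (e (r n))) \<longlonglongrightarrow> l"
    using compact_op_subsequence[OF C, of e] n1 by (metis order_refl)
  then have "Cauchy (\<lambda>n. C (e (r n)))" by (auto intro: LIMSEQ_imp_Cauchy)
  then obtain N where N: "\<And>m n. m \<ge> N \<Longrightarrow> n \<ge> N \<Longrightarrow> norm (C (e (r m)) - C (e (r n))) < 1"
    by (metis CauchyD zero_less_one)
  have ne: "r N \<noteq> r (Suc N)" using r(1) by (simp add: strict_mono_eq)
  have "sqrt 2 = norm (e (r N) - e (r (Suc N)))"
    using n1 e(2)[of "r N" "r (Suc N)"] ne by (simp add: norm_diff_orthonormal)
  also have "\<dots> \<le> norm (C (e (r N) - e (r (Suc N))))"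
    by (intro le complex_vector.subspace_diff K e)
  also have "\<dots> < 1" using N[of N "Suc N"] by (simp add: blinfun.diff_right)
  finally show False using real_sqrt_ge_1_iff[of 2] by linarith
qed

text \<open>Unit vectors y with T y tending to 0 have, along a subsequence, convergent images under
  C; the estimate then makes the subsequence itself Cauchy, and its limit is a unit vector killed by
  T.\<close>

lemma bounded_below_if_compact_bound:
  fixes C :: "'a::complex_hilbert_space \<Rightarrow>\<^sub>L 'a" and T :: "'a \<Rightarrow>\<^sub>L 'a"
  assumes V: "subspace V" "closed V" and C: "compact_op C"
    and le: "\<And>y. y \<in> V \<Longrightarrow> norm y \<le> c * norm (T y) + norm (C y)" and c: "c \<ge> 0"
    and inj: "\<And>y. y \<in> V \<Longrightarrow> T y = 0 \<Longrightarrow> y = 0"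
  shows "\<exists>d>0. \<forall>y\<in>V. d * norm y \<le> norm (T y)"
proof (rule ccontr)
  assume no: "\<not> ?thesis"
  have "\<exists>y\<in>V. norm y = 1 \<and> norm (T y) < 1 / real (Suc n)" for n
  proof -
    obtain y where y: "y \<in> V" "norm (T y) < 1 / real (Suc n) * norm y"
      using no by (metis not_le zero_less_divide_1_iff of_nat_0_less_iff zero_less_Suc)
    then have "y \<noteq> 0" by (auto simp: blinfun.zero_right)
    then have "norm ((1 / norm y) *\<^sub>R y) = 1" "norm (T ((1 / norm y) *\<^sub>R y)) < 1 / real (Suc n)"
      using y(2) by (simp_all add: blinfun.scaleR_right field_simps)
    then show ?thesis using y V(1) subspace_scale by blast
  qed
  then obtain y where y: "\<And>n. y n \<in> V" "\<And>n. norm (y n) = 1" "\<And>n. norm (T (y n)) < 1 / real (Suc n)"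
    by metis
  obtain l r where r: "strict_mono (r :: nat \<Rightarrow> nat)" "(\<lambda>n. C (y (r n))) \<longlonglongrightarrow> l"
    using compact_op_subsequence[OF C, of y] y(2) by (metis order_refl)
  have T0: "(\<lambda>n. T (y n)) \<longlonglongrightarrow> 0"
    by (rule tendsto_norm_zero_cancel, rule tendsto_sandwich[of "\<lambda>_. 0" _ _ "\<lambda>n. 1 / real (Suc n)"])
      (use y(3) less_imp_le LIMSEQ_Suc[OF lim_1_over_n] in \<open>auto intro!: always_eventually\<close>)
  then have T0r: "(\<lambda>n. T (y (r n))) \<longlonglongrightarrow> 0"
    using LIMSEQ_subseq_LIMSEQ[OF _ r(1)] by (fastforce simp: comp_def)
  have "Cauchy (\<lambda>n. y (r n))"
  proof (rule CauchyI)
    fix e :: real assume "e > 0"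
    \<comment> \<open>Chosen so that c e' < e/2; the 1 covers c = 0.\<close>
    define e' where "e' = e / (2 * (c + 1))"
    have e': "e' > 0" "c * e' < e / 2"
      using \<open>e > 0\<close> c by (simp_all add: e'_def field_simps)
    have "Cauchy (\<lambda>n. T (y (r n)))" using T0r by (rule LIMSEQ_imp_Cauchy)
    then obtain M where M: "\<And>m n. m \<ge> M \<Longrightarrow> n \<ge> M \<Longrightarrow> norm (T (y (r m)) - T (y (r n))) < e'"
      using e'(1) by (meson CauchyD)
    have "Cauchy (\<lambda>n. C (y (r n)))" using r(2) by (rule LIMSEQ_imp_Cauchy)
    then obtain N where N: "\<And>m n. m \<ge> N \<Longrightarrow> n \<ge> N \<Longrightarrow> norm (C (y (r m)) - C (y (r n))) < e / 2"
      using \<open>e > 0\<close> by (meson CauchyD half_gt_zero)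
    have "norm (y (r m) - y (r n)) < e" if "m \<ge> max M N" "n \<ge> max M N" for m n
    proof -
      have "y (r m) - y (r n) \<in> V" using y(1) V(1) by (simp add: subspace_diff)
      from le[OF this] have "norm (y (r m) - y (r n))
          \<le> c * norm (T (y (r m)) - T (y (r n))) + norm (C (y (r m)) - C (y (r n)))"
        by (simp add: blinfun.diff_right)
      also have "c * norm (T (y (r m)) - T (y (r n))) \<le> c * e'"
        using M[of m n] that c by (intro mult_left_mono) auto
      finally show ?thesis using N[of m n] that e'(2) by simp
    qed
    then show "\<exists>M. \<forall>m\<ge>M. \<forall>n\<ge>M. norm (y (r m) - y (r n)) < e" by blast
  qed
  then obtain p where p: "(\<lambda>n. y (r n)) \<longlonglongrightarrow> p" by (metis Cauchy_convergent_iff convergent_def)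
  have "p \<in> V" using closed_sequentially[OF V(2) _ p] y(1) by auto
  moreover have "norm p = 1" using tendsto_norm[OF p] y(2) by (simp add: LIMSEQ_const_iff)
  moreover have "T p = 0"
    using LIMSEQ_unique[OF blinfun.tendsto[OF tendsto_const p] T0r] by simp
  ultimately show False using inj by fastforce
qed

section \<open>Skew forms modulo compact operators\<close>

definition symmetric_op :: "('a::real_inner \<Rightarrow>\<^sub>L 'a) \<Rightarrow> bool" where
  "symmetric_op A \<longleftrightarrow> (\<forall>x y. inner (A x) y = inner x (A y))"

definition skew_op :: "('a::real_inner \<Rightarrow>\<^sub>L 'a) \<Rightarrow> bool" where
  "skew_op A \<longleftrightarrow> (\<forall>x y. inner (A x) y = - inner x (A y))"

definition antilinear_op :: "('a::complex_hilbert_space \<Rightarrow>\<^sub>L 'a) \<Rightarrow> bool" where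
  "antilinear_op A \<longleftrightarrow> (\<forall>x. A (\<i> *\<^sub>C x) = - (\<i> *\<^sub>C A x))"

text \<open>For a skew operator this amounts to invertibility, see
  \<open>skew_op_invertible\<close>; as an inequality it is stable under small perturbations and
  composition.\<close>

definition bounded_below :: "('a::real_normed_vector \<Rightarrow>\<^sub>L 'a) \<Rightarrow> bool" where
  "bounded_below A \<longleftrightarrow> (\<exists>d>0. \<forall>x. d * norm x \<le> norm (A x))"

lemma antilinear_op_scaleC: "antilinear_op A \<Longrightarrow> A (c *\<^sub>C x) = cnj c *\<^sub>C A x"
  by (subst (1 2) scaleC_eq_Re_Im) (simp add: antilinear_op_def blinfun.bilinear_simps)

text \<open>Antilinearity upgrades real skewness to the complex form \<open>cinner x (M y)\<close>,
  which is thus alternating: \<open>cinner x (M x) = 0\<close>. All parity statements rest on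
  this.\<close>

lemma cinner_skew:
  assumes "antilinear_op M" "skew_op M"
  shows "cinner x (M y) = - cinner y (M x)"
proof (rule complex_eqI)
  show "Re (cinner x (M y)) = Re (- cinner y (M x))"
    using assms(2) by (simp add: Re_cinner skew_op_def) (metis inner_commute minus_minus)
  have "inner x (\<i> *\<^sub>C M y) = - inner (M (\<i> *\<^sub>C y)) x"
    using assms(1) by (simp add: antilinear_op_def inner_commute)
  also have "\<dots> = inner (\<i> *\<^sub>C y) (M x)" using assms(2) by (simp add: skew_op_def)
  finally show "Im (cinner x (M y)) = Im (- cinner y (M x))"
    by (simp add: Im_cinner inner_i_left)
qed

definition projection_op :: "('a::complex_hilbert_space \<Rightarrow>\<^sub>L 'a) \<Rightarrow> bool" where
  "projection_op P \<longleftrightarrow> P \<in> bounded_ops \<and> (\<forall>x. P (P x) = P x) \<and> (\<forall>x y. cinner (P x) y = cinner x (P y))"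

lemma projection_opD:
  assumes "projection_op P"
  shows "P (P x) = P x" "P (c *\<^sub>C x) = c *\<^sub>C P x" "cinner (P x) y = cinner x (P y)"
    "inner (P x) y = inner x (P y)"
  using assms by (simp_all add: projection_op_def bounded_ops_def inner_eq_Re_cinner)

lemma subspace_range_projection: "subspace {y. blinfun_apply P y = y}"
  by (simp add: subspace_def blinfun.bilinear_simps)

lemma closed_range_projection: "closed {y. blinfun_apply P y = y}"
  by (intro closed_Collect_eq continuous_intros)

text \<open>
  The radical of the skew form \<open>(x, y) \<mapsto> \<langle>x, M y\<rangle>\<close> on the range of \<open>P\<close>. For \<open>M = J U\<close> and a
  projection \<open>P\<close> commuting with \<open>J\<close> it is the kernel of \<open>P U P + 1 - P\<close>. The projection is kept
  arbitrary so that subspaces of codimension one, which are not invariant under \<open>J\<close>, are covered.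
\<close>

definition form_kernel :: "('a::complex_hilbert_space \<Rightarrow>\<^sub>L 'a) \<Rightarrow> ('a \<Rightarrow>\<^sub>L 'a) \<Rightarrow> 'a set" where
  "form_kernel P M = {y. P y = y \<and> P (M y) = 0}"

text \<open>The condition M^2 = -1 of the structures J U is relaxed to invertibility. This leaves
  room for segments and congruences; the phase leads back to structures.\<close>

definition local_form :: "('a::complex_hilbert_space \<Rightarrow>\<^sub>L 'a) \<Rightarrow> ('a \<Rightarrow>\<^sub>L 'a) \<Rightarrow> bool" where
  "local_form P M \<longleftrightarrow> antilinear_op M \<and> skew_op M \<and> bounded_below M \<and> commutes_mod_compact P M"

lemma complex_subspace_form_kernel:
  assumes "projection_op P" "antilinear_op M"
  shows "complex_vector.subspace (form_kernel P M)"
  unfolding complex_vector.subspace_def form_kernel_def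
  by (auto simp: blinfun.bilinear_simps projection_opD[OF assms(1)] antilinear_op_scaleC[OF assms(2)])

lemma subspace_if_complex: "complex_vector.subspace K \<Longrightarrow> subspace K"
  by (simp add: complex_vector.subspace_def subspace_def scaleR_scaleC)

lemma closed_form_kernel: "closed (form_kernel P M)"
  unfolding form_kernel_def
  by (intro closed_Collect_conj closed_Collect_eq continuous_intros)

section \<open>Radicals over a projection and over its hyperplanes\<close>

context
  fixes P M :: "'a::complex_hilbert_space \<Rightarrow>\<^sub>L 'a"
  assumes P: "projection_op P" and M: "local_form P M"
begin

lemma local_form_antilinear: "antilinear_op M" and local_form_skew: "skew_op M"
  using M by (simp_all add: local_form_def)

text \<open>On the range of P the difference of P M y and M y is the commutator applied to y, hence
  compact. So the compression inherits the lower bound of M up to a compact term, which is its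
  Fredholm property.\<close>

lemma norm_le_compression:
  obtains c and C :: "'a \<Rightarrow>\<^sub>L 'a" where "c \<ge> 0" "compact_op C"
    "\<And>y. P y = y \<Longrightarrow> norm y \<le> c * norm ((P o\<^sub>L M) y) + norm (blinfun_apply C y)"
proof -
  obtain d where d: "d > 0" "\<And>x. d * norm x \<le> norm (M x)"
    using M by (auto simp: local_form_def bounded_below_def)
  let ?C = "((1/d) *\<^sub>R id_blinfun) o\<^sub>L ((P o\<^sub>L M) - (M o\<^sub>L P))"
  have "norm y \<le> (1/d) * norm ((P o\<^sub>L M) y) + norm (?C y)" if y: "P y = y" for y
  proof -
    have "norm y \<le> (1/d) * norm (M y)" using d by (simp add: field_simps)
    moreover have "norm (M y) \<le> norm (P (M y)) + norm (P (M y) - M y)"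
      using norm_triangle_ineq4[of "P (M y)" "P (M y) - M y"] by simp
    ultimately have "norm y \<le> (1/d) * (norm (P (M y)) + norm (P (M y) - M y))"
      using d(1) mult_left_mono[of "norm (M y)" _ "1/d"] by fastforce
    moreover have "?C y = (1/d) *\<^sub>R (P (M y) - M y)"
      using y by (simp add: blinfun.bilinear_simps scaleR_diff_right)
    ultimately show ?thesis using d(1) by (simp add: distrib_left)
  qed
  moreover have "compact_op ?C"
    using M by (intro compact_op_compose_left) (simp add: local_form_def commutes_mod_compact_def)
  ultimately show thesis using that[of "1/d" ?C] d by simp
qed

lemma cfinite_dim_form_kernel: "cfinite_dim (form_kernel P M)"
proof -
  obtain c and C :: "'a \<Rightarrow>\<^sub>L 'a" where "c \<ge> 0" "compact_op C"
    "\<And>y. P y = y \<Longrightarrow> norm y \<le> c * norm ((P o\<^sub>L M) y) + norm (blinfun_apply C y)"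
    using norm_le_compression by blast
  then show ?thesis
    by (intro cfinite_dim_if_compact_bound[of _ C] complex_subspace_form_kernel P local_form_antilinear)
      (fastforce simp: form_kernel_def)+
qed

lemma form_bounded_below:
  assumes "subspace V" "closed V" "\<And>y. y \<in> V \<Longrightarrow> P y = y" "\<And>y. y \<in> V \<Longrightarrow> P (M y) = 0 \<Longrightarrow> y = 0"
  shows "\<exists>d>0. \<forall>y\<in>V. d * norm y \<le> norm ((P o\<^sub>L M) y)"
proof -
  obtain c and C :: "'a \<Rightarrow>\<^sub>L 'a" where "c \<ge> 0" "compact_op C"
    "\<And>y. P y = y \<Longrightarrow> norm y \<le> c * norm ((P o\<^sub>L M) y) + norm (blinfun_apply C y)"
    using norm_le_compression by blast
  then show ?thesis
    by (intro bounded_below_if_compact_bound[of V C c] assms(1,2)) (use assms(3,4) in auto)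
qed

text \<open>A Fredholm alternative of index zero. On the part V of the range of P orthogonal to the
  radical, P M is bounded below, so its image is closed. Skewness puts the component of e orthogonal
  to this image into the radical, to which e is orthogonal.\<close>

lemma form_solvable:
  assumes e: "P e = e" "\<And>k. k \<in> form_kernel P M \<Longrightarrow> inner e k = 0"
  shows "\<exists>z. P z = z \<and> P (M z) = e"
proof -
  let ?K = "form_kernel P M" and ?T = "P o\<^sub>L M"
  define V where "V = {y. P y = y \<and> (\<forall>k\<in>?K. inner k y = 0)}"
  have V: "subspace V"
    unfolding V_def subspace_def by (auto simp: blinfun.bilinear_simps inner_add)
  have "closed {y. \<forall>k\<in>?K. inner k y = 0}"
    unfolding Ball_def by (intro closed_Collect_all closed_Collect_imp closed_Collect_eq
        continuous_intros) auto
  then have cV: "closed V"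
    unfolding V_def by (intro closed_Collect_conj closed_range_projection)
  have "\<exists>d>0. \<forall>y\<in>V. d * norm y \<le> norm (?T y)"
  proof (rule form_bounded_below[OF V cV])
    fix y assume "y \<in> V" "P (M y) = 0"
    then have "y \<in> ?K" "inner y y = 0" by (auto simp: V_def form_kernel_def)
    then show "y = 0" by simp
  qed (simp add: V_def)
  then obtain d where d: "d > 0" "\<And>y. y \<in> V \<Longrightarrow> d * norm y \<le> norm (?T y)" by blast
  have "complete (?T ` V)"
    using complete_isometric_image[OF d(1) V, of ?T] d(2) cV
    by (auto simp: complete_eq_closed mult.commute blinfun.bounded_linear_right)
  then have cR: "closed (?T ` V)" by (simp add: complete_eq_closed)
  have R: "subspace (?T ` V)"
    by (intro linear_subspace_image V bounded_linear.linear blinfun.bounded_linear_right)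
  obtain r where r: "r \<in> ?T ` V" "\<And>v. v \<in> ?T ` V \<Longrightarrow> inner (e - r) v = 0"
    using exists_nearest_point[OF R cR] by blast
  define s where "s = e - r"
  have Pr: "P r = r" using r(1) projection_opD[OF P] by auto
  have Ps: "P s = s" using e(1) Pr by (simp add: s_def blinfun.diff_right)
  \<comment> \<open>The radical adds nothing to the image of V, so s is orthogonal to every P M P x;
    skewness turns this into \<open>P (M s) = 0\<close>.\<close>
  have "inner (P (M s)) x = 0" for x
  proof -
    obtain k where k: "k \<in> ?K" "\<And>v. v \<in> ?K \<Longrightarrow> inner (P x - k) v = 0"
      using exists_nearest_point[OF subspace_if_complex[OF complex_subspace_form_kernel[OF P local_form_antilinear]]
          closed_form_kernel] by blast
    have "P x - k \<in> V"
      using k projection_opD[OF P] by (auto simp: V_def form_kernel_def blinfun.diff_right inner_commute)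
    then have "inner s (?T (P x - k)) = 0" using r(2) by (simp add: s_def)
    then have *: "inner s (P (M (P x))) = 0"
      using k(1) by (simp add: form_kernel_def blinfun.bilinear_simps)
    have "inner (P (M s)) x = inner (M s) (P x)" by (rule projection_opD[OF P])
    also have "\<dots> = - inner s (M (P x))" using local_form_skew by (simp add: skew_op_def)
    also have "\<dots> = - inner s (P (M (P x)))" using projection_opD(4)[OF P, of s] Ps by simp
    finally show ?thesis using * by simp
  qed
  then have "P (M s) = 0" by (metis inner_eq_zero_iff)
  then have sK: "s \<in> ?K" using Ps by (simp add: form_kernel_def)
  obtain v where v: "v \<in> V" "r = ?T v" using r(1) by blast
  \<comment> \<open>r lies in the image and is therefore orthogonal to the radical vector s, so
    \<open>inner s s = inner s e\<close>.\<close>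
  have "inner s r = inner s (M v)"
    using v Ps projection_opD(4)[OF P, of s "M v"] by simp
  also have "\<dots> = - inner (M s) v" using local_form_skew by (simp add: skew_op_def)
  also have "\<dots> = - inner (P (M s)) v"
    using v(1) projection_opD(4)[OF P, of "M s" v] by (simp add: V_def)
  also have "\<dots> = 0" using \<open>P (M s) = 0\<close> by simp
  finally have "inner s s = inner s e" by (simp add: s_def inner_diff)
  then have "s = 0" using e(2)[OF sK] by (simp add: inner_commute)
  then show ?thesis using v by (intro exI[of _ v]) (auto simp: s_def V_def)
qed

lemma projection_op_minus_rank_one:
  assumes "P e = e" "norm e = 1"
  shows "projection_op (P - rank_one e e)"
  unfolding projection_op_def
proof (intro conjI allI)
  have e: "cinner e e = 1" using assms(2) by (simp add: cinner_self)
  have eP: "cinner e (P x) = cinner e x" for x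
    using projection_opD(3)[OF P, of e x] assms(1) by simp
  show "P - rank_one e e \<in> bounded_ops"
    by (rule bounded_opsI)
      (simp add: blinfun.bilinear_simps projection_opD[OF P] cinner_scaleC_right scaleC_scaleC
        scaleC.diff_right)
  show "(P - rank_one e e) ((P - rank_one e e) x) = (P - rank_one e e) x" for x
    by (simp add: blinfun.bilinear_simps projection_opD[OF P] assms(1) cinner.diff_right eP
        cinner_scaleC_right e)
  show "cinner ((P - rank_one e e) x) y = cinner x ((P - rank_one e e) y)" for x y
    using cinner_commute[of e x]
    by (simp add: blinfun.bilinear_simps projection_opD[OF P] cinner.diff_left cinner.diff_right
        cinner_scaleC_left cinner_scaleC_right)
qed

lemma local_form_minus_rank_one: "local_form (P - rank_one e f) M"
proof -
  have "((P - rank_one e f) o\<^sub>L M) - (M o\<^sub>L (P - rank_one e f))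
      = ((P o\<^sub>L M) - (M o\<^sub>L P)) - ((rank_one e f o\<^sub>L M) - (M o\<^sub>L rank_one e f))"
    by (rule blinfun_eqI) (simp add: blinfun.bilinear_simps)
  then have "commutes_mod_compact (P - rank_one e f) M"
    using M unfolding commutes_mod_compact_def local_form_def
    by (metis compact_op_diff compact_op_compose_left compact_op_compose_right compact_op_rank_one)
  then show ?thesis using M by (simp add: local_form_def)
qed

lemma form_kernel_minus_rank_one:
  assumes "P e = e" "norm e = 1"
  shows "form_kernel (P - rank_one e e) M
    = {y. P y = y \<and> cinner e y = 0 \<and> (\<exists>c. P (M y) = c *\<^sub>C e)}"
proof -
  have e: "cinner e e = 1" using assms(2) by (simp add: cinner_self)
  have eP: "cinner e (P x) = cinner e x" for x
    using projection_opD(3)[OF P, of e x] assms(1) by simp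
  have 1: "(P - rank_one e e) y = y \<longleftrightarrow> P y = y \<and> cinner e y = 0" for y
  proof
    assume y: "(P - rank_one e e) y = y"
    then have "cinner e y = cinner e (P y - cinner e y *\<^sub>C e)" by (simp add: blinfun.diff_left)
    also have "\<dots> = 0" by (simp add: cinner.diff_right eP cinner_scaleC_right e)
    finally show "P y = y \<and> cinner e y = 0" using y by (simp add: blinfun.diff_left)
  qed (simp add: blinfun.diff_left)
  have 2: "(P - rank_one e e) x = 0 \<longleftrightarrow> (\<exists>c. P x = c *\<^sub>C e)" for x
  proof
    assume "\<exists>c. P x = c *\<^sub>C e"
    then obtain c where c: "P x = c *\<^sub>C e" by blast
    then have "cinner e x = c" using eP[of x] by (simp add: cinner_scaleC_right e)
    then show "(P - rank_one e e) x = 0" using c by (simp add: blinfun.diff_left)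
  qed (auto simp: blinfun.diff_left)
  show ?thesis unfolding form_kernel_def 1 2 by blast
qed

text \<open>If P M y = c e, pairing with the radical vector k gives c <k, e> = - <y, M k> = 0, so c
  = 0. No new radical vectors appear on the hyperplane.\<close>

lemma form_kernel_minus_rank_one_of_mem:
  assumes e: "P e = e" "norm e = 1" and k: "k \<in> form_kernel P M" "cinner e k \<noteq> 0"
  shows "form_kernel (P - rank_one e e) M = {y \<in> form_kernel P M. cinner e y = 0}"
proof -
  have "P (M y) = 0" if y: "P y = y" "P (M y) = c *\<^sub>C e" for y c
  proof -
    have "c * cinner k e = cinner k (P (M y))" by (simp add: y cinner_scaleC_right)
    also have "\<dots> = cinner k (M y)" using projection_opD(3)[OF P, of k "M y"] k(1) by (simp add: form_kernel_def)
    also have "\<dots> = - cinner y (M k)" by (rule cinner_skew[OF local_form_antilinear local_form_skew])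
    also have "\<dots> = - cinner y (P (M k))" using projection_opD(3)[OF P, of y "M k"] y by simp
    also have "\<dots> = 0" using k(1) by (simp add: form_kernel_def cinner.zero_right)
    finally have "c = 0" using k(2) by (metis cinner_commute complex_cnj_zero_iff mult_eq_0_iff)
    then show ?thesis by (simp add: y)
  qed
  then show ?thesis
    unfolding form_kernel_minus_rank_one[OF e]
    by (auto simp: form_kernel_def intro: exI[of _ 0])
qed

text \<open>Here skewness produces a parity instead of an integer-valued index.\<close>

lemma cdim_form_kernel_hyperplane:
  assumes e: "P e = e" "norm e = 1"
  shows "odd (complex_vector.dim (form_kernel P M)
    + complex_vector.dim (form_kernel (P - rank_one e e) M))"
proof (cases "\<exists>k\<in>form_kernel P M. cinner e k \<noteq> 0")
  case True
  then obtain k where k: "k \<in> form_kernel P M" "cinner e k \<noteq> 0" by blast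
  then show ?thesis
    using cdim_hyperplane[OF complex_subspace_form_kernel[OF P local_form_antilinear] cfinite_dim_form_kernel k]
    by (simp add: form_kernel_minus_rank_one_of_mem[OF e k])
next
  case False
  then have eK: "cinner e k = 0" if "k \<in> form_kernel P M" for k using that by blast
  then have "\<exists>z. P z = z \<and> P (M z) = e"
    by (intro form_solvable e) (simp add: inner_eq_Re_cinner)
  then obtain z where z: "P z = z" "P (M z) = e" by blast
  \<comment> \<open>The form alternates, so the solution z of P M z = e is orthogonal to e. It lies
    in the hyperplane and is radical there, but not in the whole range of P.\<close>
  have "cinner z e = cinner z (M z)" using projection_opD(3)[OF P, of z "M z"] z by simp
  also have "\<dots> = 0" using cinner_skew[OF local_form_antilinear local_form_skew, of z z] by simp
  finally have ze: "cinner e z = 0" by (metis cinner_commute complex_cnj_zero_iff)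
  let ?K' = "form_kernel (P - rank_one e e) M"
  have K': "?K' = {y. P y = y \<and> cinner e y = 0 \<and> (\<exists>c. P (M y) = c *\<^sub>C e)}"
    by (rule form_kernel_minus_rank_one[OF e])
  have "?K' = complex_vector.span (insert z (form_kernel P M))"
  proof (rule eq_span_insertI)
    show "complex_vector.subspace ?K'"
      by (intro complex_subspace_form_kernel projection_op_minus_rank_one e local_form_antilinear)
    show "z \<in> ?K'" using z ze unfolding K' by (auto intro: exI[of _ 1])
    show "form_kernel P M \<subseteq> ?K'"
      unfolding K' using eK by (auto simp: form_kernel_def intro: exI[of _ 0])
    fix y assume "y \<in> ?K'"
    then obtain c where c: "P y = y" "P (M y) = c *\<^sub>C e" unfolding K' by blast
    \<comment> \<open>The coefficient is conjugated because M is antilinear.\<close>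
    have "y - cnj c *\<^sub>C z \<in> form_kernel P M"
      using c z by (simp add: form_kernel_def blinfun.bilinear_simps projection_opD[OF P]
          antilinear_op_scaleC[OF local_form_antilinear])
    then show "\<exists>c. y - c *\<^sub>C z \<in> form_kernel P M" by blast
  qed
  moreover have "z \<notin> form_kernel P M" using z e by (auto simp: form_kernel_def)
  ultimately show ?thesis
    using cdim_span_insert[OF complex_subspace_form_kernel[OF P local_form_antilinear] cfinite_dim_form_kernel]
    by simp
qed

end

section \<open>Parity and square roots\<close>

lemma cdim_eq_0_iff:
  assumes "complex_vector.subspace K" "cfinite_dim K"
  shows "complex_vector.dim K = 0 \<longleftrightarrow> K \<subseteq> {0 :: 'a::complex_hilbert_space}"
proof
  assume K0: "complex_vector.dim K = 0"
  show "K \<subseteq> {0}"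
  proof
    fix x assume "x \<in> K"
    have "cinner x x = 0"
      using cdim_hyperplane[OF assms \<open>x \<in> K\<close>, of x] K0 by auto
    then show "x \<in> {0}" by (simp add: cinner_self)
  qed
next
  assume "K \<subseteq> {0}"
  then have "complex_vector.dim K \<le> card ({} :: 'a set)"
    by (intro complex_vector.dim_le_card) auto
  then show "complex_vector.dim K = 0" by simp
qed

text \<open>The dimension itself can drop near M0. The induction removes a unit vector of the
  radical of M0 from the range of P; this flips the parity for M and for M0 alike, so their
  agreement passes back from the hyperplane.\<close>

lemma form_kernel_parity_locally_constant:
  assumes "projection_op P" "local_form P M0"
  shows "\<exists>r>0. \<forall>M. local_form P M \<longrightarrow> norm (M - M0) < r \<longrightarrow>
    even (complex_vector.dim (form_kernel P M) + complex_vector.dim (form_kernel P M0))"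
  using assms
proof (induction "complex_vector.dim (form_kernel P M0)" arbitrary: P)
  case (0 P)
  note P = 0(2) and M0 = 0(3)
  have K: "form_kernel P M0 \<subseteq> {0}"
    using cdim_eq_0_iff[OF complex_subspace_form_kernel[OF P local_form_antilinear[OF P M0]]
        cfinite_dim_form_kernel[OF P M0]] 0(1) by simp
  have "\<exists>d>0. \<forall>y\<in>{y. P y = y}. d * norm y \<le> norm ((P o\<^sub>L M0) y)"
    by (rule form_bounded_below[OF P M0 subspace_range_projection closed_range_projection])
      (use K in \<open>auto simp: form_kernel_def\<close>)
  then obtain d where d: "d > 0" "\<And>y. P y = y \<Longrightarrow> d * norm y \<le> norm (P (M0 y))" by auto
  \<comment> \<open>A radical vector y of M satisfies P M0 y = - P (M - M0) y, so the lower bound d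
    forces y = 0 within this radius. Adding 1 keeps the divisor positive for P = 0.\<close>
  define r where "r = d / (norm P + 1)"
  have "norm P + 1 > 0" by (simp add: add_nonneg_pos)
  then have r: "r > 0" "(norm P + 1) * r = d" using d by (simp_all add: r_def)
  have "complex_vector.dim (form_kernel P M) = 0" if M: "local_form P M" "norm (M - M0) < r" for M
  proof -
    have "y = 0" if y: "y \<in> form_kernel P M" for y
    proof (rule ccontr)
      assume "y \<noteq> 0"
      have "d * norm y \<le> norm (P (M0 y))" using y by (intro d) (simp add: form_kernel_def)
      also have "P (M0 y) = - P ((M - M0) y)"
        using y by (simp add: form_kernel_def blinfun.bilinear_simps)
      also have "norm \<dots> \<le> norm P * norm ((M - M0) y)" by (simp add: norm_blinfun)
      also have "\<dots> \<le> (norm P + 1) * (norm (M - M0) * norm y)"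
        by (intro mult_mono norm_blinfun) auto
      also have "\<dots> < (norm P + 1) * (r * norm y)"
        using M(2) \<open>y \<noteq> 0\<close> \<open>norm P + 1 > 0\<close> by simp
      also have "\<dots> = d * norm y" using r(2) by (simp add: mult.assoc[symmetric])
      finally show False by simp
    qed
    then have "form_kernel P M \<subseteq> {0}" by blast
    then show ?thesis
      using cdim_eq_0_iff[OF complex_subspace_form_kernel[OF P local_form_antilinear[OF P M(1)]]
          cfinite_dim_form_kernel[OF P M(1)]] by simp
  qed
  then show ?case using r(1) 0(1) by (intro exI[of _ r]) simp
next
  case (Suc n P)
  note P = Suc(3) and M0 = Suc(4)
  have sub: "complex_vector.subspace (form_kernel P M0)"
    by (intro complex_subspace_form_kernel P local_form_antilinear[OF P M0])
  have fin: "cfinite_dim (form_kernel P M0)" by (rule cfinite_dim_form_kernel[OF P M0])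
  have "\<not> form_kernel P M0 \<subseteq> {0}"
    using cdim_eq_0_iff[OF sub fin] Suc(2) by simp
  then obtain e where e: "e \<in> form_kernel P M0" "norm e = 1" using exists_unit_vector[OF sub] by blast
  have Pe: "P e = e" using e(1) by (simp add: form_kernel_def)
  have ee: "cinner e e \<noteq> 0" using e by (simp add: cinner_self)
  let ?P = "P - rank_one e e"
  have P': "projection_op ?P" by (rule projection_op_minus_rank_one[OF P M0 Pe e(2)])
  have M': "local_form ?P M" if "local_form P M" for M
    by (rule local_form_minus_rank_one[OF P that])
  have "complex_vector.dim (form_kernel ?P M0) = n"
    using form_kernel_minus_rank_one_of_mem[OF P M0 Pe e(2) e(1) ee]
      cdim_hyperplane[OF sub fin e(1) ee] Suc(2) by simp
  with Suc(1)[OF _ P' M'[OF M0]] obtain r where r: "r > 0" "\<And>M. local_form ?P M \<Longrightarrow> norm (M - M0) < r \<Longrightarrow>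
      even (complex_vector.dim (form_kernel ?P M) + complex_vector.dim (form_kernel ?P M0))" by auto
  have "even (complex_vector.dim (form_kernel P M) + complex_vector.dim (form_kernel P M0))"
    if "local_form P M" "norm (M - M0) < r" for M
    using r(2)[OF M'[OF that(1)] that(2)] cdim_form_kernel_hyperplane[OF P M0 Pe e(2)]
      cdim_form_kernel_hyperplane[OF P that(1) Pe e(2)] by auto
  then show ?case using r(1) by blast
qed

text \<open>
  A square root of \<open>1 - T\<close> for \<open>\<parallel>T\<parallel> \<le> 1\<close>. With \<open>B = 1 - C\<close> the equation \<open>C\<^sup>2 = 1 - T\<close> becomes
  \<open>B = (T + B\<^sup>2) / 2\<close>, and the iteration is dominated by the scalar one for \<open>T = 1\<close>, uniformly in \<open>T\<close>.
\<close>

primrec sqrt_iter :: "('a::real_normed_vector \<Rightarrow>\<^sub>L 'a) \<Rightarrow> nat \<Rightarrow> ('a \<Rightarrow>\<^sub>L 'a)" where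
  "sqrt_iter T 0 = 0"
| "sqrt_iter T (Suc n) = (1/2) *\<^sub>R (T + (sqrt_iter T n o\<^sub>L sqrt_iter T n))"

primrec sqrt_bound :: "nat \<Rightarrow> real" where
  "sqrt_bound 0 = 0"
| "sqrt_bound (Suc n) = (1 + (sqrt_bound n)\<^sup>2) / 2"

definition sqrt_one_minus :: "('a::banach \<Rightarrow>\<^sub>L 'a) \<Rightarrow> ('a \<Rightarrow>\<^sub>L 'a)" where
  "sqrt_one_minus T = id_blinfun - lim (sqrt_iter T)"

lemma sqrt_bound_range: "0 \<le> sqrt_bound n" "sqrt_bound n \<le> 1"
proof -
  have "0 \<le> sqrt_bound n \<and> sqrt_bound n \<le> 1"
  proof (induction n)
    case (Suc n)
    then have "(sqrt_bound n)\<^sup>2 \<le> 1" by (simp add: power_le_one)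
    then show ?case by simp
  qed simp
  then show "0 \<le> sqrt_bound n" "sqrt_bound n \<le> 1" by auto
qed

text \<open>The increments are (1 - b)^2 / 2, and 1 is the only fixed point, a double one.
  Convergence in this extreme case is what admits \<open>norm T \<le> 1\<close> instead of a strict
  bound.\<close>

lemma sqrt_bound_tendsto: "sqrt_bound \<longlonglongrightarrow> 1"
proof -
  have "sqrt_bound n \<le> sqrt_bound (Suc n)" for n
    using zero_le_power2[of "sqrt_bound n - 1"] by (simp add: power2_eq_square algebra_simps)
  then have "incseq sqrt_bound" by (rule incseq_SucI)
  then obtain L where L: "sqrt_bound \<longlonglongrightarrow> L"
    using incseq_convergent[of sqrt_bound 1] sqrt_bound_range by blast
  have "(\<lambda>n. sqrt_bound (Suc n)) \<longlonglongrightarrow> (1 + L\<^sup>2) / 2"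
    unfolding sqrt_bound.simps by (intro tendsto_intros L) simp
  then have "L = (1 + L\<^sup>2) / 2" using LIMSEQ_unique LIMSEQ_Suc[OF L] by blast
  then have "(L - 1)\<^sup>2 = 0" by (simp add: power2_eq_square algebra_simps)
  then show ?thesis using L by simp
qed

lemma norm_sqrt_iter:
  assumes "norm T \<le> 1"
  shows "norm (sqrt_iter T n) \<le> sqrt_bound n"
proof (induction n)
  case (Suc n)
  have "norm (sqrt_iter T n o\<^sub>L sqrt_iter T n) \<le> sqrt_bound n * sqrt_bound n"
    by (rule order_trans[OF norm_blinfun_compose mult_mono[OF Suc Suc]])
      (auto simp: sqrt_bound_range)
  then have "norm (T + (sqrt_iter T n o\<^sub>L sqrt_iter T n)) \<le> 1 + sqrt_bound n * sqrt_bound n"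
    using assms by (rule_tac norm_triangle_le) simp
  then show ?case by (simp add: power2_eq_square)
qed simp

text \<open>A difference of squares factors without commutativity as B B - D D = B (B - D) + (B - D)
  D. The scalar increments satisfy the same recursion with equality.\<close>

lemma norm_sqrt_iter_step:
  assumes "norm T \<le> 1"
  shows "norm (sqrt_iter T (Suc n) - sqrt_iter T n) \<le> sqrt_bound (Suc n) - sqrt_bound n"
proof (induction n)
  case 0
  then show ?case using assms by simp
next
  case (Suc n)
  let ?B = "sqrt_iter T" and ?b = sqrt_bound
  have "?B (Suc (Suc n)) - ?B (Suc n)
      = (1/2) *\<^sub>R ((?B (Suc n) o\<^sub>L (?B (Suc n) - ?B n)) + ((?B (Suc n) - ?B n) o\<^sub>L ?B n))"
  proof (rule blinfun_eqI)
    fix x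
    define D where "D = ?B (Suc n)"
    have D: "D x = (1/2) *\<^sub>R (T x + ?B n (?B n x))"
      by (simp add: D_def blinfun.bilinear_simps)
    have "?B (Suc (Suc n)) x = (1/2) *\<^sub>R (T x + D (D x))"
      by (simp only: sqrt_iter.simps(2)[of T "Suc n"] D_def[symmetric])
        (simp add: blinfun.bilinear_simps)
    moreover have "(1/2) *\<^sub>R (T x + D (D x)) - D x = (1/2) *\<^sub>R (D (D x) - ?B n (?B n x))"
      by (subst (2) D) (simp add: scaleR_diff_right scaleR_add_right)
    ultimately show "(?B (Suc (Suc n)) - ?B (Suc n)) x
      = ((1/2) *\<^sub>R ((?B (Suc n) o\<^sub>L (?B (Suc n) - ?B n)) + ((?B (Suc n) - ?B n) o\<^sub>L ?B n))) x"
      by (simp add: blinfun.bilinear_simps D_def[symmetric] del: sqrt_iter.simps)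
  qed
  also have "norm \<dots> \<le> (1/2) * (?b (Suc n) * (?b (Suc n) - ?b n) + (?b (Suc n) - ?b n) * ?b n)"
  proof -
    have "norm (?B (Suc n) o\<^sub>L (?B (Suc n) - ?B n)) \<le> ?b (Suc n) * (?b (Suc n) - ?b n)"
      by (intro order_trans[OF norm_blinfun_compose] mult_mono norm_sqrt_iter[OF assms] Suc)
        (auto simp: sqrt_bound_range simp del: sqrt_bound.simps)
    moreover have "norm ((?B (Suc n) - ?B n) o\<^sub>L ?B n) \<le> (?b (Suc n) - ?b n) * ?b n"
      by (intro order_trans[OF norm_blinfun_compose] mult_mono norm_sqrt_iter[OF assms] Suc
          order_trans[OF norm_ge_zero Suc]) simp
    ultimately show ?thesis by (simp del: sqrt_iter.simps sqrt_bound.simps add: norm_triangle_le)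
  qed
  also have "\<dots> = ?b (Suc (Suc n)) - ?b (Suc n)"
    unfolding sqrt_bound.simps(2)[of "Suc n"] sqrt_bound.simps(2)[of n]
    by (simp add: power2_eq_square field_simps)
  finally show ?case .
qed

lemma norm_sqrt_iter_diff:
  assumes "norm T \<le> 1" "m \<le> n"
  shows "norm (sqrt_iter T n - sqrt_iter T m) \<le> sqrt_bound n - sqrt_bound m"
  using assms(2)
proof (induction rule: dec_induct)
  case (step n)
  have "norm (sqrt_iter T (Suc n) - sqrt_iter T m)
      \<le> norm (sqrt_iter T (Suc n) - sqrt_iter T n) + norm (sqrt_iter T n - sqrt_iter T m)"
    using norm_triangle_ineq[of "sqrt_iter T (Suc n) - sqrt_iter T n" "sqrt_iter T n - sqrt_iter T m"]
    by simp
  then show ?case using step.IH norm_sqrt_iter_step[OF assms(1), of n] by linarith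
qed simp

lemma sqrt_iter_tendsto:
  fixes T :: "'a::banach \<Rightarrow>\<^sub>L 'a"
  assumes "norm T \<le> 1"
  shows "sqrt_iter T \<longlonglongrightarrow> id_blinfun - sqrt_one_minus T"
proof -
  have "Cauchy (sqrt_iter T)"
  proof (rule CauchyI)
    fix e :: real assume "e > 0"
    have "Cauchy sqrt_bound" using sqrt_bound_tendsto by (rule LIMSEQ_imp_Cauchy)
    then obtain N where N: "\<And>m n. m \<ge> N \<Longrightarrow> n \<ge> N \<Longrightarrow> norm (sqrt_bound m - sqrt_bound n) < e"
      using \<open>e > 0\<close> by (meson CauchyD)
    have "norm (sqrt_iter T m - sqrt_iter T n) < e" if "m \<ge> N" "n \<ge> N" for m n
      using N[OF that] norm_sqrt_iter_diff[OF assms, of m n] norm_sqrt_iter_diff[OF assms, of n m]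
      by (cases "m \<le> n") (auto simp: norm_minus_commute)
    then show "\<exists>M. \<forall>m\<ge>M. \<forall>n\<ge>M. norm (sqrt_iter T m - sqrt_iter T n) < e" by blast
  qed
  then show ?thesis by (simp add: sqrt_one_minus_def Cauchy_convergent_iff convergent_LIMSEQ_iff)
qed

text \<open>The error bound does not depend on T; convergence is uniform on the unit ball and the
  square root is continuous there.\<close>

lemma norm_sqrt_iter_limit:
  fixes T :: "'a::banach \<Rightarrow>\<^sub>L 'a"
  assumes "norm T \<le> 1"
  shows "norm (sqrt_iter T n - (id_blinfun - sqrt_one_minus T)) \<le> 1 - sqrt_bound n"
proof (rule LIMSEQ_le)
  show "(\<lambda>m. norm (sqrt_iter T n - sqrt_iter T m)) \<longlonglongrightarrow> norm (sqrt_iter T n - (id_blinfun - sqrt_one_minus T))"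
    by (intro tendsto_intros sqrt_iter_tendsto assms)
  show "(\<lambda>m. sqrt_bound m - sqrt_bound n) \<longlonglongrightarrow> 1 - sqrt_bound n"
    by (intro tendsto_intros sqrt_bound_tendsto)
  show "\<exists>N. \<forall>m\<ge>N. norm (sqrt_iter T n - sqrt_iter T m) \<le> sqrt_bound m - sqrt_bound n"
    using norm_sqrt_iter_diff[OF assms, of n] by (auto simp: norm_minus_commute)
qed

lemmas compose_tendsto = bounded_bilinear.tendsto[OF bounded_bilinear_blinfun_compose]
lemmas compose_continuous_on = bounded_bilinear.continuous_on[OF bounded_bilinear_blinfun_compose]

context
  fixes T :: "'a::banach \<Rightarrow>\<^sub>L 'a"
  assumes T: "norm T \<le> 1"
begin

lemma sqrt_one_minus_square: "sqrt_one_minus T (sqrt_one_minus T x) = x - T x"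
proof -
  let ?B = "id_blinfun - sqrt_one_minus T"
  have "(\<lambda>n. sqrt_iter T (Suc n)) \<longlonglongrightarrow> (1/2) *\<^sub>R (T + (?B o\<^sub>L ?B))"
    unfolding sqrt_iter.simps by (intro tendsto_intros compose_tendsto sqrt_iter_tendsto T)
  then have "?B = (1/2) *\<^sub>R (T + (?B o\<^sub>L ?B))"
    using LIMSEQ_unique LIMSEQ_Suc[OF sqrt_iter_tendsto[OF T]] by blast
  then have "2 *\<^sub>R ?B x = 2 *\<^sub>R ((1/2) *\<^sub>R (T + (?B o\<^sub>L ?B))) x" by metis
  then have "2 *\<^sub>R (x - sqrt_one_minus T x)
      = T x + (x - sqrt_one_minus T x - sqrt_one_minus T (x - sqrt_one_minus T x))"
    by (simp add: blinfun.bilinear_simps)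
  then show ?thesis by (simp add: blinfun.bilinear_simps algebra_simps scaleR_2)
qed

text \<open>Every iterate is a polynomial in T.\<close>

lemma sqrt_one_minus_commute:
  assumes "Z o\<^sub>L T = T o\<^sub>L Z"
  shows "Z o\<^sub>L sqrt_one_minus T = sqrt_one_minus T o\<^sub>L Z"
proof -
  have Z: "Z (T x) = T (Z x)" for x
    using assms by (metis blinfun_apply_blinfun_compose)
  have "Z (sqrt_iter T n x) = sqrt_iter T n (Z x)" for n x
    by (induction n arbitrary: x) (simp_all add: blinfun.bilinear_simps Z)
  then have "Z o\<^sub>L sqrt_iter T n = sqrt_iter T n o\<^sub>L Z" for n by (intro blinfun_eqI) simp
  moreover have "(\<lambda>n. Z o\<^sub>L sqrt_iter T n) \<longlonglongrightarrow> (Z o\<^sub>L (id_blinfun - sqrt_one_minus T))"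
    "(\<lambda>n. sqrt_iter T n o\<^sub>L Z) \<longlonglongrightarrow> ((id_blinfun - sqrt_one_minus T) o\<^sub>L Z)"
    by (intro compose_tendsto tendsto_const sqrt_iter_tendsto T)+
  ultimately have "Z o\<^sub>L (id_blinfun - sqrt_one_minus T) = (id_blinfun - sqrt_one_minus T) o\<^sub>L Z"
    using LIMSEQ_unique by fastforce
  then have "(Z o\<^sub>L (id_blinfun - sqrt_one_minus T)) x = ((id_blinfun - sqrt_one_minus T) o\<^sub>L Z) x" for x
    by simp
  then show ?thesis by (intro blinfun_eqI) (simp add: blinfun.bilinear_simps)
qed

lemma commutes_mod_compact_sqrt_one_minus:
  assumes "commutes_mod_compact P T"
  shows "commutes_mod_compact P (sqrt_one_minus T)"
proof -
  have "commutes_mod_compact P (sqrt_iter T n)" for n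
    by (induction n) (auto intro!: commutes_mod_compact_scaleR commutes_mod_compact_add assms
        commutes_mod_compact_compose intro: commutes_mod_compactI)
  then have "commutes_mod_compact P (id_blinfun - (id_blinfun - sqrt_one_minus T))"
    by (intro commutes_mod_compact_diff commutes_mod_compact_lim[OF _ sqrt_iter_tendsto[OF T]]) auto
  then show ?thesis by simp
qed

end

context
  fixes T :: "'a::{banach,real_inner} \<Rightarrow>\<^sub>L 'a"
  assumes T: "norm T \<le> 1"
begin

lemma symmetric_sqrt_one_minus:
  assumes "symmetric_op T"
  shows "symmetric_op (sqrt_one_minus T)"
proof -
  have "inner (sqrt_iter T n x) y = inner x (sqrt_iter T n y)" for n x y
    using assms by (induction n arbitrary: x y)
      (simp_all add: blinfun.bilinear_simps inner_add symmetric_op_def)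
  moreover have "(\<lambda>n. inner (sqrt_iter T n x) y) \<longlonglongrightarrow> inner ((id_blinfun - sqrt_one_minus T) x) y"
    "(\<lambda>n. inner x (sqrt_iter T n y)) \<longlonglongrightarrow> inner x ((id_blinfun - sqrt_one_minus T) y)" for x y
    by (intro tendsto_intros blinfun.tendsto sqrt_iter_tendsto T)+
  ultimately have "inner ((id_blinfun - sqrt_one_minus T) x) y
      = inner x ((id_blinfun - sqrt_one_minus T) y)" for x y
    using LIMSEQ_unique by fastforce
  then show ?thesis
    by (simp add: symmetric_op_def blinfun.bilinear_simps inner_diff)
qed

text \<open>The error bound at n = 0 says that B = 1 - C has norm at most 1, and <C x, x> = <x, x> -
  <B x, x>.\<close>

lemma sqrt_one_minus_nonneg: "inner (sqrt_one_minus T x) x \<ge> 0"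
proof -
  have "norm (id_blinfun - sqrt_one_minus T) \<le> 1"
    using norm_sqrt_iter_limit[OF T, of 0] by (simp add: norm_minus_commute)
  have "inner ((id_blinfun - sqrt_one_minus T) x) x \<le> norm ((id_blinfun - sqrt_one_minus T) x) * norm x"
    by (rule norm_cauchy_schwarz)
  also have "\<dots> \<le> (norm (id_blinfun - sqrt_one_minus T) * norm x) * norm x"
    by (intro mult_right_mono norm_blinfun) simp
  also have "\<dots> \<le> (1 * norm x) * norm x"
    by (intro mult_right_mono \<open>norm (id_blinfun - sqrt_one_minus T) \<le> 1\<close>) auto
  also have "\<dots> = inner x x" by (simp add: norm_eq_sqrt_inner)
  finally show ?thesis by (simp add: blinfun.bilinear_simps inner_diff)
qed

end

lemma continuous_on_sqrt_one_minus:
  "continuous_on {T. norm T \<le> 1} (sqrt_one_minus :: ('a::banach \<Rightarrow>\<^sub>L 'a) \<Rightarrow> _)"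
proof -
  have "continuous_on {T :: 'a \<Rightarrow>\<^sub>L 'a. norm T \<le> 1} (\<lambda>T. id_blinfun - sqrt_one_minus T)"
  proof (rule uniform_limit_theorem[where F = sequentially and f = "\<lambda>n T. sqrt_iter T n"])
    have "continuous_on S (\<lambda>T :: 'a \<Rightarrow>\<^sub>L 'a. sqrt_iter T n)" for S n
      by (induction n) (auto intro!: continuous_intros compose_continuous_on)
    then show "\<forall>\<^sub>F n in sequentially. continuous_on {T :: 'a \<Rightarrow>\<^sub>L 'a. norm T \<le> 1} (\<lambda>T. sqrt_iter T n)"
      by simp
    show "uniform_limit {T :: 'a \<Rightarrow>\<^sub>L 'a. norm T \<le> 1} (\<lambda>n T. sqrt_iter T n)
        (\<lambda>T. id_blinfun - sqrt_one_minus T) sequentially"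
    proof (rule uniform_limitI)
      fix e :: real assume "e > 0"
      then have "\<forall>\<^sub>F n in sequentially. dist (sqrt_bound n) 1 < e"
        using sqrt_bound_tendsto tendstoD by blast
      then show "\<forall>\<^sub>F n in sequentially. \<forall>T\<in>{T :: 'a \<Rightarrow>\<^sub>L 'a. norm T \<le> 1}.
          dist (sqrt_iter T n) (id_blinfun - sqrt_one_minus T) < e"
      proof eventually_elim
        case (elim n)
        then have "1 - sqrt_bound n < e" by (simp add: dist_real_def)
        then show ?case using norm_sqrt_iter_limit[of _ n] by (fastforce simp: dist_norm)
      qed
    qed
  qed simp
  then have "continuous_on {T :: 'a \<Rightarrow>\<^sub>L 'a. norm T \<le> 1} (\<lambda>T. id_blinfun - (id_blinfun - sqrt_one_minus T))"
    by (rule continuous_on_diff[OF continuous_on_const])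
  then show ?thesis by simp
qed

section \<open>Polar decomposition and signs\<close>

definition op_inverse :: "('a::real_normed_vector \<Rightarrow>\<^sub>L 'a) \<Rightarrow> ('a \<Rightarrow>\<^sub>L 'a)" where
  "op_inverse M = (SOME N. \<forall>x. M (blinfun_apply N x) = x \<and> blinfun_apply N (M x) = x)"

text \<open>The lower bound closes the range, and skewness makes M vanish on the orthogonal
  complement of its range; injectivity then leaves no complement.\<close>

lemma skew_op_invertible:
  fixes M :: "'a::{real_inner,banach} \<Rightarrow>\<^sub>L 'a"
  assumes M: "skew_op M" "bounded_below M"
  shows "M (op_inverse M x) = x" "op_inverse M (M x) = x"
proof -
  obtain d where d: "d > 0" "\<And>x. d * norm x \<le> norm (M x)"
    using M(2) by (auto simp: bounded_below_def)
  have inj: "x = 0" if "M x = 0" for x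
  proof -
    have "d * norm x \<le> 0" using d(2)[of x] that by simp
    then show ?thesis using d(1) by (simp add: mult_le_0_iff)
  qed
  have "complete (range M)"
    using complete_isometric_image[OF d(1) subspace_UNIV, of M] d(2)
    by (auto simp: mult.commute blinfun.bounded_linear_right complete_UNIV)
  then have cR: "closed (range M)" by (simp add: complete_eq_closed)
  have R: "subspace (range M)"
    by (intro linear_subspace_image subspace_UNIV bounded_linear.linear blinfun.bounded_linear_right)
  have "\<exists>x. M x = y" for y
  proof -
    obtain r where r: "r \<in> range M" "\<And>v. v \<in> range M \<Longrightarrow> inner (y - r) v = 0"
      using exists_nearest_point[OF R cR] by blast
    have "inner (M (y - r)) x = 0" for x
      using r(2)[of "M x"] M(1) by (simp add: skew_op_def)
    then have "M (y - r) = 0" by (metis inner_eq_zero_iff)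
    then have "y - r = 0" by (rule inj)
    then show ?thesis using r(1) by auto
  qed
  then obtain N where N: "\<And>y. M (N y) = y" by metis
  have inj': "x = y" if "M x = M y" for x y
    using inj[of "x - y"] that by (simp add: blinfun.diff_right)
  have "bounded_linear N"
  proof (rule bounded_linear_intro[where K="1/d"])
    show "norm (N x) \<le> norm x * (1/d)" for x
      using d(2)[of "N x"] d(1) N by (simp add: field_simps)
    show "N (x + y) = N x + N y" for x y by (rule inj') (simp add: N blinfun.add_right)
    show "N (r *\<^sub>R x) = r *\<^sub>R N x" for r x by (rule inj') (simp add: N blinfun.scaleR_right)
  qed
  moreover have "N (M x) = x" for x by (rule inj') (rule N)
  ultimately have "\<exists>N. \<forall>x. M (blinfun_apply N x) = x \<and> blinfun_apply N (M x) = x"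
    by (intro exI[of _ "Blinfun N"]) (simp add: bounded_linear_Blinfun_apply N)
  from someI_ex[OF this] show "M (op_inverse M x) = x" "op_inverse M (M x) = x"
    unfolding op_inverse_def by blast+
qed

lemma skew_op_op_inverse:
  fixes M :: "'a::{real_inner,banach} \<Rightarrow>\<^sub>L 'a"
  assumes "skew_op M" "bounded_below M"
  shows "skew_op (op_inverse M)"
  unfolding skew_op_def
proof (intro allI)
  fix x y
  have "inner (op_inverse M x) (M (op_inverse M y)) = - inner (M (op_inverse M x)) (op_inverse M y)"
    using assms(1) by (simp add: skew_op_def)
  then show "inner (op_inverse M x) y = - inner x (op_inverse M y)"
    by (simp add: skew_op_invertible[OF assms])
qed

lemma antilinear_op_op_inverse:
  fixes M :: "'a::complex_hilbert_space \<Rightarrow>\<^sub>L 'a"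
  assumes "antilinear_op M" "skew_op M" "bounded_below M"
  shows "antilinear_op (op_inverse M)"
  unfolding antilinear_op_def
proof (intro allI)
  fix x
  have "op_inverse M (\<i> *\<^sub>C M (op_inverse M x)) = - op_inverse M (M (\<i> *\<^sub>C op_inverse M x))"
    using assms(1) by (simp add: antilinear_op_def blinfun.bilinear_simps)
  then show "op_inverse M (\<i> *\<^sub>C x) = - (\<i> *\<^sub>C op_inverse M x)"
    by (simp add: skew_op_invertible[OF assms(2,3)])
qed

lemma norm_op_inverse_le:
  fixes M :: "'a::{real_inner,banach} \<Rightarrow>\<^sub>L 'a"
  assumes "skew_op M" and d: "d > 0" "\<And>x. d * norm x \<le> norm (M x)"
  shows "norm (op_inverse M) \<le> 1/d"
proof (rule norm_blinfun_bound)
  have "bounded_below M" using d by (auto simp: bounded_below_def)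
  then show "norm (op_inverse M x) \<le> 1/d * norm x" for x
    using d(2)[of "op_inverse M x"] d(1) skew_op_invertible(1)[OF assms(1), of x]
    by (simp add: field_simps)
qed (use d in simp)

lemma continuous_on_op_inverse:
  "continuous_on {M :: 'a::{real_inner,banach} \<Rightarrow>\<^sub>L 'a. skew_op M \<and> bounded_below M} op_inverse"
  unfolding continuous_on_iff
proof (intro ballI allI impI)
  fix M0 :: "'a \<Rightarrow>\<^sub>L 'a" and e :: real
  assume M0: "M0 \<in> {M. skew_op M \<and> bounded_below M}" and e: "e > 0"
  then obtain d where d: "d > 0" "\<And>x. d * norm x \<le> norm (M0 x)" by (auto simp: bounded_below_def)
  \<comment> \<open>Within d/2 the lower bound of M is still d/2, so the inverses have norms at most
    2/d and 1/d. The second entry cancels these factors in M^-1 - M0^-1 = M^-1 (M0 - M)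
    M0^-1.\<close>
  define r where "r = min (d/2) (e * d * d / 2)"
  have "dist (op_inverse M) (op_inverse M0) < e"
    if M: "M \<in> {M. skew_op M \<and> bounded_below M}" and Mr: "dist M M0 < r" for M
  proof -
    have n: "norm (M0 - M) < d/2" "norm (M0 - M) < e * d * d / 2"
      using Mr by (simp_all add: r_def dist_norm norm_minus_commute)
    have dM: "d/2 * norm x \<le> norm (M x)" for x
    proof -
      have "d * norm x \<le> norm (M x + (M0 - M) x)" using d(2)[of x] by (simp add: blinfun.diff_left)
      also have "\<dots> \<le> norm (M x) + norm (M0 - M) * norm x"
        by (intro norm_triangle_mono norm_blinfun order_refl)
      also have "norm (M0 - M) * norm x \<le> d/2 * norm x" using n(1) by (intro mult_right_mono) auto
      finally show ?thesis by simp
    qed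
    have "op_inverse M - op_inverse M0 = op_inverse M o\<^sub>L ((M0 - M) o\<^sub>L op_inverse M0)"
      using M M0 by (intro blinfun_eqI) (simp add: blinfun.bilinear_simps skew_op_invertible)
    also have "norm \<dots> \<le> norm (op_inverse M) * (norm (M0 - M) * norm (op_inverse M0))"
      by (intro order_trans[OF norm_blinfun_compose] mult_left_mono norm_blinfun_compose) simp
    also have "\<dots> \<le> (1/(d/2)) * (norm (M0 - M) * (1/d))"
      using M M0 d dM by (intro mult_mono norm_op_inverse_le) auto
    also have "\<dots> < (1/(d/2)) * ((e * d * d / 2) * (1/d))"
      using n(2) d(1) by (intro mult_strict_left_mono mult_strict_right_mono) auto
    also have "\<dots> = e" using d(1) by (simp add: field_simps)
    finally show ?thesis by (simp add: dist_norm)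
  qed
  moreover have "r > 0" using d e by (simp add: r_def)
  ultimately show "\<exists>d>0. \<forall>x'\<in>{M. skew_op M \<and> bounded_below M}. dist x' M0 < d \<longrightarrow>
      dist (op_inverse x') (op_inverse M0) < e" by blast
qed

text \<open>With B adjoint to A, |x - B A x|^2 = |x|^2 - 2 |A x|^2 + |B A x|^2, and the last term is
  at most |A x|^2. This brings 1 - B A into the domain of the square root.\<close>

lemma norm_one_minus_adjoint_compose_le:
  fixes A B :: "'a::real_inner \<Rightarrow>\<^sub>L 'a"
  assumes adj: "\<And>x y. inner (B x) y = inner x (A y)" and B: "norm B \<le> 1"
  shows "norm (id_blinfun - (B o\<^sub>L A)) \<le> 1"
proof (rule norm_blinfun_bound)
  fix x
  have "norm (B (A x)) \<le> norm B * norm (A x)" by (rule norm_blinfun)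
  also have "\<dots> \<le> 1 * norm (A x)" by (intro mult_right_mono B) simp
  finally have "(norm (B (A x)))\<^sup>2 \<le> (norm (A x))\<^sup>2" by (simp add: power_mono)
  moreover have "inner (B (A x)) x = (norm (A x))\<^sup>2"
    by (simp add: adj power2_norm_eq_inner)
  moreover have "(norm (x - B (A x)))\<^sup>2 = (norm x)\<^sup>2 - 2 * inner (B (A x)) x + (norm (B (A x)))\<^sup>2"
    by (simp add: power2_norm_eq_inner inner_diff inner_commute)
  ultimately have "(norm (x - B (A x)))\<^sup>2 \<le> (norm x)\<^sup>2"
    using zero_le_power2[of "norm (A x)"] by linarith
  then have "norm (x - B (A x)) \<le> norm x" by (rule power2_le_imp_le) simp
  then show "norm ((id_blinfun - (B o\<^sub>L A)) x) \<le> 1 * norm x"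
    by (simp add: blinfun.diff_left)
qed simp

text \<open>For P = \<Lambda> these are exactly the operators J U with U in the space under study.
  The definition mentions no J, so unitaries unrelated to J can act by conjugation.\<close>

definition local_quaternionic :: "('a::complex_hilbert_space \<Rightarrow>\<^sub>L 'a) \<Rightarrow> ('a \<Rightarrow>\<^sub>L 'a) \<Rightarrow> bool" where
  "local_quaternionic P M \<longleftrightarrow>
    antilinear_op M \<and> skew_op M \<and> (\<forall>x. M (M x) = - x) \<and> commutes_mod_compact P M"

lemma norm_quaternionic:
  fixes M :: "'a::real_inner \<Rightarrow>\<^sub>L 'a"
  assumes "skew_op M" "\<And>x. M (M x) = - x"
  shows "norm (M x) = norm x"
  using assms by (simp add: norm_eq_sqrt_inner skew_op_def)

lemma local_form_if_quaternionic: "local_quaternionic P M \<Longrightarrow> local_form P M"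
  by (auto simp: local_quaternionic_def local_form_def bounded_below_def norm_quaternionic
      intro!: exI[of _ 1])

text \<open>
  The phase of \<open>M\<close> in its polar decomposition. Since \<open>M\<close> is skew, \<open>\<bar>M\<bar>\<^sup>2 = - M\<^sup>2\<close>, so \<open>\<bar>M\<bar>\<close> commutes
  with \<open>M\<close> and \<open>M \<bar>M\<bar>\<^sup>-\<^sup>1 = - M\<^sup>-\<^sup>1 \<bar>M\<bar>\<close>. Dividing \<open>M\<close> by \<open>\<parallel>M\<parallel> + 1\<close> brings \<open>- M\<^sup>2\<close> into the
  range of the square root above.
\<close>

definition phase_arg :: "('a::real_normed_vector \<Rightarrow>\<^sub>L 'a) \<Rightarrow> ('a \<Rightarrow>\<^sub>L 'a)" where
  "phase_arg M = id_blinfun + (1 / (norm M + 1)\<^sup>2) *\<^sub>R (M o\<^sub>L M)"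

text \<open>The root is |M| / (norm M + 1), hence the factor in front. In this form only the skew M
  has to be inverted, not |M|.\<close>

definition phase :: "('a::banach \<Rightarrow>\<^sub>L 'a) \<Rightarrow> ('a \<Rightarrow>\<^sub>L 'a)" where
  "phase M = - (norm M + 1) *\<^sub>R (op_inverse M o\<^sub>L sqrt_one_minus (phase_arg M))"

lemma norm_phase_arg_le:
  assumes "skew_op M"
  shows "norm (phase_arg M) \<le> 1"
proof -
  define s where "s = norm M + 1"
  have s: "s > 0" by (simp add: s_def add_nonneg_pos)
  let ?A = "(1/s) *\<^sub>R M"
  have "phase_arg M = id_blinfun - (- ?A o\<^sub>L ?A)"
    unfolding phase_arg_def s_def[symmetric]
    by (rule blinfun_eqI) (simp add: blinfun.bilinear_simps power2_eq_square)
  moreover have "norm (id_blinfun - (- ?A o\<^sub>L ?A)) \<le> 1"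
  proof (rule norm_one_minus_adjoint_compose_le)
    show "inner ((- ?A) x) y = inner x (?A y)" for x y
      using assms by (simp add: blinfun.bilinear_simps skew_op_def)
    show "norm (- ?A) \<le> 1" using s by (simp add: s_def)
  qed
  ultimately show ?thesis by simp
qed

lemma commute_phase_arg:
  fixes Z M :: "'a::real_normed_vector \<Rightarrow>\<^sub>L 'a"
  assumes Z: "\<And>x. Z (M (M x)) = M (M (blinfun_apply Z x))"
  shows "Z o\<^sub>L phase_arg M = phase_arg M o\<^sub>L Z"
  by (rule blinfun_eqI) (simp add: phase_arg_def blinfun.bilinear_simps Z)

text \<open>The hypothesis involves only M^2, so it also holds for multiplication by i, which
  anticommutes with an antilinear M.\<close>

lemma commute_phase_sqrt:
  fixes Z M :: "'a::complex_hilbert_space \<Rightarrow>\<^sub>L 'a"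
  assumes M: "skew_op M" and Z: "\<And>x. Z (M (M x)) = M (M (blinfun_apply Z x))"
  shows "Z (sqrt_one_minus (phase_arg M) x) = sqrt_one_minus (phase_arg M) (Z x)"
  using sqrt_one_minus_commute[OF norm_phase_arg_le[OF M] commute_phase_arg[of Z, OF Z]]
  by (metis blinfun_apply_blinfun_compose)

context
  fixes P M :: "'a::complex_hilbert_space \<Rightarrow>\<^sub>L 'a"
  assumes M: "local_form P M"
begin

lemma local_form_op_inverse: "M (op_inverse M x) = x" "op_inverse M (M x) = x"
  using M skew_op_invertible[of M] by (auto simp: local_form_def)

lemma phase_apply: "phase M x = - (norm M + 1) *\<^sub>R op_inverse M (sqrt_one_minus (phase_arg M) x)"
  by (simp add: phase_def blinfun.bilinear_simps)

lemma local_quaternionic_phase: "local_quaternionic P (phase M)"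
proof -
  define s where "s = norm M + 1"
  have s: "s > 0" by (simp add: s_def add_nonneg_pos)
  let ?N = "op_inverse M" and ?C = "sqrt_one_minus (phase_arg M)"
  note inv = local_form_op_inverse
  have sk: "skew_op M" and al: "antilinear_op M" and lc: "commutes_mod_compact P M"
    using M by (auto simp: local_form_def)
  have T1: "norm (phase_arg M) \<le> 1" by (rule norm_phase_arg_le[OF sk])
  have CN: "?N (?C x) = ?C (?N x)" for x by (rule commute_phase_sqrt[OF sk]) (simp add: inv)
  have Ci: "iop (?C x) = ?C (iop x)" for x
    by (rule commute_phase_sqrt[OF sk])
      (use al in \<open>simp add: antilinear_op_def blinfun.bilinear_simps\<close>)
  have CC: "?C (?C x) = - ((1/s\<^sup>2) *\<^sub>R M (M x))" for x
    unfolding sqrt_one_minus_square[OF T1]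
    by (simp add: phase_arg_def blinfun.bilinear_simps s_def)
  have bb: "bounded_below M" using M by (simp add: local_form_def)
  have Nanti: "?N (\<i> *\<^sub>C x) = - (\<i> *\<^sub>C ?N x)" for x
    using antilinear_op_op_inverse[OF al sk bb] by (simp add: antilinear_op_def)
  have Nskew: "inner (?N x) y = - inner x (?N y)" for x y
    using skew_op_op_inverse[OF sk bb] by (simp add: skew_op_def)
  have Tsym: "symmetric_op (phase_arg M)"
    using sk by (simp add: symmetric_op_def phase_arg_def blinfun.bilinear_simps inner_add skew_op_def)
  have Csym: "inner (?C x) y = inner x (?C y)" for x y
    using symmetric_sqrt_one_minus[OF T1 Tsym] by (simp add: symmetric_op_def)
  show ?thesis
    unfolding local_quaternionic_def
  proof (intro conjI allI)
    show "antilinear_op (phase M)"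
      unfolding antilinear_op_def phase_apply
      by (simp add: Ci[symmetric, unfolded iop_apply] Nanti blinfun.bilinear_simps scaleC.scaleR_right)
    show "skew_op (phase M)"
      unfolding skew_op_def phase_apply by (simp add: Nskew Csym CN)
    \<comment> \<open>The root C commutes with the inverse N of M, so the square is s^2 N^2 C^2, and
      C^2 = - M^2 / s^2.\<close>
    show "phase M (phase M x) = - x" for x
      unfolding phase_apply s_def[symmetric]
      using s by (simp add: blinfun.bilinear_simps CN[symmetric] CC inv power2_eq_square)
    have "commutes_mod_compact P ?N"
      by (rule commutes_mod_compact_inverse[OF lc]) (auto intro!: blinfun_eqI simp: inv)
    moreover have "commutes_mod_compact P ?C"
      unfolding phase_arg_def
      by (intro commutes_mod_compact_sqrt_one_minus[OF T1[unfolded phase_arg_def]]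
          commutes_mod_compact_add commutes_mod_compact_scaleR commutes_mod_compact_compose lc) simp
    ultimately show "commutes_mod_compact P (phase M)"
      unfolding phase_def by (intro commutes_mod_compact_scaleR commutes_mod_compact_compose)
  qed
qed

lemma phase_commute:
  fixes Z :: "'a \<Rightarrow>\<^sub>L 'a"
  assumes "\<And>x. Z (M x) = M (blinfun_apply Z x)"
  shows "Z (phase M x) = phase M (Z x)"
proof -
  have "Z (op_inverse M x) = op_inverse M (Z x)" for x
    by (metis assms local_form_op_inverse)
  moreover have "Z (sqrt_one_minus (phase_arg M) x) = sqrt_one_minus (phase_arg M) (Z x)" for x
    using M by (intro commute_phase_sqrt) (auto simp: assms local_form_def)
  ultimately show ?thesis by (simp add: phase_apply blinfun.bilinear_simps)
qed

end

text \<open>Here C^2 = 1/s^2. The vector w = C x - x/s satisfies C w = - w/s, and positivity of C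
  forces w = 0. Hence C = 1/s, and M^-1 = - M gives the claim.\<close>

lemma phase_of_quaternionic:
  fixes P M :: "'a::complex_hilbert_space \<Rightarrow>\<^sub>L 'a"
  assumes M: "local_quaternionic P M"
  shows "phase M = M"
proof (rule blinfun_eqI)
  fix x
  define s where "s = norm M + 1"
  have s: "s > 0" by (simp add: s_def add_nonneg_pos)
  have sk: "skew_op M" and MM: "\<And>x. M (M x) = - x" using M by (auto simp: local_quaternionic_def)
  let ?C = "sqrt_one_minus (phase_arg M)"
  have T1: "norm (phase_arg M) \<le> 1" by (rule norm_phase_arg_le[OF sk])
  have CC: "?C (?C x) = (1/s\<^sup>2) *\<^sub>R x" for x
    unfolding sqrt_one_minus_square[OF T1]
    by (simp add: phase_arg_def blinfun.bilinear_simps s_def MM)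
  have C: "?C x = (1/s) *\<^sub>R x" for x
  proof -
    define w where "w = ?C x - (1/s) *\<^sub>R x"
    have "?C w = (1/s) *\<^sub>R ((1/s) *\<^sub>R x - ?C x)"
      by (simp add: w_def blinfun.bilinear_simps CC power2_eq_square scaleR_diff_right)
    also have "\<dots> = - ((1/s) *\<^sub>R w)" by (simp add: w_def scaleR_diff_right)
    finally have "inner w w \<le> 0" using sqrt_one_minus_nonneg[OF T1, of w] s
      by (simp add: zero_le_divide_iff divide_le_0_iff)
    then have "w = 0" using inner_ge_zero[of w] by (simp add: antisym)
    then show ?thesis by (simp add: w_def)
  qed
  have N: "op_inverse M x = - M x" for x
    using local_form_op_inverse(2)[OF local_form_if_quaternionic[OF M], of "- M x"]
    by (simp add: blinfun.bilinear_simps MM)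
  show "phase M x = M x"
    unfolding phase_apply[OF local_form_if_quaternionic[OF M]] C N s_def[symmetric]
    using s by (simp add: blinfun.bilinear_simps)
qed

lemma continuous_on_phase:
  "continuous_on {M :: 'a::complex_hilbert_space \<Rightarrow>\<^sub>L 'a. skew_op M \<and> bounded_below M} phase"
proof -
  let ?S = "{M :: 'a \<Rightarrow>\<^sub>L 'a. skew_op M \<and> bounded_below M}"
  have "norm M + 1 \<noteq> 0" for M :: "'a \<Rightarrow>\<^sub>L 'a" using norm_ge_zero[of M] by linarith
  then have "continuous_on ?S phase_arg"
    unfolding phase_arg_def by (intro continuous_intros compose_continuous_on) auto
  then have "continuous_on ?S (\<lambda>M. sqrt_one_minus (phase_arg M))"
    by (rule continuous_on_compose2[OF continuous_on_sqrt_one_minus]) (auto simp: norm_phase_arg_le)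
  then show ?thesis
    unfolding phase_def
    by (intro continuous_intros compose_continuous_on continuous_on_op_inverse)
qed

text \<open>Endpoints that are already structures stay where they are, by
  \<open>phase_of_quaternionic\<close>.\<close>

lemma path_component_phase:
  assumes "path_component {M. local_form P M} A B"
  shows "path_component {M. local_quaternionic P M} (phase A) (phase B)"
proof -
  obtain g where g: "path g" "path_image g \<subseteq> {M. local_form P M}" "pathstart g = A" "pathfinish g = B"
    using assms unfolding path_component_def by blast
  have "continuous_on (path_image g) phase"
    by (rule continuous_on_subset[OF continuous_on_phase]) (use g(2) in \<open>auto simp: local_form_def\<close>)
  then have "path (phase \<circ> g)" by (rule path_continuous_image[OF g(1)])
  moreover have "path_image (phase \<circ> g) \<subseteq> {M. local_quaternionic P M}"
    using g(2) local_quaternionic_phase unfolding path_image_compose by blast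
  ultimately show ?thesis
    unfolding path_component_def using g(3,4)
    by (intro exI[of _ "phase \<circ> g"]) (simp add: pathstart_compose pathfinish_compose)
qed

text \<open>With A a rescaling of Y and C = |A|, let p project orthogonally onto V = ker (C - A).
  Then A = C on V and A = - C on its complement, so S = 2 p - 1 satisfies S A = C. On the kernel of
  Y the sign is +1.\<close>

lemma exists_sign_operator:
  fixes Y :: "'a::complex_hilbert_space \<Rightarrow>\<^sub>L 'a"
  assumes Y: "symmetric_op Y"
  obtains S :: "'a \<Rightarrow>\<^sub>L 'a" where "symmetric_op S" "\<And>x. S (S x) = x" "\<And>x. inner (S (Y x)) x \<ge> 0"
    "\<And>(Z :: 'a \<Rightarrow>\<^sub>L 'a) x. symmetric_op Z \<or> skew_op Z \<Longrightarrow> (\<And>x. Z (Y x) = Y (Z x)) \<Longrightarrow> blinfun_apply Z (S x) = S (blinfun_apply Z x)"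
proof -
  define s where "s = norm Y + 1"
  have s: "s > 0" by (simp add: s_def add_nonneg_pos)
  define A where "A = (1/s) *\<^sub>R Y"
  have Asym: "inner (A x) y = inner x (A y)" for x y
    using Y by (simp add: A_def symmetric_op_def blinfun.bilinear_simps)
  have YA: "Y x = s *\<^sub>R A x" for x using s by (simp add: A_def blinfun.bilinear_simps)
  define T where "T = id_blinfun - (A o\<^sub>L A)"
  have T1: "norm T \<le> 1"
    unfolding T_def by (rule norm_one_minus_adjoint_compose_le[OF Asym])
      (use s in \<open>simp add: A_def s_def\<close>)
  define C where "C = sqrt_one_minus T"
  have CC: "C (C x) = A (A x)" for x
    unfolding C_def sqrt_one_minus_square[OF T1] by (simp add: T_def blinfun.bilinear_simps)
  have "symmetric_op T"
    by (simp add: symmetric_op_def T_def blinfun.bilinear_simps inner_diff Asym)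
  then have Csym: "inner (C x) y = inner x (C y)" for x y
    using symmetric_sqrt_one_minus[OF T1] by (simp add: C_def symmetric_op_def)
  have comm: "Z (C x) = C (Z x)" if Z: "\<And>x. Z (A x) = A (blinfun_apply Z x)" for Z :: "'a \<Rightarrow>\<^sub>L 'a" and x
  proof -
    have "Z o\<^sub>L T = T o\<^sub>L Z"
      by (rule blinfun_eqI) (simp add: T_def blinfun.bilinear_simps Z)
    from sqrt_one_minus_commute[OF T1 this] show ?thesis
      unfolding C_def by (metis blinfun_apply_blinfun_compose)
  qed
  have AC: "A (C x) = C (A x)" for x by (rule comm) simp
  define V where "V = {x. C x = A x}"
  have V: "subspace V" by (simp add: V_def subspace_def blinfun.bilinear_simps)
  have "closed V" unfolding V_def by (intro closed_Collect_eq continuous_intros)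
  then obtain p :: "'a \<Rightarrow>\<^sub>L 'a" where p: "\<And>x. p x \<in> V" "\<And>x v. v \<in> V \<Longrightarrow> inner (x - p x) v = 0"
    using exists_proj_blinfun[OF V] by blast
  have p_eqI: "p x = y" if "y \<in> V" "\<And>v. v \<in> V \<Longrightarrow> inner (x - y) v = 0" for x y
  proof -
    have d: "p x - y \<in> V" using p(1) that(1) V by (simp add: subspace_diff)
    have "inner (p x - y) (p x - y) = inner (x - y) (p x - y) - inner (x - p x) (p x - y)"
      by (simp add: inner_diff)
    also have "\<dots> = 0" using that(2)[OF d] p(2)[OF d] by simp
    finally show ?thesis by simp
  qed
  have p_idem: "p (p x) = p x" for x by (rule p_eqI) (simp_all add: p)
  have psym: "inner (p x) y = inner x (p y)" for x y
    using p(2)[OF p(1), of x y] p(2)[OF p(1), of y x] by (simp add: inner_diff inner_commute)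
  have p_comm: "Z (p x) = p (Z x)"
    if Z: "symmetric_op Z \<or> skew_op Z" "\<And>x. Z (A x) = A (blinfun_apply Z x)" for Z :: "'a \<Rightarrow>\<^sub>L 'a" and x
  proof (rule p_eqI[symmetric])
    \<comment> \<open>Z commutes with A and C and so preserves V; being symmetric or skew, it
      preserves the complement of V as well, hence commutes with p.\<close>
    have ZV: "Z v \<in> V" if "v \<in> V" for v
      using that Z(2) comm[OF Z(2)] by (simp add: V_def) (metis)
    then show "Z (p x) \<in> V" using p(1) by blast
    fix v assume v: "v \<in> V"
    have "inner (Z (x - p x)) v = inner (x - p x) (Z v) \<or> inner (Z (x - p x)) v = - inner (x - p x) (Z v)"
      using Z(1) by (auto simp: symmetric_op_def skew_op_def)
    then show "inner (Z x - Z (p x)) v = 0"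
      using p(2)[OF ZV[OF v], of x] by (auto simp: blinfun.diff_right)
  qed
  have "symmetric_op A" using Asym by (simp add: symmetric_op_def)
  then have pA: "A (p x) = p (A x)" for x by (intro p_comm) auto
  have pC: "C (p x) = p (C x)" for x
    using Csym AC by (intro p_comm) (auto simp: symmetric_op_def)
  have neg: "A (x - p x) = - C (x - p x)" for x
  proof -
    let ?y = "x - p x"
    \<comment> \<open>Since A and C commute and have equal squares, C - A kills the image of C + A.
      On the complement of V this image is also orthogonal to V, hence zero.\<close>
    have "A ?y + C ?y \<in> V"
      by (simp add: V_def blinfun.bilinear_simps CC AC algebra_simps)
    then have "p (A ?y + C ?y) = A ?y + C ?y" by (intro p_eqI) simp_all
    moreover have "p (A ?y + C ?y) = 0"
      by (simp add: blinfun.add_right pA[symmetric] pC[symmetric])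
        (simp add: blinfun.bilinear_simps p_idem)
    ultimately show ?thesis by (simp add: eq_neg_iff_add_eq_0)
  qed
  define S where "S = p + p - id_blinfun"
  have S: "S x = p x + p x - x" for x by (simp add: S_def blinfun.bilinear_simps)
  have SA: "S (A x) = C x" for x
  proof -
    have "S (A x) = A (p x) - A (x - p x)" by (simp add: S blinfun.diff_right pA)
    also have "A (p x) = C (p x)" using p(1)[of x] by (simp add: V_def)
    finally show ?thesis unfolding neg by (simp add: blinfun.diff_right)
  qed
  show thesis
  proof (rule that[of S])
    show "symmetric_op S" by (simp add: symmetric_op_def S inner_add inner_diff psym)
    show "S (S x) = x" for x by (simp add: S blinfun.bilinear_simps p_idem)
    show "inner (S (Y x)) x \<ge> 0" for x
      using s sqrt_one_minus_nonneg[OF T1, of x]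
      by (simp add: YA blinfun.bilinear_simps SA) (simp add: C_def)
    show "Z (S x) = S (Z x)" if "symmetric_op Z \<or> skew_op Z" "\<And>x. Z (Y x) = Y (blinfun_apply Z x)" for Z :: "'a \<Rightarrow>\<^sub>L 'a" and x
    proof -
      have "Z (A x) = A (Z x)" for x using that(2) by (simp add: A_def blinfun.bilinear_simps)
      from p_comm[of Z, OF that(1) this] show ?thesis by (simp add: S blinfun.bilinear_simps)
    qed
  qed
qed

section \<open>Paths of skew forms\<close>

lemma path_component_if_segment:
  fixes a b :: "'a::real_normed_vector"
  shows "closed_segment a b \<subseteq> S \<Longrightarrow> path_component S a b"
  unfolding path_component_def by (intro exI[of _ "linepath a b"]) simp

lemma antilinear_op_combination:
  assumes "antilinear_op A" "antilinear_op B"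
  shows "antilinear_op (a *\<^sub>R A + b *\<^sub>R B)"
  using assms by (simp add: antilinear_op_def blinfun.bilinear_simps scaleC.scaleR_right scaleC.add_right)

lemma skew_op_combination:
  assumes "skew_op A" "skew_op B"
  shows "skew_op (a *\<^sub>R A + b *\<^sub>R B)"
  using assms by (simp add: skew_op_def blinfun.bilinear_simps inner_add)

text \<open>A nonnegative inner product keeps the segment away from 0: the squared norm at time t is
  at least (1 - t)^2 + t^2 times |x|^2, bounded here by the convenient constant 1/4. The phase turns
  the segment into a path of structures.\<close>

lemma path_component_if_acute:
  fixes P A B :: "'a::complex_hilbert_space \<Rightarrow>\<^sub>L 'a"
  assumes A: "local_quaternionic P A" and B: "local_quaternionic P B"
    and acute: "\<And>x. inner (A x) (B x) \<ge> 0"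
  shows "path_component {M. local_quaternionic P M} A B"
proof -
  have "local_form P ((1 - t) *\<^sub>R A + t *\<^sub>R B)" if t: "0 \<le> t" "t \<le> 1" for t
  proof -
    let ?N = "(1 - t) *\<^sub>R A + t *\<^sub>R B"
    have nA: "inner (A x) (A x) = inner x x" and nB: "inner (B x) (B x) = inner x x" for x
      using A B norm_quaternionic[of A x] norm_quaternionic[of B x]
      by (auto simp: local_quaternionic_def norm_eq_sqrt_inner)
    have "1/2 * norm x \<le> norm (?N x)" for x
    proof (rule power2_le_imp_le)
      have "(1 - t)\<^sup>2 + t\<^sup>2 - 1/4 = 1/4 + 2 * (t - 1/2)\<^sup>2" by (simp add: power2_eq_square algebra_simps)
      then have "1/4 \<le> (1 - t)\<^sup>2 + t\<^sup>2" using zero_le_power2[of "t - 1/2"] by linarith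
      then have "1/4 * inner x x \<le> ((1 - t)\<^sup>2 + t\<^sup>2) * inner x x" by (intro mult_right_mono) auto
      also have "\<dots> \<le> ((1 - t)\<^sup>2 + t\<^sup>2) * inner x x + 2 * ((1 - t) * t * inner (A x) (B x))"
        using t acute[of x] by simp
      also have "\<dots> = inner (?N x) (?N x)"
        by (simp add: blinfun.bilinear_simps inner_add inner_commute[of "B x" "A x"] nA nB
            power2_eq_square algebra_simps)
      finally show "(1/2 * norm x)\<^sup>2 \<le> (norm (?N x))\<^sup>2"
        unfolding power_mult_distrib power2_norm_eq_inner by (simp add: power2_eq_square)
    qed simp
    then have "bounded_below ?N" unfolding bounded_below_def by (intro exI[of _ "1/2"]) simp
    then show ?thesis
      using A B unfolding local_form_def local_quaternionic_def
      by (intro conjI antilinear_op_combination skew_op_combination commutes_mod_compact_add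
          commutes_mod_compact_scaleR) auto
  qed
  then have "path_component {M. local_form P M} A B"
    by (intro path_component_if_segment) (auto simp: closed_segment_def)
  then show ?thesis
    using path_component_phase phase_of_quaternionic[OF A] phase_of_quaternionic[OF B] by metis
qed

text \<open>
  Two structures \<open>A\<close> and \<open>J\<close> commuting with \<open>P\<close> are joined through \<open>J \<i> S\<close>, where \<open>S\<close> is the sign of the
  self-adjoint operator \<open>Y = - \<i> (A J - J A) / 2\<close>; for \<open>A = J U\<close> the latter is the imaginary part of \<open>U\<close>.
\<close>

lemma path_component_if_commute:
  fixes P A J :: "'a::complex_hilbert_space \<Rightarrow>\<^sub>L 'a"
  assumes P: "projection_op P"
    and A: "local_quaternionic P A" "\<And>x. P (A x) = A (P x)"
    and J: "local_quaternionic P J" "\<And>x. P (J x) = J (P x)"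
  shows "path_component {M. local_quaternionic P M} A J"
proof -
  have i: "A (\<i> *\<^sub>C x) = - (\<i> *\<^sub>C A x)" "J (\<i> *\<^sub>C x) = - (\<i> *\<^sub>C J x)" for x
    using A(1) J(1) by (auto simp: local_quaternionic_def antilinear_op_def)
  have sq: "A (A x) = - x" "J (J x) = - x" for x
    using A(1) J(1) by (auto simp: local_quaternionic_def)
  have skA: "inner (A x) y = - inner x (A y)" and skJ: "inner (J x) y = - inner x (J y)" for x y
    using A(1) J(1) by (auto simp: local_quaternionic_def skew_op_def)
  have ii: "\<i> *\<^sub>C \<i> *\<^sub>C (x :: 'a) = - x" for x by (simp add: scaleC_scaleC)
  define Y where "Y = (- 1/2) *\<^sub>R (iop o\<^sub>L ((A o\<^sub>L J) - (J o\<^sub>L A)))"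
  have Y: "Y x = (- 1/2) *\<^sub>R (\<i> *\<^sub>C (A (J x) - J (A x)))" for x
    by (simp add: Y_def blinfun.bilinear_simps)
  have "symmetric_op Y"
    by (simp add: symmetric_op_def Y inner_i_left inner_diff skA skJ i scaleC.diff_right)
  then obtain S :: "'a \<Rightarrow>\<^sub>L 'a" where S: "symmetric_op S" "\<And>x. S (S x) = x" "\<And>x. inner (S (Y x)) x \<ge> 0"
    "\<And>(Z :: 'a \<Rightarrow>\<^sub>L 'a) x. symmetric_op Z \<or> skew_op Z \<Longrightarrow> (\<And>x. Z (Y x) = Y (Z x)) \<Longrightarrow> Z (S x) = S (Z x)"
    using exists_sign_operator by blast
  have SY: "Y (S x) = S (Y x)" for x using \<open>symmetric_op Y\<close> by (intro S(4)) auto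
  have "iop (S x) = S (iop x)" for x
  proof (rule S(4))
    show "symmetric_op (iop :: 'a \<Rightarrow>\<^sub>L 'a) \<or> skew_op (iop :: 'a \<Rightarrow>\<^sub>L 'a)" by (simp add: skew_op_def inner_i_left)
  qed (simp add: Y i blinfun.bilinear_simps scaleC.scaleR_right scaleC.diff_right)
  then have Si: "\<i> *\<^sub>C S x = S (\<i> *\<^sub>C x)" for x by simp
  have SA: "A (S x) = S (A x)" for x
    by (rule S(4)) (auto simp: skew_op_def skA Y i sq blinfun.bilinear_simps scaleC.diff_right)
  have SJ: "J (S x) = S (J x)" for x
    by (rule S(4)) (auto simp: skew_op_def skJ Y i sq blinfun.bilinear_simps scaleC.diff_right)
  have SP: "P (S x) = S (P x)" for x
    by (rule S(4))
      (auto simp: symmetric_op_def projection_opD[OF P] Y A(2) J(2) blinfun.bilinear_simps)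
  have Ssym: "inner (S x) y = inner x (S y)" for x y using S(1) by (simp add: symmetric_op_def)
  \<comment> \<open>The segment from A to J can pass through 0, for instance when A = - J. The
    intermediate structure B makes a nonobtuse angle with A and a right angle with J.\<close>
  define B where "B = J o\<^sub>L (iop o\<^sub>L S)"
  have Bx: "B x = J (\<i> *\<^sub>C S x)" for x by (simp add: B_def)
  have "local_quaternionic P B"
    unfolding local_quaternionic_def
  proof (intro conjI allI)
    show "antilinear_op B" by (simp add: antilinear_op_def Bx Si[symmetric] i ii blinfun.bilinear_simps)
    show "skew_op B"
      by (simp add: skew_op_def Bx skJ inner_i_left Ssym Si SJ i blinfun.bilinear_simps)
    show "B (B x) = - x" for x
      by (simp add: Bx i SJ Si[symmetric] sq ii S(2) blinfun.bilinear_simps)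
    show "commutes_mod_compact P B"
      by (intro commutes_mod_compactI blinfun_eqI) (simp add: Bx J(2) SP projection_opD[OF P])
  qed
  have "inner (A x) (B x) \<ge> 0" for x
  proof -
    have "inner (A x) (B x) = - inner x (A (B x))" by (simp add: skA)
    moreover have "inner (B x) (A x) = - inner x (B (A x))"
      using \<open>local_quaternionic P B\<close> by (simp add: local_quaternionic_def skew_op_def)
    then have "inner (A x) (B x) = - inner (B (A x)) x" by (simp add: inner_commute)
    \<comment> \<open>By skewness of A and B, 2 <A x, B x> = - <(A B + B A) x, x>, which equals 2 <S
      Y x, x>; this is nonnegative because S is the sign of Y.\<close>
    moreover have "A (B x) + B (A x) = - 2 *\<^sub>R S (Y x)"
      unfolding SY[symmetric]
      by (simp add: Bx Y SA[symmetric] i blinfun.bilinear_simps scaleC.diff_right)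
    then have "inner (A (B x) + B (A x)) x = inner (- 2 *\<^sub>R S (Y x)) x" by (rule arg_cong)
    then have "inner x (A (B x)) + inner (B (A x)) x = - 2 * inner (S (Y x)) x"
      by (simp add: inner_add_left inner_add_right inner_commute)
    ultimately show ?thesis using S(3)[of x] by linarith
  qed
  then have "path_component {M. local_quaternionic P M} A B"
    by (intro path_component_if_acute A \<open>local_quaternionic P B\<close>)
  \<comment> \<open>J preserves the real inner product, and i S is skew because S is symmetric and
    commutes with i.\<close>
  moreover have "inner (B x) (J x) = 0" for x
  proof -
    have "inner (B x) (J x) = inner (\<i> *\<^sub>C S x) x" by (simp add: Bx skJ sq)
    moreover have "inner (\<i> *\<^sub>C S x) x = - inner (\<i> *\<^sub>C S x) x"
      by (subst inner_i_left) (simp add: Ssym Si inner_commute)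
    ultimately show ?thesis by linarith
  qed
  then have "path_component {M. local_quaternionic P M} B J"
    by (intro path_component_if_acute J \<open>local_quaternionic P B\<close>) simp
  ultimately show ?thesis by (rule path_component_trans)
qed

text \<open>
  A kernel of dimension at least two is reduced by two dimensions by adding a small multiple of the
  skew form \<open>e1 \<and> e2\<close> of two orthonormal vectors of the kernel.
\<close>

lemma form_kernel_reduce:
  fixes P M :: "'a::complex_hilbert_space \<Rightarrow>\<^sub>L 'a"
  assumes P: "projection_op P" and M: "local_form P M"
    and dim: "complex_vector.dim (form_kernel P M) = Suc (Suc n)"
  shows "\<exists>M'. path_component {M. local_form P M} M M' \<and> local_form P M' \<and>
    complex_vector.dim (form_kernel P M') = n"
proof -
  let ?K = "form_kernel P M"
  have sub: "complex_vector.subspace ?K"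
    by (intro complex_subspace_form_kernel P local_form_antilinear[OF P M])
  have fin: "cfinite_dim ?K" by (rule cfinite_dim_form_kernel[OF P M])
  have "\<not> ?K \<subseteq> {0}" using cdim_eq_0_iff[OF sub fin] dim by simp
  then obtain e1 where e1: "e1 \<in> ?K" "norm e1 = 1" using exists_unit_vector[OF sub] by blast
  let ?K1 = "{y \<in> ?K. cinner e1 y = 0}"
  have dim1: "complex_vector.dim ?K1 = Suc n"
    using cdim_hyperplane[OF sub fin e1(1), of e1] e1(2) dim by (simp add: cinner_self)
  have sub1: "complex_vector.subspace ?K1" by (rule subspace_orthogonal[OF sub])
  have fin1: "cfinite_dim ?K1" by (rule cfinite_dim_subset[OF fin]) auto
  have "\<not> ?K1 \<subseteq> {0}" using cdim_eq_0_iff[OF sub1 fin1] dim1 by simp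
  then obtain e2 where e2: "e2 \<in> ?K1" "norm e2 = 1" using exists_unit_vector[OF sub1] by blast
  let ?K2 = "{y \<in> ?K1. cinner e2 y = 0}"
  have dim2: "complex_vector.dim ?K2 = n"
    using cdim_hyperplane[OF sub1 fin1 e2(1), of e2] e2(2) dim1 by (simp add: cinner_self)
  have e11: "cinner e1 e1 = 1" and e22: "cinner e2 e2 = 1" and e12: "cinner e1 e2 = 0"
    using e1 e2 by (simp_all add: cinner_self)
  have e21: "cinner e2 e1 = 0" using e12 cinner_commute[of e2 e1] by simp
  have Pe: "P e1 = e1" "P e2 = e2" using e1 e2 by (simp_all add: form_kernel_def)
  define F where "F = Blinfun (\<lambda>y. cinner y e1 *\<^sub>C e2 - cinner y e2 *\<^sub>C e1)"
  have F: "F y = cinner y e1 *\<^sub>C e2 - cinner y e2 *\<^sub>C e1" for y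
    unfolding F_def
    by (subst bounded_linear_Blinfun_apply) (auto intro!: bounded_linear_sub
        bounded_linear_compose[OF scaleC.bounded_linear_left cinner.bounded_linear_left])
  have PF: "P (F y) = F y" for y by (simp add: F blinfun.diff_right projection_opD[OF P] Pe)
  have FP: "F (P y) = F y" for y by (simp add: F projection_opD(3)[OF P] Pe)
  have antiF: "antilinear_op F"
    by (simp add: antilinear_op_def F cinner_scaleC_left scaleC_scaleC scaleC.diff_right scaleC.minus_left)
  have "cinner (F x) y + cnj (cinner x (F y)) = 0" for x y
    using cinner_commute[of e1 x] cinner_commute[of e2 x] cinner_commute[of e1 y] cinner_commute[of e2 y]
    by (simp add: F cinner.diff_left cinner.diff_right cinner_scaleC_left cinner_scaleC_right
        cinner_commute[of x e1] cinner_commute[of x e2] cinner_commute[of y e1] cinner_commute[of y e2])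
  then have "Re (cinner (F x) y + cnj (cinner x (F y))) = 0" for x y by simp
  then have skewF: "skew_op F" by (simp add: skew_op_def Re_cinner eq_neg_iff_add_eq_0)
  obtain d where d: "d > 0" "\<And>x. d * norm x \<le> norm (M x)"
    using M by (auto simp: local_form_def bounded_below_def)
  \<comment> \<open>With r = d / (2 q) the perturbation r F has norm at most d/2, so the whole
    segment keeps the lower bound d/2.\<close>
  define q where "q = norm F + 1"
  define r where "r = d / (2 * q)"
  have pos: "q > 0" by (simp add: q_def add_nonneg_pos)
  then have r: "r > 0" using d(1) by (simp add: r_def)
  have "r * norm F \<le> r * q" using r by (simp add: q_def)
  also have "\<dots> = d/2" using pos by (simp add: r_def)
  finally have rF: "r * norm F \<le> d/2" .
  have LF: "local_form P (M + t *\<^sub>R F)" if t: "0 \<le> t" "t \<le> r" for t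
  proof -
    have "d/2 * norm x \<le> norm ((M + t *\<^sub>R F) x)" for x
    proof -
      have "d * norm x \<le> norm (M x)" by (rule d(2))
      also have "\<dots> \<le> norm ((M + t *\<^sub>R F) x) + norm (t *\<^sub>R F x)"
        using norm_triangle_ineq4[of "(M + t *\<^sub>R F) x" "t *\<^sub>R F x"] by (simp add: blinfun.bilinear_simps)
      also have "norm (t *\<^sub>R F x) \<le> r * (norm F * norm x)"
        using t unfolding norm_scaleR by (intro mult_mono norm_blinfun) auto
      also have "\<dots> \<le> d/2 * norm x"
        using mult_right_mono[OF rF norm_ge_zero[of x]] by (simp add: mult.assoc)
      finally show ?thesis by simp
    qed
    then have "bounded_below (M + t *\<^sub>R F)"
      using d(1) unfolding bounded_below_def by (intro exI[of _ "d/2"]) simp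
    moreover have "commutes_mod_compact P F"
      by (intro commutes_mod_compactI blinfun_eqI) (simp add: PF FP)
    ultimately show ?thesis
      using M antilinear_op_combination[of M F 1 t] skew_op_combination[of M F 1 t] antiF skewF
      by (auto simp: local_form_def intro!: commutes_mod_compact_add commutes_mod_compact_scaleR)
  qed
  let ?M' = "M + r *\<^sub>R F"
  have "closed_segment M ?M' \<subseteq> {M. local_form P M}"
  proof
    fix N assume "N \<in> closed_segment M ?M'"
    then obtain u where u: "0 \<le> u" "u \<le> 1" "N = (1 - u) *\<^sub>R M + u *\<^sub>R ?M'"
      by (auto simp: closed_segment_def)
    then have "N = M + (u * r) *\<^sub>R F" by (simp add: algebra_simps)
    then show "N \<in> {M. local_form P M}" using u(1,2) r LF[of "u * r"] by (simp add: mult_left_le_one_le)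
  qed
  then have "path_component {M. local_form P M} M ?M'" by (rule path_component_if_segment)
  moreover have "form_kernel P ?M' = ?K2"
  proof -
    \<comment> \<open>Radical vectors are orthogonal to P M y. Pairing P M y + r F y = 0 with e1 and
      e2 therefore isolates F y, whose coefficients must vanish.\<close>
    have orth: "cinner e (P (M y)) = 0" if "e \<in> ?K" "P y = y" for e y
    proof -
      have "cinner e (P (M y)) = cinner e (M y)"
        using that projection_opD(3)[OF P, of e "M y"] by (simp add: form_kernel_def)
      also have "\<dots> = - cinner y (M e)" by (rule cinner_skew[OF local_form_antilinear[OF P M] local_form_skew[OF P M]])
      also have "\<dots> = - cinner y (P (M e))" using projection_opD(3)[OF P, of y "M e"] that by simp
      finally show ?thesis using that(1) by (simp add: form_kernel_def cinner.zero_right)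
    qed
    have "y \<in> ?K2" if y: "y \<in> form_kernel P ?M'" for y
    proof -
      have Py: "P y = y" and 0: "P (M y) + r *\<^sub>R F y = 0"
        using y by (simp_all add: form_kernel_def blinfun.bilinear_simps PF)
      have "cinner e1 (P (M y) + r *\<^sub>R F y) = 0" "cinner e2 (P (M y) + r *\<^sub>R F y) = 0"
        unfolding 0 by (simp_all add: cinner.zero_right)
      then have "cinner e1 (F y) = 0" "cinner e2 (F y) = 0"
        using orth[OF e1(1) Py] orth[of e2, OF _ Py] e2(1) r
        by (simp_all add: cinner.add_right cinner.scaleR_right)
      then have c: "cinner y e2 = 0" "cinner y e1 = 0"
        by (simp_all add: F cinner.diff_right cinner_scaleC_right e11 e12 e21 e22)
      then have "F y = 0" by (simp add: F)
      then show ?thesis using c 0 Py cinner_commute[of e1 y] cinner_commute[of e2 y]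
        by (simp add: form_kernel_def)
    qed
    moreover have "y \<in> form_kernel P ?M'" if "y \<in> ?K2" for y
      using that cinner_commute[of y e1] cinner_commute[of y e2]
      by (simp add: form_kernel_def blinfun.bilinear_simps PF F)
    ultimately show ?thesis by blast
  qed
  ultimately show ?thesis using dim2 LF[of r] r by (intro exI[of _ ?M']) simp
qed

lemma form_kernel_reduce_even:
  fixes P M :: "'a::complex_hilbert_space \<Rightarrow>\<^sub>L 'a"
  assumes P: "projection_op P"
  shows "local_form P M \<Longrightarrow> complex_vector.dim (form_kernel P M) = 2 * n \<Longrightarrow>
    \<exists>M'. path_component {M. local_form P M} M M' \<and> local_form P M' \<and>
      complex_vector.dim (form_kernel P M') = 0"
proof (induction n arbitrary: M)
  case 0
  then show ?case by (intro exI[of _ M]) (simp add: path_component_refl)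
next
  case (Suc n)
  then have "complex_vector.dim (form_kernel P M) = Suc (Suc (2 * n))" by simp
  from form_kernel_reduce[OF P Suc.prems(1) this] Suc.IH show ?case
    by (meson path_component_trans)
qed

lemma bounded_below_compose:
  assumes "bounded_below A" "bounded_below B"
  shows "bounded_below (A o\<^sub>L B)"
proof -
  obtain c d where c: "c > 0" "\<And>x. c * norm x \<le> norm (A x)" and d: "d > 0" "\<And>x. d * norm x \<le> norm (B x)"
    using assms by (auto simp: bounded_below_def)
  have "(c * d) * norm x \<le> norm (A (B x))" for x
  proof -
    have "c * (d * norm x) \<le> c * norm (B x)" using c(1) d(2)[of x] by simp
    also have "\<dots> \<le> norm (A (B x))" by (rule c(2))
    finally show ?thesis by (simp add: mult.assoc)
  qed
  then show ?thesis using c(1) d(1) unfolding bounded_below_def by (intro exI[of _ "c * d"]) simp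
qed

lemma bounded_below_if_left_inverse:
  fixes A B :: "'a::real_normed_vector \<Rightarrow>\<^sub>L 'a"
  assumes "\<And>x. B (blinfun_apply A x) = x"
  shows "bounded_below A"
  unfolding bounded_below_def
proof (intro exI[of _ "1 / (norm B + 1)"] conjI allI)
  have pos: "norm B + 1 > 0" by (simp add: add_nonneg_pos)
  then show "1 / (norm B + 1) > 0" by simp
  fix x
  have "norm x = norm (B (A x))" by (simp add: assms)
  also have "\<dots> \<le> norm B * norm (A x)" by (rule norm_blinfun)
  also have "\<dots> \<le> (norm B + 1) * norm (A x)" by (intro mult_right_mono) auto
  finally show "1 / (norm B + 1) * norm x \<le> norm (A x)"
    using pos by (simp add: divide_le_eq mult.commute)
qed

text \<open>Block elimination: \<open>(1 - t Y) M (1 - t Z)\<close> is a congruence which is block diagonal at \<open>t = 1\<close>.\<close>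

lemma path_component_commuting_if_form_kernel_trivial:
  fixes P M J :: "'a::complex_hilbert_space \<Rightarrow>\<^sub>L 'a"
  assumes P: "projection_op P" and M: "local_form P M"
    and J: "local_quaternionic P J" "\<And>x. P (J x) = J (P x)"
    and K: "form_kernel P M \<subseteq> {0}"
  shows "\<exists>M'. path_component {M. local_form P M} M M' \<and> local_form P M' \<and> (\<forall>x. P (M' x) = M' (P x))"
proof -
  note PP = projection_opD[OF P]
  have al: "antilinear_op M" and sk: "skew_op M" and bb: "bounded_below M"
    and lc: "commutes_mod_compact P M"
    using M by (auto simp: local_form_def)
  have Ji: "J (\<i> *\<^sub>C x) = - (\<i> *\<^sub>C J x)" and Jsk: "inner (J x) y = - inner x (J y)"
    and nJ: "norm (J x) = norm x" for x y
    using J(1) norm_quaternionic[of J x] by (auto simp: local_quaternionic_def antilinear_op_def skew_op_def)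
  have Mi: "M (\<i> *\<^sub>C x) = - (\<i> *\<^sub>C M x)" and Msk: "inner (M x) y = - inner x (M y)" for x y
    using al sk by (auto simp: antilinear_op_def skew_op_def)
  have "\<exists>d>0. \<forall>y\<in>{y. P y = y}. d * norm y \<le> norm ((P o\<^sub>L M) y)"
    by (rule form_bounded_below[OF P M subspace_range_projection closed_range_projection])
      (use K in \<open>auto simp: form_kernel_def\<close>)
  then obtain d0 where d0: "d0 > 0" "\<And>y. P y = y \<Longrightarrow> d0 * norm y \<le> norm (P (M y))" by auto
  define Q where "Q = id_blinfun - P"
  have Q: "Q x = x - P x" for x by (simp add: Q_def blinfun.diff_left)
  \<comment> \<open>The compression of M on the range of P, completed by J on the kernel to a skew
    operator bounded below on the whole space, so that \<open>op_inverse\<close> applies.\<close>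
  define R where "R = (P o\<^sub>L (M o\<^sub>L P)) + (J o\<^sub>L Q)"
  have R: "R x = P (M (P x)) + J (x - P x)" for x by (simp add: R_def blinfun.add_left Q)
  have RP: "P (R x) = R (P x)" for x
    by (simp add: R blinfun.bilinear_simps PP J(2))
  have skR: "skew_op R"
    by (simp add: skew_op_def R inner_add inner_diff blinfun.bilinear_simps PP(4) Msk Jsk J(2))
  have alR: "antilinear_op R"
    by (simp add: antilinear_op_def R blinfun.bilinear_simps PP Mi Ji scaleC.add_right
        scaleC.diff_right)
  have bbR: "bounded_below R"
    unfolding bounded_below_def
  proof (intro exI[of _ "min d0 1"] conjI allI)
    show "min d0 1 > 0" using d0 by simp
    fix x
    have orth: "inner (P u) (v - P v) = 0" for u v by (simp add: PP(1,4) inner_diff)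
    have pyth: "(norm (P u + (v - P v)))\<^sup>2 = (norm (P u))\<^sup>2 + (norm (v - P v))\<^sup>2" for u v
      using orth[of u v]
      by (simp only: power2_norm_eq_inner inner_add inner_commute[of "v - P v" "P u"])
    have "min d0 1 * norm (P x) \<le> d0 * norm (P x)" by (intro mult_right_mono) auto
    also have "\<dots> \<le> norm (P (M (P x)))" by (rule d0(2)) (rule PP(1))
    finally have "(min d0 1 * norm (P x))\<^sup>2 \<le> (norm (P (M (P x))))\<^sup>2"
      using d0(1) by (intro power_mono) auto
    moreover have "min d0 1 * norm (x - P x) \<le> 1 * norm (J (x - P x))"
      unfolding nJ by (intro mult_right_mono) auto
    then have "(min d0 1 * norm (x - P x))\<^sup>2 \<le> (norm (J (x - P x)))\<^sup>2"
      using d0(1) by (intro power_mono) auto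
    moreover have "(norm (R x))\<^sup>2 = (norm (P (M (P x))))\<^sup>2 + (norm (J (x - P x)))\<^sup>2"
      using pyth[of "M (P x)" "J x"] by (simp add: R blinfun.diff_right J(2))
    moreover have "(norm x)\<^sup>2 = (norm (P x))\<^sup>2 + (norm (x - P x))\<^sup>2"
      using pyth[of x x] by simp
    ultimately have "(min d0 1 * norm x)\<^sup>2 \<le> (norm (R x))\<^sup>2"
      by (simp add: power_mult_distrib distrib_left)
    then show "min d0 1 * norm x \<le> norm (R x)" by (rule power2_le_imp_le) simp
  qed
  let ?N0 = "op_inverse R"
  note inv = skew_op_invertible[OF skR bbR]
  have N0P: "P (?N0 x) = ?N0 (P x)" for x by (metis RP inv)
  \<comment> \<open>The inverse of the compression on the range of P, extended by 0. It commutes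
    with P exactly, which keeps the elimination local.\<close>
  define N where "N = ?N0 o\<^sub>L P"
  have N: "N x = ?N0 (P x)" for x by (simp add: N_def)
  have Ni: "N (\<i> *\<^sub>C x) = - (\<i> *\<^sub>C N x)" for x
    using antilinear_op_op_inverse[OF alR skR bbR] by (simp add: N PP antilinear_op_def)
  have Nsk: "inner (N x) y = - inner x (N y)" for x y
    using skew_op_op_inverse[OF skR bbR] N0P PP(4) by (simp add: N skew_op_def)
  have PN: "P (N x) = N x" and NP: "N (P x) = N x" for x by (simp_all add: N N0P PP)
  have PMN: "P (M (N x)) = P x" for x
  proof -
    have "R (N x) = P (M (N x))" by (simp add: R PN)
    then show ?thesis by (simp add: N inv)
  qed
  have NM: "N (M (P x)) = P x" for x
  proof -
    have "R (P x) = P (M (P x))" by (simp add: R PP)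
    then have "?N0 (P (M (P x))) = P x" by (metis inv(2))
    then show ?thesis by (simp add: N)
  qed
  \<comment> \<open>Off-diagonal multipliers of Gaussian elimination. Y is the adjoint of Z, because
    the signs of the skew M and N cancel; both square to zero, so 1 + t Y and 1 + t Z are the
    inverses needed.\<close>
  define Z where "Z = N o\<^sub>L (M o\<^sub>L Q)"
  define Y where "Y = Q o\<^sub>L (M o\<^sub>L N)"
  have Z: "Z x = N (M (x - P x))" for x by (simp add: Z_def Q)
  have Y: "Y x = M (N x) - P (M (N x))" for x by (simp add: Y_def Q)
  have PZ: "P (Z x) = Z x" and ZP: "Z (P x) = 0" for x by (simp_all add: Z PN PP)
  have PY: "P (Y x) = 0" and YP: "Y (P x) = Y x" for x by (simp_all add: Y NP blinfun.bilinear_simps PP)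
  have ZZ: "Z (Z x) = 0" for x using ZP[of "Z x"] by (simp add: PZ)
  have YY: "Y (Y x) = 0" for x using YP[of "Y x"] by (simp add: PY)
  have YZ: "inner (Y x) y = inner x (Z y)" for x y
  proof -
    have "inner (Y x) y = inner (M (N x)) (y - P y)" by (simp add: Y inner_diff PP(4))
    then show ?thesis by (simp add: Z Msk Nsk)
  qed
  have ZY: "inner x (Y y) = inner (Z x) y" for x y using YZ[of y x] by (simp add: inner_commute)
  have Zi: "Z (\<i> *\<^sub>C x) = \<i> *\<^sub>C Z x" and Yi: "Y (\<i> *\<^sub>C x) = \<i> *\<^sub>C Y x" for x
    using Ni[of "M (x - P x)"] Mi[of "x - P x"]
    by (simp_all add: Z Y PP Ni Mi blinfun.bilinear_simps scaleC.diff_right)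
  define g where "g t = (id_blinfun - t *\<^sub>R Y) o\<^sub>L (M o\<^sub>L (id_blinfun - t *\<^sub>R Z))" for t :: real
  have g: "g t x = M (x - t *\<^sub>R Z x) - t *\<^sub>R Y (M (x - t *\<^sub>R Z x))" for t x
    by (simp add: g_def blinfun.bilinear_simps scaleR_diff_right)
  have LF: "local_form P (g t)" for t
    unfolding local_form_def
  proof (intro conjI)
    show "antilinear_op (g t)"
      by (simp add: antilinear_op_def g Zi Mi Yi blinfun.bilinear_simps scaleC.diff_right
          scaleC.scaleR_right scaleR_diff_right)
    show "skew_op (g t)"
      by (simp add: skew_op_def g inner_diff scaleR_diff_right YZ ZY Msk blinfun.bilinear_simps algebra_simps)
    show "bounded_below (g t)"
      unfolding g_def
    proof (intro bounded_below_compose bb)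
      show "bounded_below (id_blinfun - t *\<^sub>R Y)"
        by (rule bounded_below_if_left_inverse[of "id_blinfun + t *\<^sub>R Y"])
          (simp add: blinfun.bilinear_simps YY)
      show "bounded_below (id_blinfun - t *\<^sub>R Z)"
        by (rule bounded_below_if_left_inverse[of "id_blinfun + t *\<^sub>R Z"])
          (simp add: blinfun.bilinear_simps ZZ)
    qed
    have lN: "commutes_mod_compact P N"
      by (intro commutes_mod_compactI blinfun_eqI) (simp add: PN NP)
    have lQ: "commutes_mod_compact P Q"
      by (intro commutes_mod_compactI blinfun_eqI) (simp add: Q blinfun.diff_right)
    show "commutes_mod_compact P (g t)"
      unfolding g_def Y_def Z_def
      by (intro commutes_mod_compact_compose commutes_mod_compact_diff commutes_mod_compact_id
          commutes_mod_compact_scaleR lN lQ lc)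
  qed
  have "g 0 = M" by (rule blinfun_eqI) (simp add: g)
  moreover have "continuous_on {0..1} g"
    unfolding g_def by (intro continuous_intros compose_continuous_on)
  ultimately have "path_component {M. local_form P M} M (g 1)"
    unfolding path_component_def using LF
    by (intro exI[of _ g]) (auto simp: path_def path_image_def pathstart_def pathfinish_def)
  \<comment> \<open>Z clears the block P M Q because P M N = P, and Y clears the block Q M P because
    N M P = P.\<close>
  moreover have "P (g 1 x) = g 1 (P x)" for x
  proof -
    have "g 1 (P x) = P (M (P x))"
      using NM[of x] by (simp add: g ZP Y)
    moreover have "P (g 1 (x - P x)) = 0"
    proof -
      have "Z (x - P x) = Z x" by (simp add: blinfun.diff_right ZP)
      then have "g 1 (x - P x) = M (x - P x - Z x) - Y (M (x - P x - Z x))" by (simp add: g)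
      moreover have "P (M (x - P x - Z x)) = 0" by (simp add: blinfun.diff_right Z PMN)
      ultimately show ?thesis by (simp only: blinfun.diff_right[of P] PY diff_self)
    qed
    moreover have "g 1 x = g 1 (P x) + g 1 (x - P x)" by (simp add: blinfun.diff_right)
    ultimately show ?thesis by (simp add: blinfun.add_right PP)
  qed
  ultimately show ?thesis using LF by blast
qed

lemma path_component_if_even:
  fixes P M J :: "'a::complex_hilbert_space \<Rightarrow>\<^sub>L 'a"
  assumes P: "projection_op P" and M: "local_quaternionic P M"
    and J: "local_quaternionic P J" "\<And>x. P (J x) = J (P x)"
    and even: "even (complex_vector.dim (form_kernel P M))"
  shows "path_component {M. local_quaternionic P M} M J"
proof -
  obtain n where "complex_vector.dim (form_kernel P M) = 2 * n" using even by blast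
  from form_kernel_reduce_even[OF P local_form_if_quaternionic[OF M] this]
  obtain M1 where M1: "path_component {M. local_form P M} M M1" "local_form P M1"
    "complex_vector.dim (form_kernel P M1) = 0" by blast
  have "form_kernel P M1 \<subseteq> {0}"
    using M1(3) cdim_eq_0_iff[OF complex_subspace_form_kernel[OF P local_form_antilinear[OF P M1(2)]]
        cfinite_dim_form_kernel[OF P M1(2)]] by simp
  from path_component_commuting_if_form_kernel_trivial[OF P M1(2) J this]
  obtain M2 where M2: "path_component {M. local_form P M} M1 M2" "local_form P M2"
    "\<And>x. P (M2 x) = M2 (P x)" by blast
  have "path_component {M. local_quaternionic P M} (phase M) (phase M2)"
    by (intro path_component_phase path_component_trans[OF M1(1) M2(1)])
  moreover have "path_component {M. local_quaternionic P M} (phase M2) J"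
    by (intro path_component_if_commute P J local_quaternionic_phase M2(2) phase_commute[OF M2(2)])
      (rule M2(3))
  ultimately show ?thesis
    using phase_of_quaternionic[OF M] by (metis path_component_trans)
qed

section \<open>Orthonormal families and the bilateral shift\<close>

text \<open>By Pythagoras the squared distance of two nested partial sums is a difference of partial
  sums of the convergent series of squares.\<close>

lemma summable_on_orthogonal:
  fixes v :: "'i \<Rightarrow> 'a::{real_inner,complete_space}"
  assumes orth: "\<And>i j. i \<noteq> j \<Longrightarrow> inner (v i) (v j) = 0"
    and sq: "(\<lambda>i. (norm (v i))\<^sup>2) summable_on UNIV"
  shows "v summable_on UNIV"
proof -
  let ?F = "finite_subsets_at_top (UNIV :: 'i set)"
  have pyth: "(norm (sum v F))\<^sup>2 = (\<Sum>i\<in>F. (norm (v i))\<^sup>2)" if "finite F" for F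
    using that by (intro norm_sum_Pythagorean) (auto simp: pairwise_def orthogonal_def orth)
  define L where "L = infsum (\<lambda>i. (norm (v i))\<^sup>2) UNIV"
  have lim: "((\<lambda>F. \<Sum>i\<in>F. (norm (v i))\<^sup>2) \<longlongrightarrow> L) ?F"
    using has_sum_infsum[OF sq] unfolding has_sum_def L_def .
  have "\<exists>P. eventually P ?F \<and> (\<forall>F G. P F \<and> P G \<longrightarrow> dist (sum v F) (sum v G) < e)" if e: "e > 0" for e
  proof -
    \<comment> \<open>Two partial sums of squares within d of L differ by less than 2 d =
      (e/2)^2.\<close>
    define d where "d = e\<^sup>2 / 8"
    have d: "d > 0" using e by (simp add: d_def)
    then obtain F0 where F0: "finite F0" "\<And>F. finite F \<Longrightarrow> F0 \<subseteq> F \<Longrightarrow> dist (\<Sum>i\<in>F. (norm (v i))\<^sup>2) L < d"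
      using tendstoD[OF lim d] unfolding eventually_finite_subsets_at_top by auto
    have close: "dist (sum v F) (sum v F0) < e/2" if F: "finite F" "F0 \<subseteq> F" for F
    proof -
      have "(dist (sum v F) (sum v F0))\<^sup>2 = (norm (sum v (F - F0)))\<^sup>2"
        using F by (simp add: dist_norm sum_diff)
      also have "\<dots> = (\<Sum>i\<in>F - F0. (norm (v i))\<^sup>2)" using F by (intro pyth) simp
      also have "\<dots> = (\<Sum>i\<in>F. (norm (v i))\<^sup>2) - (\<Sum>i\<in>F0. (norm (v i))\<^sup>2)"
        using F by (simp add: sum_diff)
      also have "\<dots> < 2 * d"
        using F0(2)[OF F] F0(2)[OF F0(1) order_refl] by (simp add: dist_real_def abs_if split: if_splits)
      also have "\<dots> = (e/2)\<^sup>2" by (simp add: d_def power2_eq_square)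
      finally show ?thesis by (rule power2_less_imp_less) (use e in simp)
    qed
    have "dist (sum v F) (sum v G) < e" if "finite F \<and> F0 \<subseteq> F" "finite G \<and> F0 \<subseteq> G" for F G
      using close[of F] close[of G] that dist_triangle2[of "sum v F" "sum v G" "sum v F0"] by linarith
    moreover have "eventually (\<lambda>F. finite F \<and> F0 \<subseteq> F) ?F"
      unfolding eventually_finite_subsets_at_top using F0(1) by blast
    ultimately show ?thesis by blast
  qed
  then have "cauchy_filter (filtermap (sum v) ?F)"
    by (simp add: cauchy_filter_metric_filtermap)
  then obtain s where "(sum v \<longlongrightarrow> s) ?F"
    using complete_uniform[where S="UNIV :: 'a set"] complete_UNIV by (force simp: filterlim_def)
  then show ?thesis using summable_on_def has_sum_def by blast
qed

definition orthonormal :: "('i \<Rightarrow> 'a::complex_hilbert_space) \<Rightarrow> bool" where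
  "orthonormal b \<longleftrightarrow> (\<forall>i j. cinner (b i) (b j) = (if i = j then 1 else 0))"

lemma norm_orthonormal_sum:
  assumes "orthonormal b" "finite F"
  shows "(norm (\<Sum>i\<in>F. z i *\<^sub>C b i))\<^sup>2 = (\<Sum>i\<in>F. (cmod (z i))\<^sup>2)"
proof -
  have n1: "norm (b i) = 1" for i
  proof -
    have "complex_of_real ((norm (b i))\<^sup>2) = 1"
      using assms(1) cinner_self[of "b i"] by (simp add: orthonormal_def)
    then have "(norm (b i))\<^sup>2 = 1" by (metis of_real_eq_1_iff)
    then show ?thesis using norm_ge_zero[of "b i"] by (simp add: power2_eq_1_iff)
  qed
  have "(norm (\<Sum>i\<in>F. z i *\<^sub>C b i))\<^sup>2 = (\<Sum>i\<in>F. (norm (z i *\<^sub>C b i))\<^sup>2)"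
    using assms by (intro norm_sum_Pythagorean)
      (auto simp: pairwise_def orthogonal_def inner_eq_Re_cinner cinner_scaleC_left
        cinner_scaleC_right orthonormal_def)
  then show ?thesis by (simp add: norm_scaleC n1)
qed

lemma bessel_inequality:
  assumes b: "orthonormal b" and F: "finite F"
  shows "(\<Sum>i\<in>F. (cmod (cinner (b i) x))\<^sup>2) \<le> (norm x)\<^sup>2"
proof -
  let ?s = "\<Sum>i\<in>F. cinner (b i) x *\<^sub>C b i"
  have "cinner x ?s = (\<Sum>i\<in>F. cinner (b i) x * cnj (cinner (b i) x))"
    by (simp add: cinner.sum_right cinner_scaleC_right cinner_commute[of x])
  also have "\<dots> = complex_of_real (\<Sum>i\<in>F. (cmod (cinner (b i) x))\<^sup>2)"
    by (simp only: of_real_sum complex_norm_square)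
  finally have "Re (cinner x ?s) = Re (complex_of_real (\<Sum>i\<in>F. (cmod (cinner (b i) x))\<^sup>2))"
    by (rule arg_cong)
  then have "inner x ?s = (\<Sum>i\<in>F. (cmod (cinner (b i) x))\<^sup>2)"
    by (simp only: inner_eq_Re_cinner Re_complex_of_real)
  moreover have "inner ?s ?s = (\<Sum>i\<in>F. (cmod (cinner (b i) x))\<^sup>2)"
    using norm_orthonormal_sum[OF assms] by (simp add: power2_norm_eq_inner)
  moreover have "inner (x - ?s) (x - ?s) = inner x x - 2 * inner x ?s + inner ?s ?s"
    by (simp add: inner_diff inner_commute)
  ultimately show ?thesis
    using inner_ge_zero[of "x - ?s"] by (simp add: power2_norm_eq_inner)
qed

text \<open>The sum over i of |c i><b i|: for orthonormal families it sends b i to c i and vanishes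
  on the complement of the b i. The source family comes first.\<close>

definition partial_isometry ::
    "('i \<Rightarrow> 'a::complex_hilbert_space) \<Rightarrow> ('i \<Rightarrow> 'a) \<Rightarrow> ('a \<Rightarrow>\<^sub>L 'a)" where
  "partial_isometry b c = Blinfun (\<lambda>x. infsum (\<lambda>i. cinner (b i) x *\<^sub>C c i) UNIV)"

text \<open>Bessel's inequality for b makes the coefficients square summable, and Pythagoras for c
  bounds the sum by \<open>norm x\<close>.\<close>

lemma has_sum_partial_isometry:
  fixes b c :: "'i \<Rightarrow> 'a::complex_hilbert_space"
  assumes b: "orthonormal b" and c: "orthonormal c"
  shows "((\<lambda>i. cinner (b i) x *\<^sub>C c i) has_sum partial_isometry b c x) UNIV"
proof -
  have sm: "(\<lambda>i. cinner (b i) x *\<^sub>C c i) summable_on UNIV" for x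
  proof (rule summable_on_orthogonal)
    have "norm (cinner (b i) x *\<^sub>C c i) = cmod (cinner (b i) x)" for i
      using norm_orthonormal_sum[OF c, of "{i}" "\<lambda>i. cinner (b i) x"] by simp
    moreover have "(\<lambda>i. (cmod (cinner (b i) x))\<^sup>2) summable_on UNIV"
      by (rule nonneg_bdd_above_summable_on) (auto intro!: bdd_aboveI2 bessel_inequality[OF b])
    ultimately show "(\<lambda>i. (norm (cinner (b i) x *\<^sub>C c i))\<^sup>2) summable_on UNIV" by simp
  qed (use c in \<open>simp add: inner_eq_Re_cinner cinner_scaleC_left cinner_scaleC_right orthonormal_def\<close>)
  define T where "T x = infsum (\<lambda>i. cinner (b i) x *\<^sub>C c i) UNIV" for x
  have T: "((\<lambda>i. cinner (b i) x *\<^sub>C c i) has_sum T x) UNIV" for x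
    unfolding T_def by (rule has_sum_infsum[OF sm])
  have "bounded_linear T"
  proof (rule bounded_linear_intro[where K=1])
    show "T (x + y) = T x + T y" for x y
      using has_sum_unique[OF T[of "x + y"]] has_sum_add[OF T[of x] T[of y]]
      by (simp add: cinner.add_right scaleC.add_left)
    show "T (r *\<^sub>R x) = r *\<^sub>R T x" for r x
      using has_sum_unique[OF T[of "r *\<^sub>R x"]] has_sum_scaleR[OF T[of x], of r]
      by (simp add: cinner.scaleR_right scaleC.scaleR_left)
    show "norm (T x) \<le> norm x * 1" for x
    proof (rule Lim_norm_ubound)
      show "(sum (\<lambda>i. cinner (b i) x *\<^sub>C c i) \<longlongrightarrow> T x) (finite_subsets_at_top UNIV)"
        using T[of x] by (simp add: has_sum_def)
      have "norm (\<Sum>i\<in>F. cinner (b i) x *\<^sub>C c i) \<le> norm x" if F: "finite F" for F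
      proof (rule power2_le_imp_le)
        show "(norm (\<Sum>i\<in>F. cinner (b i) x *\<^sub>C c i))\<^sup>2 \<le> (norm x)\<^sup>2"
          unfolding norm_orthonormal_sum[OF c F] by (rule bessel_inequality[OF b F])
      qed simp
      then show "\<forall>\<^sub>F F in finite_subsets_at_top UNIV. norm (\<Sum>i\<in>F. cinner (b i) x *\<^sub>C c i) \<le> norm x * 1"
        by (intro eventually_finite_subsets_at_top_weakI) simp
    qed simp
  qed
  then show ?thesis using T by (simp add: partial_isometry_def T_def[symmetric] bounded_linear_Blinfun_apply)
qed

lemma has_sum_single_term:
  assumes "\<And>i. i \<noteq> j \<Longrightarrow> f i = 0"
  shows "(f has_sum f j) UNIV"
  by (rule has_sum_finite_neutralI[of "{j}"]) (use assms in auto)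

context
  fixes b c :: "'i \<Rightarrow> 'a::complex_hilbert_space"
  assumes b: "orthonormal b" and c: "orthonormal c"
begin

lemma partial_isometry_scaleC: "partial_isometry b c (z *\<^sub>C x) = z *\<^sub>C partial_isometry b c x"
  using has_sum_unique[OF has_sum_partial_isometry[OF b c, of "z *\<^sub>C x"]]
    has_sum_bounded_linear[OF scaleC.bounded_linear_right has_sum_partial_isometry[OF b c, of x], of z]
  by (simp add: cinner_scaleC_right scaleC_scaleC)

lemma cinner_partial_isometry: "cinner (c j) (partial_isometry b c x) = cinner (b j) x"
proof -
  have "((\<lambda>i. cinner (c j) (cinner (b i) x *\<^sub>C c i)) has_sum cinner (c j) (partial_isometry b c x)) UNIV"
    by (intro has_sum_bounded_linear[OF cinner.bounded_linear_right] has_sum_partial_isometry b c)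
  moreover have "((\<lambda>i. cinner (c j) (cinner (b i) x *\<^sub>C c i)) has_sum cinner (c j) (cinner (b j) x *\<^sub>C c j)) UNIV"
    using c by (intro has_sum_single_term) (simp add: cinner_scaleC_right orthonormal_def)
  ultimately show ?thesis
    using has_sum_unique c by (fastforce simp: cinner_scaleC_right orthonormal_def)
qed

lemma partial_isometry_compose:
  assumes "orthonormal d"
  shows "partial_isometry c d (partial_isometry b c x) = partial_isometry b d x"
  using has_sum_unique[OF has_sum_partial_isometry[OF c assms, of "partial_isometry b c x"]]
    has_sum_partial_isometry[OF b assms, of x]
  by (simp add: cinner_partial_isometry)

lemma partial_isometry_adjoint: "inner (partial_isometry c b x) y = inner x (partial_isometry b c y)"
proof -
  have "((\<lambda>i. inner x (cinner (b i) y *\<^sub>C c i)) has_sum inner x (partial_isometry b c y)) UNIV"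
    by (intro has_sum_bounded_linear[OF bounded_linear_inner_right] has_sum_partial_isometry b c)
  moreover have "((\<lambda>i. inner (cinner (c i) x *\<^sub>C b i) y) has_sum inner (partial_isometry c b x) y) UNIV"
    by (intro has_sum_bounded_linear[OF bounded_linear_inner_left] has_sum_partial_isometry b c)
  moreover have "inner (cinner (c i) x *\<^sub>C b i) y = inner x (cinner (b i) y *\<^sub>C c i)" for i
    by (simp add: inner_eq_Re_cinner cinner_scaleC_left cinner_scaleC_right
        cinner_commute[of x "c i"] mult.commute)
  ultimately show ?thesis using has_sum_unique by fastforce
qed

end

text \<open>Unconditional sums can be reordered, so the shifted family has the same projection onto
  its closed span.\<close>

lemma partial_isometry_reindex:
  assumes "orthonormal b" "bij \<pi>"
  shows "partial_isometry (b \<circ> \<pi>) (b \<circ> \<pi>) = partial_isometry b b"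
proof (rule blinfun_eqI)
  fix x
  have "orthonormal (b \<circ> \<pi>)"
    using assms by (auto simp: orthonormal_def dest: bij_is_inj injD)
  then have "((\<lambda>i. cinner (b (\<pi> i)) x *\<^sub>C b (\<pi> i)) has_sum partial_isometry (b \<circ> \<pi>) (b \<circ> \<pi>) x) UNIV"
    using has_sum_partial_isometry by fastforce
  moreover have "((\<lambda>i. cinner (b (\<pi> i)) x *\<^sub>C b (\<pi> i)) has_sum partial_isometry b b x) UNIV"
    using has_sum_partial_isometry[OF assms(1,1)]
    by (subst has_sum_reindex_bij_betw[OF assms(2), of "\<lambda>i. cinner (b i) x *\<^sub>C b i"])
  ultimately show "partial_isometry (b \<circ> \<pi>) (b \<circ> \<pi>) x = partial_isometry b b x"
    by (rule has_sum_unique)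
qed

text \<open>
  The bilateral shift along an orthonormal family indexed by the integers whose nonnegative part
  lies in the range and whose negative part lies in the kernel of \<open>P\<close>.
\<close>

lemma exists_unitary_shift:
  fixes P :: "'a::complex_hilbert_space \<Rightarrow>\<^sub>L 'a"
  assumes P: "projection_op P" and inf: "\<not> cfinite_dim (range P)" "\<not> cfinite_dim {x. P x = 0}"
  obtains W W' :: "'a \<Rightarrow>\<^sub>L 'a" and e where "W \<in> bounded_ops" "\<And>x. W' (W x) = x" "\<And>x. W (W' x) = x"
    "\<And>x y. inner (W' x) y = inner x (W y)" "P e = e" "norm e = 1"
    "\<And>x. W (P x) = (P - rank_one e e) (W x)"
proof -
  note PP = projection_opD[OF P]
  have "range P = {x. P x = x}" using PP(1) by (auto intro: rangeI[of P] simp: image_iff) (metis)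
  then have "\<not> cfinite_dim {x. P x = x}" using inf(1) by simp
  moreover have "complex_vector.subspace {x. P x = x}" "complex_vector.subspace {x. P x = 0}"
    by (simp_all add: complex_vector.subspace_def blinfun.bilinear_simps PP)
  ultimately have ex_u: "\<exists>u :: nat \<Rightarrow> 'a. (\<forall>n. u n \<in> {x. P x = x}) \<and> (\<forall>m n. cinner (u m) (u n) = (if m = n then 1 else 0))"
    and ex_v: "\<exists>v :: nat \<Rightarrow> 'a. (\<forall>n. v n \<in> {x. P x = 0}) \<and> (\<forall>m n. cinner (v m) (v n) = (if m = n then 1 else 0))"
    using exists_orthonormal_sequence[of "{x. P x = x}"] exists_orthonormal_sequence[of "{x. P x = 0}"]
      inf(2) by blast+
  obtain u :: "nat \<Rightarrow> 'a" where u: "\<And>n. P (u n) = u n" "\<And>m n. cinner (u m) (u n) = (if m = n then 1 else 0)"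
    using ex_u by auto
  obtain v :: "nat \<Rightarrow> 'a" where v: "\<And>n. P (v n) = 0" "\<And>m n. cinner (v m) (v n) = (if m = n then 1 else 0)"
    using ex_v by auto
  have uv: "cinner (u m) (v n) = 0" for m n
    using PP(3)[of "u m" "v n"] by (simp add: u v cinner.zero_right)
  then have vu: "cinner (v n) (u m) = 0" for m n by (metis cinner_commute complex_cnj_zero_iff)
  \<comment> \<open>Here b (-1) = v 0 lies in the kernel and b 0 = u 0 in the range of P, so moving
    up by one carries exactly one vector across.\<close>
  define b where "b i = (if i \<ge> 0 then u (nat i) else v (nat (- i - 1)))" for i :: int
  have b: "orthonormal b"
    by (auto simp: orthonormal_def b_def u v uv vu)
  define d where "d = b \<circ> (\<lambda>i. i + 1)"
  have bij: "bij (\<lambda>i :: int. i + 1)" by (rule bij_betw_byWitness[where f'="\<lambda>i. i - 1"]) auto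
  have d: "orthonormal d" using b by (simp add: orthonormal_def d_def)
  have Qd: "partial_isometry d d = partial_isometry b b"
    unfolding d_def by (rule partial_isometry_reindex[OF b bij])
  define Q where "Q = partial_isometry b b"
  define T where "T = partial_isometry b d"
  define T' where "T' = partial_isometry d b"
  \<comment> \<open>The shift on the closed span of the family and the identity on its complement,
    since the family need not be complete.\<close>
  define W where "W = id_blinfun - Q + T"
  define W' where "W' = id_blinfun - Q + T'"
  have W: "W x = x - Q x + T x" and W': "W' x = x - Q x + T' x" for x
    by (simp_all add: W_def W'_def blinfun.bilinear_simps)
  have QQ: "Q (Q x) = Q x" and T'T: "T' (T x) = Q x" and TT': "T (T' x) = Q x"
    and QT: "Q (T x) = T x" and TQ: "T (Q x) = T x" and QT': "Q (T' x) = T' x" and T'Q: "T' (Q x) = T' x" for x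
    using partial_isometry_compose[OF b b b] partial_isometry_compose[OF b d b]
      partial_isometry_compose[OF d b d] partial_isometry_compose[OF b d d]
      partial_isometry_compose[OF b b d] partial_isometry_compose[OF d b b]
      partial_isometry_compose[OF d d b]
    by (simp_all add: Q_def T_def T'_def Qd)
  have Pb: "P (b i) = (if i \<ge> 0 then b i else 0)" for i by (simp add: b_def u v)
  have PQ: "P (Q x) = Q (P x)" for x
  proof -
    have "((\<lambda>i. P (cinner (b i) x *\<^sub>C b i)) has_sum P (Q x)) UNIV" unfolding Q_def
      by (intro has_sum_bounded_linear[OF blinfun.bounded_linear_right] has_sum_partial_isometry b)
    moreover have "((\<lambda>i. cinner (b i) (P x) *\<^sub>C b i) has_sum Q (P x)) UNIV" unfolding Q_def
      by (intro has_sum_partial_isometry b)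
    moreover have "P (cinner (b i) x *\<^sub>C b i) = cinner (b i) (P x) *\<^sub>C b i" for i
      by (simp add: PP(2) PP(3)[symmetric] Pb cinner.zero_left)
    ultimately show ?thesis using has_sum_unique by fastforce
  qed
  \<comment> \<open>Only i = -1 contributes: for every other index b i and b (i + 1) lie on the same
    side of P.\<close>
  have PT: "P (T x) - T (P x) = cinner (b (-1)) x *\<^sub>C b 0" for x
  proof -
    let ?f = "\<lambda>i. P (cinner (b i) x *\<^sub>C d i) - cinner (b i) (P x) *\<^sub>C d i"
    have s1: "((\<lambda>i. P (cinner (b i) x *\<^sub>C d i)) has_sum P (T x)) UNIV" unfolding T_def
      by (intro has_sum_bounded_linear[OF blinfun.bounded_linear_right] has_sum_partial_isometry b d)
    have "((\<lambda>i. cinner (b i) (P x) *\<^sub>C d i) has_sum T (P x)) UNIV" unfolding T_def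
      by (intro has_sum_partial_isometry b d)
    then have "((\<lambda>i. - (cinner (b i) (P x) *\<^sub>C d i)) has_sum - T (P x)) UNIV"
      by (simp add: has_sum_uminus)
    from has_sum_add[OF s1 this] have "(?f has_sum P (T x) - T (P x)) UNIV" by simp
    moreover have f: "?f i = cinner (b i) x *\<^sub>C P (d i) - cinner (P (b i)) x *\<^sub>C d i" for i
      by (simp add: PP(2) PP(3)[symmetric])
    have "?f i = 0" if "i \<noteq> - 1" for i
      unfolding f using that by (simp add: d_def Pb cinner.zero_left)
    then have "(?f has_sum ?f (-1)) UNIV" by (rule has_sum_single_term)
    ultimately have "P (T x) - T (P x) = ?f (-1)" by (rule has_sum_unique)
    also have "\<dots> = cinner (b (-1)) x *\<^sub>C b 0"
      unfolding f by (simp add: d_def Pb cinner.zero_left)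
    finally show ?thesis .
  qed
  have bW: "cinner (b 0) (W x) = cinner (b (-1)) x" for x
    using cinner_partial_isometry[OF b b, of 0 x] cinner_partial_isometry[OF b d, of "-1" x]
    by (simp add: W Q_def T_def d_def cinner.add_right cinner.diff_right)
  show thesis
  proof (rule that[of W W' "b 0"])
    show "W \<in> bounded_ops"
      using partial_isometry_scaleC[OF b b] partial_isometry_scaleC[OF b d]
      by (intro bounded_opsI) (simp add: W Q_def T_def scaleC.diff_right scaleC.add_right)
    show "W' (W x) = x" "W (W' x) = x" for x
      by (simp_all add: W W' blinfun.bilinear_simps QQ T'T TT' QT TQ QT' T'Q)
    show "inner (W' x) y = inner x (W y)" for x y
      using partial_isometry_adjoint[OF b b] partial_isometry_adjoint[OF b d]
      by (simp add: W W' Q_def T_def T'_def inner_add inner_diff)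
    show "P (b 0) = b 0" by (simp add: Pb)
    show "norm (b 0) = 1"
      using norm_orthonormal_sum[OF b, of "{0}" "\<lambda>_. 1"] norm_ge_zero[of "b 0"]
      by (simp add: power2_eq_1_iff)
    show "W (P x) = (P - rank_one (b 0) (b 0)) (W x)" for x
      using PT[of x] by (simp add: blinfun.diff_left bW)
        (simp add: W blinfun.bilinear_simps PQ algebra_simps)
  qed
qed

section \<open>The two components\<close>

lemma cdim_image:
  fixes W :: "'a::complex_hilbert_space \<Rightarrow>\<^sub>L 'a"
  assumes W: "W \<in> bounded_ops" "inj W"
  shows "complex_vector.dim (W ` K) = complex_vector.dim K"
proof -
  interpret W: Vector_Spaces.linear scaleC scaleC "blinfun_apply W"
    unfolding Vector_Spaces.linear_iff
    by (intro conjI complex_vector.vector_space_axioms allI blinfun.add_right bounded_ops_scaleC[OF W(1)])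
  obtain B where B: "B \<subseteq> K" "complex_vector.independent B" "K \<subseteq> complex_vector.span B"
      "card B = complex_vector.dim K"
    using complex_vector.basis_exists by blast
  have sp: "complex_vector.span K = complex_vector.span B"
    using complex_vector.span_mono[OF B(1)] complex_vector.span_minimal[OF B(3)] by auto
  have "complex_vector.independent (W ` B)"
    by (rule W.independent_injective_image[OF B(2)]) (rule inj_on_subset[OF W(2)], simp)
  have "complex_vector.dim (W ` K) = complex_vector.dim (complex_vector.span (W ` K))" by simp
  also have "complex_vector.span (W ` K) = complex_vector.span (W ` B)"
    by (simp add: W.span_image sp)
  also have "complex_vector.dim \<dots> = card (W ` B)"
    by (rule complex_vector.dim_span_eq_card_independent) fact
  also have "\<dots> = card B" using W(2) by (intro card_image) (auto intro: inj_on_subset)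
  finally show ?thesis using B(4) by simp
qed

lemma local_quaternionic_conjugate:
  fixes P M W W' :: "'a::complex_hilbert_space \<Rightarrow>\<^sub>L 'a"
  assumes M: "local_quaternionic P M"
    and W: "\<And>x. W (\<i> *\<^sub>C x) = \<i> *\<^sub>C blinfun_apply W x" "commutes_mod_compact P W"
    and W': "\<And>x. W' (\<i> *\<^sub>C x) = \<i> *\<^sub>C blinfun_apply W' x" "commutes_mod_compact P W'"
    and inv: "\<And>x. W (W' x) = x" "\<And>x. W' (W x) = x"
    and adj: "\<And>x y. inner (W' x) y = inner x (W y)"
  shows "local_quaternionic P (W' o\<^sub>L (M o\<^sub>L W))"
  unfolding local_quaternionic_def
proof (intro conjI allI)
  have M': "M (\<i> *\<^sub>C x) = - (\<i> *\<^sub>C M x)" "inner (M x) y = - inner x (M y)" "M (M x) = - x" for x y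
    using M by (auto simp: local_quaternionic_def antilinear_op_def skew_op_def)
  have adj': "inner (W x) y = inner x (W' y)" for x y using adj[of y x] by (simp add: inner_commute)
  show "antilinear_op (W' o\<^sub>L (M o\<^sub>L W))"
    by (simp add: antilinear_op_def W W' M' blinfun.bilinear_simps)
  show "skew_op (W' o\<^sub>L (M o\<^sub>L W))" by (simp add: skew_op_def adj M' adj')
  show "(W' o\<^sub>L (M o\<^sub>L W)) ((W' o\<^sub>L (M o\<^sub>L W)) x) = - x" for x
    by (simp add: inv M' blinfun.bilinear_simps)
  show "commutes_mod_compact P (W' o\<^sub>L (M o\<^sub>L W))"
    using M by (intro commutes_mod_compact_compose W W') (simp add: local_quaternionic_def)
qed

lemma cdim_form_kernel_commuting:
  fixes P J :: "'a::complex_hilbert_space \<Rightarrow>\<^sub>L 'a"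
  assumes P: "projection_op P" and J: "local_quaternionic P J" "\<And>x. P (J x) = J (P x)"
  shows "complex_vector.dim (form_kernel P J) = 0"
proof -
  have "form_kernel P J \<subseteq> {0}"
  proof
    fix y assume "y \<in> form_kernel P J"
    then have y: "P y = y" "P (J y) = 0" by (simp_all add: form_kernel_def)
    then have "J y = 0" using J(2)[of y] by simp
    then have "J (J y) = 0" by (simp add: blinfun.zero_right)
    then show "y \<in> {0}" using J(1) by (simp add: local_quaternionic_def)
  qed
  then show ?thesis
    using cdim_eq_0_iff[OF complex_subspace_form_kernel[OF P] cfinite_dim_form_kernel[OF P]]
      local_form_if_quaternionic[OF J(1)] J(1) by (simp add: local_quaternionic_def)
qed

text \<open>
  Conjugation by the shift turns the radical over the range of \<open>P\<close> into the radical over a hyperplane of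
  that range. It is therefore a homeomorphism exchanging the two parities, so that the odd structures
  form a single component because the even ones do.
\<close>

lemma exists_odd_structure:
  fixes P J :: "'a::complex_hilbert_space \<Rightarrow>\<^sub>L 'a"
  assumes P: "projection_op P" and inf: "\<not> cfinite_dim (range P)" "\<not> cfinite_dim {x. P x = 0}"
    and J: "local_quaternionic P J" "\<And>x. P (J x) = J (P x)"
  obtains N where "local_quaternionic P N" "odd (complex_vector.dim (form_kernel P N))"
    "\<And>M. local_quaternionic P M \<Longrightarrow> odd (complex_vector.dim (form_kernel P M)) \<Longrightarrow>
      path_component {M. local_quaternionic P M} M N"
proof -
  obtain W W' :: "'a \<Rightarrow>\<^sub>L 'a" and e where W: "W \<in> bounded_ops" "\<And>x. W' (W x) = x" "\<And>x. W (W' x) = x"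
    "\<And>x y. inner (W' x) y = inner x (W y)" "P e = e" "norm e = 1"
    "\<And>x. W (P x) = (P - rank_one e e) (W x)"
    by (rule exists_unitary_shift[OF P inf]) (rule that; assumption)
  note PP = projection_opD[OF P]
  have adj': "inner (W x) y = inner x (W' y)" for x y using W(4)[of y x] by (simp add: inner_commute)
  have Wi: "W (\<i> *\<^sub>C x) = \<i> *\<^sub>C W x" for x by (rule bounded_ops_scaleC[OF W(1)])
  have W'i: "W' (\<i> *\<^sub>C x) = \<i> *\<^sub>C W' x" for x by (metis W(2,3) Wi)
  have "(P o\<^sub>L W) - (W o\<^sub>L P) = rank_one e e o\<^sub>L W"
    by (rule blinfun_eqI) (simp add: blinfun.diff_left W(7))
  then have lW: "commutes_mod_compact P W"
    by (simp add: commutes_mod_compact_def compact_op_compose_right)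
  have lW': "commutes_mod_compact P W'"
    by (rule commutes_mod_compact_inverse[OF lW]) (auto intro!: blinfun_eqI simp: W)
  \<comment> \<open>W' is the adjoint of W, so F is a congruence and preserves skewness; no relation
    between W and J enters.\<close>
  define F where "F M = W' o\<^sub>L (M o\<^sub>L W)" for M
  define G where "G M = W o\<^sub>L (M o\<^sub>L W')" for M
  have F: "local_quaternionic P (F M)" if "local_quaternionic P M" for M
    unfolding F_def by (rule local_quaternionic_conjugate[OF that Wi lW W'i lW' W(3,2,4)])
  have G: "local_quaternionic P (G M)" if "local_quaternionic P M" for M
    unfolding G_def by (rule local_quaternionic_conjugate[OF that W'i lW' Wi lW W(2,3) adj'])
  have GF: "G (F M) = M" and FG: "F (G M) = M" for M
    by (simp_all add: F_def G_def blinfun_eqI W)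
  have parity: "odd (complex_vector.dim (form_kernel P M) + complex_vector.dim (form_kernel P (F M)))"
    if M: "local_quaternionic P M" for M
  proof -
    let ?P = "P - rank_one e e"
    have iff: "W y \<in> form_kernel ?P M \<longleftrightarrow> y \<in> form_kernel P (F M)" for y
    proof -
      have "?P (W y) = W y \<longleftrightarrow> P y = y" unfolding W(7)[symmetric] by (metis W(2))
      moreover have "?P (M (W y)) = W (P (F M y))" by (simp add: W(7) F_def W(3))
      then have "?P (M (W y)) = 0 \<longleftrightarrow> P (F M y) = 0" by (metis W(2) blinfun.zero_right)
      ultimately show ?thesis by (simp add: form_kernel_def)
    qed
    have "form_kernel ?P M = W ` form_kernel P (F M)"
    proof (intro set_eqI iffI)
      fix z assume "z \<in> form_kernel ?P M"
      then have "W' z \<in> form_kernel P (F M)" using iff[of "W' z"] by (simp add: W(3))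
      then show "z \<in> W ` form_kernel P (F M)" by (intro image_eqI[of _ _ "W' z"]) (simp add: W(3))
    qed (use iff in auto)
    moreover have "inj W" by (rule inj_on_inverseI[of _ W']) (rule W(2))
    ultimately have "complex_vector.dim (form_kernel ?P M) = complex_vector.dim (form_kernel P (F M))"
      by (simp add: cdim_image[OF W(1)])
    then show ?thesis
      using cdim_form_kernel_hyperplane[OF P local_form_if_quaternionic[OF M] W(5,6)] by simp
  qed
  show thesis
  proof (rule that[of "G J"])
    show "local_quaternionic P (G J)" by (rule G[OF J(1)])
    show "odd (complex_vector.dim (form_kernel P (G J)))"
      using parity[OF G[OF J(1)]] cdim_form_kernel_commuting[OF P J] by (simp add: FG)
    fix M assume M: "local_quaternionic P M" "odd (complex_vector.dim (form_kernel P M))"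
    let ?E = "{M. local_quaternionic P M}"
    have "path_component ?E (F M) J"
      using parity[OF M(1)] M(2) by (intro path_component_if_even[OF P F[OF M(1)] J]) simp
    then obtain g where g: "path g" "path_image g \<subseteq> ?E" "pathstart g = F M" "pathfinish g = J"
      unfolding path_component_def by blast
    have "continuous_on (path_image g) G"
      unfolding G_def by (intro continuous_intros compose_continuous_on)
    then have "path (G \<circ> g)" by (rule path_continuous_image[OF g(1)])
    moreover have "path_image (G \<circ> g) \<subseteq> ?E" using g(2) G unfolding path_image_compose by blast
    ultimately show "path_component ?E M (G J)"
      unfolding path_component_def using g(3,4)
      by (intro exI[of _ "G \<circ> g"]) (simp add: pathstart_compose pathfinish_compose GF)
  qed
qed

lemma of_nat_bit: "(of_nat n :: bit) = (if even n then 0 else 1)"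
  by (induction n) auto

section \<open>Translation between the unitaries U and the structures J U\<close>

locale quaternionic_projection =
  fixes \<Lambda> :: "'a::complex_hilbert_space \<Rightarrow>\<^sub>L 'a" and J :: "'a \<Rightarrow> 'a"
  assumes sa: "sa_projection \<Lambda>"
    and range_inf: "\<not> cfinite_dim (range \<Lambda>)" and ker_inf: "\<not> cfinite_dim {x. \<Lambda> x = 0}"
    and J_anti: "antiunitary J" and JJ: "J (J x) = - x" and J\<Lambda>: "J (\<Lambda> x) = \<Lambda> (J x)"
begin

lemma projection_\<Lambda>: "projection_op \<Lambda>"
proof -
  have L: "\<Lambda> \<in> bounded_ops" "\<Lambda> o\<^sub>L \<Lambda> = \<Lambda>" "cadj \<Lambda> = \<Lambda>" using sa by (auto simp: sa_projection_def)
  then have "\<Lambda> (\<Lambda> x) = \<Lambda> x" for x by (metis blinfun_apply_blinfun_compose)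
  moreover have "cinner (\<Lambda> x) y = cinner x (\<Lambda> y)" for x y using cinner_cadj[OF L(1), of x y] L(3) by simp
  ultimately show ?thesis using L(1) by (simp add: projection_op_def)
qed

lemma J_add: "J (x + y) = J x + J y" and J_scaleC: "J (c *\<^sub>C x) = cnj c *\<^sub>C J x"
  and cinner_J: "cinner (J x) (J y) = cnj (cinner x y)"
  using J_anti by (auto simp: antiunitary_def)

definition j :: "'a \<Rightarrow>\<^sub>L 'a" where "j = Blinfun J"

lemma j_apply [simp]: "j x = J x"
proof -
  have "bounded_linear J"
  proof (rule bounded_linear_intro[where K=1])
    show "J (r *\<^sub>R x) = r *\<^sub>R J x" for r x by (simp add: scaleR_scaleC J_scaleC)
    have "inner (J x) (J x) = inner x x" for x by (simp add: inner_eq_Re_cinner cinner_J)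
    then show "norm (J x) \<le> norm x * 1" for x by (simp add: norm_eq_sqrt_inner)
  qed (rule J_add)
  then show ?thesis by (simp add: j_def bounded_linear_Blinfun_apply)
qed

lemma J_minus: "J (- x) = - J x"
  by (metis blinfun.minus_right j_apply)

lemma J_skew: "inner (J x) y = - inner x (J y)"
proof -
  have "inner (J x) (J (J y)) = inner x (J y)" by (simp add: inner_eq_Re_cinner cinner_J)
  then show ?thesis by (simp add: JJ)
qed

lemma local_quaternionic_j: "local_quaternionic \<Lambda> j"
  unfolding local_quaternionic_def
  by (auto simp: antilinear_op_def skew_op_def J_scaleC scaleC.minus_left J_skew JJ J\<Lambda>
      intro!: commutes_mod_compactI blinfun_eqI)

text \<open>J U J U = J J U^* U = -1, and since J is skew, skewness of J U is the relation J U = U^*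
  J, equivalent to the given one by J^2 = -1.\<close>

lemma local_quaternionic_if_mem:
  assumes U: "U \<in> star_quaternionic_local_unitaries \<Lambda> J"
  shows "local_quaternionic \<Lambda> (j o\<^sub>L U)"
proof -
  have bU: "U \<in> bounded_ops" and UJ: "U (J x) = J (cadj U x)" for x
    using U by (auto simp: star_quaternionic_local_unitaries_def unitary_ops_def)
  have "cadj U o\<^sub>L U = id_blinfun"
    using U by (auto simp: star_quaternionic_local_unitaries_def unitary_ops_def)
  then have UU: "cadj U (U x) = x" for x
    by (metis blinfun_apply_blinfun_compose blinfun_apply_id_blinfun)
  have JU: "J (U x) = cadj U (J x)" for x
  proof -
    have "U (J (J x)) = J (cadj U (J x))" by (rule UJ)
    then have "J (U (- x)) = J (J (cadj U (J x)))" by (simp add: JJ)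
    then show ?thesis by (simp add: JJ blinfun.minus_right J_minus)
  qed
  have "compact_op ((\<Lambda> o\<^sub>L U) - (U o\<^sub>L \<Lambda>))"
    using U by (auto simp: star_quaternionic_local_unitaries_def local_ops_def compact_ops_def compact_op_def)
  then have "commutes_mod_compact \<Lambda> U" by (simp add: commutes_mod_compact_def)
  moreover have "commutes_mod_compact \<Lambda> j"
    using local_quaternionic_j by (simp add: local_quaternionic_def)
  ultimately have "commutes_mod_compact \<Lambda> (j o\<^sub>L U)" by (rule commutes_mod_compact_compose[rotated])
  moreover have "antilinear_op (j o\<^sub>L U)"
    by (simp add: antilinear_op_def bounded_ops_scaleC[OF bU] J_scaleC scaleC.minus_left)
  moreover have "skew_op (j o\<^sub>L U)"
    by (simp add: skew_op_def JU inner_cadj[OF bU] J_skew UJ)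
  moreover have "J (U (J (U x))) = - x" for x by (simp add: UJ UU JJ)
  ultimately show ?thesis by (simp add: local_quaternionic_def)
qed

text \<open>The inverse of U \<mapsto> J U is M \<mapsto> - J M because the inverse of J is - J. The
  adjoint of - J M is - M J, as J and M are both skew.\<close>

lemma mem_if_local_quaternionic:
  assumes M: "local_quaternionic \<Lambda> M"
  shows "- (j o\<^sub>L M) \<in> star_quaternionic_local_unitaries \<Lambda> J"
proof -
  have M': "M (\<i> *\<^sub>C x) = - (\<i> *\<^sub>C M x)" "inner (M x) y = - inner x (M y)" "M (M x) = - x" for x y
    using M by (auto simp: local_quaternionic_def antilinear_op_def skew_op_def)
  let ?U = "- (j o\<^sub>L M)" and ?V = "- (M o\<^sub>L j)"
  have Ux: "?U x = - J (M x)" and Vx: "?V x = - M (J x)" for x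
    by (simp_all add: blinfun.minus_left)
  have bU: "?U \<in> bounded_ops"
    by (rule bounded_opsI) (simp add: Ux M' J_scaleC J_minus scaleC.minus_left)
  have UV: "inner (?V x) y = inner x (?U y)" for x y by (simp add: Ux Vx M' J_skew)
  have Vi: "?V (\<i> *\<^sub>C x) = \<i> *\<^sub>C ?V x" for x
    by (simp add: Vx M' J_scaleC scaleC.minus_left blinfun.minus_right)
  have adj: "cadj ?U = ?V"
    by (rule cadj_eqI, rule cinner_eqI) (simp_all add: UV bounded_ops_scaleC[OF bU] del: blinfun_apply_blinfun_compose)
  have UM: "commutes_mod_compact \<Lambda> ?U"
    using M local_quaternionic_j
    by (intro commutes_mod_compact_uminus commutes_mod_compact_compose) (simp_all add: local_quaternionic_def)
  have "(\<Lambda> o\<^sub>L ?U) - (?U o\<^sub>L \<Lambda>) \<in> bounded_ops"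
    by (rule bounded_opsI) (simp add: blinfun.diff_left bounded_ops_scaleC[OF bU]
        projection_opD[OF projection_\<Lambda>] scaleC.diff_right)
  then have "?U \<in> local_ops \<Lambda>"
    using bU UM by (simp add: local_ops_def compact_ops_def commutes_mod_compact_def compact_op_def)
  moreover have "?U \<in> unitary_ops"
    using bU by (auto intro!: blinfun_eqI
        simp: unitary_ops_def adj blinfun.minus_left M' JJ J_minus blinfun.minus_right)
  moreover have "?U (J x) = J (cadj ?U x)" for x unfolding adj Ux Vx by (simp add: J_minus)
  ultimately show ?thesis by (simp add: star_quaternionic_local_unitaries_def)
qed

lemma j_inverse: "- (j o\<^sub>L (j o\<^sub>L U)) = U" "j o\<^sub>L - (j o\<^sub>L U) = U"
  by (auto intro!: blinfun_eqI simp: blinfun.bilinear_simps JJ J_minus)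

text \<open>Applying \<Lambda> splits the kernel equation into \<Lambda> x = x and \<Lambda> U x =
  0. The second can be tested after applying J, which is injective and commutes with
  \<Lambda>.\<close>

lemma index2_eq: "index2 \<Lambda> U = of_nat (complex_vector.dim (form_kernel \<Lambda> (j o\<^sub>L U)))"
proof -
  note LL = projection_opD[OF projection_\<Lambda>]
  have J0: "J x = 0 \<longleftrightarrow> x = 0" for x by (metis JJ J_minus neg_equal_0_iff_equal blinfun.zero_right j_apply)
  have "((\<Lambda> o\<^sub>L U o\<^sub>L \<Lambda>) + id_blinfun - \<Lambda>) x = 0 \<longleftrightarrow> x \<in> form_kernel \<Lambda> (j o\<^sub>L U)" for x
  proof
    assume "((\<Lambda> o\<^sub>L U o\<^sub>L \<Lambda>) + id_blinfun - \<Lambda>) x = 0"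
    then have 0: "\<Lambda> (U (\<Lambda> x)) + x - \<Lambda> x = 0" by (simp add: blinfun.bilinear_simps)
    then have "\<Lambda> (\<Lambda> (U (\<Lambda> x)) + x - \<Lambda> x) = 0" by (simp add: blinfun.zero_right)
    then have "\<Lambda> (U (\<Lambda> x)) = 0" by (simp add: blinfun.bilinear_simps LL)
    then show "x \<in> form_kernel \<Lambda> (j o\<^sub>L U)"
      using 0 by (simp add: form_kernel_def J\<Lambda>[symmetric] J0)
  next
    assume "x \<in> form_kernel \<Lambda> (j o\<^sub>L U)"
    then show "((\<Lambda> o\<^sub>L U o\<^sub>L \<Lambda>) + id_blinfun - \<Lambda>) x = 0"
      by (simp add: form_kernel_def J\<Lambda>[symmetric] J0 blinfun.bilinear_simps)
  qed
  then show ?thesis by (simp add: index2_def)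
qed

abbreviation "S \<equiv> star_quaternionic_local_unitaries \<Lambda> J"

lemma path_component_of_structures:
  assumes "path_component {M. local_quaternionic \<Lambda> M} (j o\<^sub>L U) M"
  shows "path_component S U (- (j o\<^sub>L M))"
proof -
  obtain g where g: "path g" "path_image g \<subseteq> {M. local_quaternionic \<Lambda> M}"
    "pathstart g = j o\<^sub>L U" "pathfinish g = M"
    using assms unfolding path_component_def by blast
  let ?h = "\<lambda>M. - (j o\<^sub>L M)"
  have "continuous_on (path_image g) ?h"
    by (intro continuous_intros compose_continuous_on)
  then have "path (?h \<circ> g)" by (rule path_continuous_image[OF g(1)])
  moreover have "path_image (?h \<circ> g) \<subseteq> S"
    using g(2) mem_if_local_quaternionic unfolding path_image_compose by blast
  ultimately show ?thesis
    unfolding path_component_def using g(3,4)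
    by (intro exI[of _ "?h \<circ> g"]) (simp add: pathstart_compose pathfinish_compose j_inverse)
qed

lemma exists_representatives:
  obtains U0 U1 where "U0 \<in> S" "index2 \<Lambda> U0 = 0" "U1 \<in> S" "index2 \<Lambda> U1 = 1"
    "\<And>U. U \<in> S \<Longrightarrow> index2 \<Lambda> U = 0 \<Longrightarrow> path_component S U U0"
    "\<And>U. U \<in> S \<Longrightarrow> index2 \<Lambda> U = 1 \<Longrightarrow> path_component S U U1"
proof -
  have \<Lambda>j: "\<Lambda> (j x) = j (\<Lambda> x)" for x by (simp add: J\<Lambda>)
  obtain N where N: "local_quaternionic \<Lambda> N" "odd (complex_vector.dim (form_kernel \<Lambda> N))"
    "\<And>M. local_quaternionic \<Lambda> M \<Longrightarrow> odd (complex_vector.dim (form_kernel \<Lambda> M)) \<Longrightarrow>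
      path_component {M. local_quaternionic \<Lambda> M} M N"
    using exists_odd_structure[OF projection_\<Lambda> range_inf ker_inf local_quaternionic_j \<Lambda>j] by blast
  have j: "even (complex_vector.dim (form_kernel \<Lambda> j))"
    by (simp add: cdim_form_kernel_commuting[OF projection_\<Lambda> local_quaternionic_j \<Lambda>j])
  show thesis
  \<comment> \<open>The even representative is the identity operator, since J^2 = -1.\<close>
  proof (rule that[of "- (j o\<^sub>L j)" "- (j o\<^sub>L N)"])
    show "- (j o\<^sub>L j) \<in> S" "- (j o\<^sub>L N) \<in> S"
      by (intro mem_if_local_quaternionic local_quaternionic_j N(1))+
    show "index2 \<Lambda> (- (j o\<^sub>L j)) = 0" "index2 \<Lambda> (- (j o\<^sub>L N)) = 1"
      using j N(2) by (simp_all add: index2_eq of_nat_bit j_inverse)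
    fix U assume U: "U \<in> S"
    show "path_component S U (- (j o\<^sub>L j))" if "index2 \<Lambda> U = 0"
      using that
      by (intro path_component_of_structures path_component_if_even[OF projection_\<Lambda> _ local_quaternionic_j \<Lambda>j]
          local_quaternionic_if_mem U) (simp add: index2_eq of_nat_bit split: if_splits)
    show "path_component S U (- (j o\<^sub>L N))" if "index2 \<Lambda> U = 1"
      using that
      by (intro path_component_of_structures N(3) local_quaternionic_if_mem U)
        (simp add: index2_eq of_nat_bit split: if_splits)
  qed
qed

text \<open>Composition with the isometry \<open>j\<close> does not increase distances, so local
  constancy of the parity passes from J U to U.\<close>

lemma continuous_map_index2: "continuous_map (top_of_set S) (discrete_topology UNIV) (index2 \<Lambda>)"
  unfolding continuous_map_def
proof (intro conjI allI impI)
  fix V :: "bit set"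
  show "openin (top_of_set S) {U \<in> topspace (top_of_set S). index2 \<Lambda> U \<in> V}"
    unfolding openin_contains_ball
  proof (intro conjI ballI)
    fix U0 assume "U0 \<in> {U \<in> topspace (top_of_set S). index2 \<Lambda> U \<in> V}"
    then have U0: "U0 \<in> S" "index2 \<Lambda> U0 \<in> V" by auto
    obtain r where r: "r > 0" "\<And>M. local_form \<Lambda> M \<Longrightarrow> norm (M - (j o\<^sub>L U0)) < r \<Longrightarrow>
        even (complex_vector.dim (form_kernel \<Lambda> M) + complex_vector.dim (form_kernel \<Lambda> (j o\<^sub>L U0)))"
      using form_kernel_parity_locally_constant[OF projection_\<Lambda>
          local_form_if_quaternionic[OF local_quaternionic_if_mem[OF U0(1)]]] by blast
    have "index2 \<Lambda> U = index2 \<Lambda> U0" if U: "U \<in> S" "dist U U0 < r" for U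
    proof -
      have "(j o\<^sub>L U) - (j o\<^sub>L U0) = j o\<^sub>L (U - U0)"
        by (rule blinfun_eqI) (simp add: blinfun.bilinear_simps flip: j_apply)
      moreover have "norm j \<le> 1"
        by (rule norm_blinfun_bound)
          (use local_quaternionic_j norm_quaternionic[of j] in \<open>auto simp: local_quaternionic_def\<close>)
      then have "norm (j o\<^sub>L (U - U0)) \<le> 1 * norm (U - U0)"
        by (intro order_trans[OF norm_blinfun_compose] mult_right_mono) auto
      ultimately have "norm ((j o\<^sub>L U) - (j o\<^sub>L U0)) < r" using U(2) by (simp add: dist_norm)
      from r(2)[OF local_form_if_quaternionic[OF local_quaternionic_if_mem[OF U(1)]] this]
      show ?thesis by (auto simp: index2_eq of_nat_bit)
    qed
    then have "ball U0 r \<inter> S \<subseteq> {U \<in> topspace (top_of_set S). index2 \<Lambda> U \<in> V}"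
      using U0(2) by (simp add: subset_eq dist_commute)
    then show "\<exists>e>0. ball U0 e \<inter> S \<subseteq> {U \<in> topspace (top_of_set S). index2 \<Lambda> U \<in> V}"
      using r(1) by blast
  qed auto
qed auto

text \<open>A connected set has a one-point image in the discrete space of indices; conversely both
  operators are joined to the common representative of their index.\<close>

lemma path_component_of_iff:
  assumes "U \<in> S" "V \<in> S"
  shows "path_component_of (top_of_set S) U V \<longleftrightarrow> index2 \<Lambda> U = index2 \<Lambda> V"
proof
  assume "path_component_of (top_of_set S) U V"
  then obtain T where T: "path_connectedin (top_of_set S) T" "U \<in> T" "V \<in> T"
    unfolding path_component_of by blast
  have "connectedin (discrete_topology UNIV) (index2 \<Lambda> ` T)"
    by (intro connectedin_continuous_map_image[OF continuous_map_index2] path_connectedin_imp_connectedin T)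
  then show "index2 \<Lambda> U = index2 \<Lambda> V" using T(2,3) unfolding connectedin_discrete_topology by blast
next
  assume eq: "index2 \<Lambda> U = index2 \<Lambda> V"
  obtain U0 U1 where reps: "\<And>U. U \<in> S \<Longrightarrow> index2 \<Lambda> U = 0 \<Longrightarrow> path_component S U U0"
    "\<And>U. U \<in> S \<Longrightarrow> index2 \<Lambda> U = 1 \<Longrightarrow> path_component S U U1"
    by (rule exists_representatives) (rule that; assumption)
  have "path_component S U V"
  proof (cases "index2 \<Lambda> V = 0")
    case True
    then show ?thesis
      using path_component_trans[OF reps(1)[OF assms(1)] path_component_sym[OF reps(1)[OF assms(2)]]] eq
      by simp
  next
    case False
    then show ?thesis
      using path_component_trans[OF reps(2)[OF assms(1)] path_component_sym[OF reps(2)[OF assms(2)]]] eq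
      by simp
  qed
  then obtain g where "path g" "path_image g \<subseteq> S" "pathstart g = U" "pathfinish g = V"
    unfolding path_component_def by blast
  then show "path_component_of (top_of_set S) U V"
    unfolding path_component_of_def pathin_def
    by (intro exI[of _ g]) (auto simp: path_def path_image_def pathstart_def pathfinish_def
        continuous_map_in_subtopology)
qed

end

theorem theorem3p3:
  fixes \<Lambda> :: "'a::complex_hilbert_space \<Rightarrow>\<^sub>L 'a" and J :: "'a \<Rightarrow> 'a"
  assumes "separable_space (euclidean :: 'a topology)"
    and "\<not> cfinite_dim (UNIV :: 'a set)"
    and "sa_projection \<Lambda>"
    and "\<not> cfinite_dim (range (blinfun_apply \<Lambda>))"
    and "\<not> cfinite_dim {x. blinfun_apply \<Lambda> x = 0}"
    and "antiunitary J"
    and "\<forall>x. J (J x) = - x"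
    and "\<forall>x. J (blinfun_apply \<Lambda> x) = blinfun_apply \<Lambda> (J x)"
  defines "X \<equiv> top_of_set (star_quaternionic_local_unitaries \<Lambda> J)"
  shows "card (path_components_of X) = 2 \<and>
    continuous_map X (discrete_topology UNIV) (index2 \<Lambda>) \<and>
    (\<exists>f. bij_betw f (path_components_of X) (UNIV :: bit set) \<and>
         (\<forall>U \<in> topspace X. f (path_component_of_set X U) = index2 \<Lambda> U))"
proof -
  interpret quaternionic_projection \<Lambda> J
    by unfold_locales (use assms in auto)
  have X: "topspace X = S" by (simp add: X_def)
  have iff: "path_component_of X U V \<longleftrightarrow> index2 \<Lambda> U = index2 \<Lambda> V" if "U \<in> S" "V \<in> S" for U V
    unfolding X_def by (rule path_component_of_iff[OF that])
  \<comment> \<open>The choice of a point does not matter on a path component, where the index is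
    constant.\<close>
  define f where "f C = index2 \<Lambda> (SOME U. U \<in> C)" for C
  have f: "f (path_component_of_set X U) = index2 \<Lambda> U" if U: "U \<in> S" for U
  proof -
    have "U \<in> path_component_of_set X U" using iff[OF U U] by simp
    then have "(SOME V. V \<in> path_component_of_set X U) \<in> path_component_of_set X U" by (rule someI)
    moreover have "path_component_of_set X U \<subseteq> S"
      using path_component_of_subset_topspace[of X U] by (simp add: X)
    ultimately show ?thesis using iff[OF U] by (auto simp: f_def)
  qed
  have bij: "bij_betw f (path_components_of X) (UNIV :: bit set)"
    unfolding bij_betw_def
  proof
    show "inj_on f (path_components_of X)"
    proof (rule inj_onI)
      fix C D assume "C \<in> path_components_of X" "D \<in> path_components_of X" and eq: "f C = f D"
      then obtain U V where UV: "U \<in> S" "V \<in> S" "C = path_component_of_set X U" "D = path_component_of_set X V"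
        by (auto simp: path_components_of_def X)
      then have "path_component_of X U V" using eq iff f by simp
      then have "path_component_of X U = path_component_of X V"
        using path_component_of_equiv[of X U V] by blast
      then show "C = D" by (simp add: UV(3,4))
    qed
    obtain U0 U1 where "U0 \<in> S" "index2 \<Lambda> U0 = 0" "U1 \<in> S" "index2 \<Lambda> U1 = 1"
      by (rule exists_representatives) (rule that; assumption)
    then have "f (path_component_of_set X U0) = 0" "f (path_component_of_set X U1) = 1"
      "path_component_of_set X U0 \<in> path_components_of X" "path_component_of_set X U1 \<in> path_components_of X"
      by (simp_all add: f path_components_of_def X)
    then have "0 \<in> f ` path_components_of X" "1 \<in> f ` path_components_of X"
      by (metis image_eqI)+
    then have "b \<in> f ` path_components_of X" for b :: bit by (cases b) simp_all
    then show "f ` path_components_of X = (UNIV :: bit set)" by blast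
  qed
  have "card (UNIV :: bit set) = 2"
  proof -
    have UNIV_bit: "(UNIV :: bit set) = {0, 1}" using bit.exhaust by blast
    show ?thesis unfolding UNIV_bit by simp
  qed
  then have "card (path_components_of X) = 2" using bij_betw_same_card[OF bij] by simp
  moreover have "continuous_map X (discrete_topology UNIV) (index2 \<Lambda>)"
    unfolding X_def by (rule continuous_map_index2)
  moreover have "\<forall>U\<in>topspace X. f (path_component_of_set X U) = index2 \<Lambda> U" using f by (simp add: X)
  ultimately show ?thesis using bij by blast
qed

end
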